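(* Let $F=\frac1n\sum_{i=1}^n f_i:\mathbb{R}^d\to\mathbb{R}$ and $\mathbf{x}_0\in\mathbb{R}^d$ satisfy the following, with positive finite constants $\Delta_F,L,\rho,M$: (i) $F(\mathbf{x}_0)-\inf_{\mathbf{x}}F(\mathbf{x})\le\Delta_F$; (ii) for every $i$ and all $\mathbf{x},\mathbf{y}\in\mathbb{R}^d$, $\|\nabla f_i(\mathbf{x})-\nabla f_i(\mathbf{y})\|_2\le L\|\mathbf{x}-\mathbf{y}\|_2$ and $\|\nabla^2 f_i(\mathbf{x})-\nabla^2 f_i(\mathbf{y})\|_2\le\rho\|\mathbf{x}-\mathbf{y}\|_2$; (iii) $\|\nabla f_i(\mathbf{x})-\nabla F(\mathbf{x})\|_2\le M$ for all $\mathbf{x}\in\mathbb{R}^d$ and $i\in\{1,\dots,n\}$. Let $\epsilon>0$ and $\xi\in(0,1)$. Run the algorithm SRVRC (defined in the context) from $\mathbf{x}_0$ with cubic penalty parameters $M_t=4\rho$ for all $t$, epoch lengths $S^{(g)},S^{(h)}$ (positive integers), and total iteration number $T\ge 40\Delta_F\rho^{1/2}\epsilon^{-3/2}$. Suppose the batch sizes satisfy: for $t$ with $t \bmod S^{(g)}\ne 0$, $$B_t^{(g)}\ge n\land\frac{1440L^2S^{(g)}\|\mathbf{h}_{t-1}\|_2^2\log^2(2T/\xi)}{\epsilon^2};$$ for $t$ with $t\bmod S^{(h)}\neq 0$, $$B_t^{(h)}\ge n\land\frac{800\rho S^{(h)}\|\mathbf{h}_{t-1}\|_2^2\log^2(2Td/\xi)}{\epsilon};$$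 for $t$ with $t\bmod S^{(g)}=0$, $$B_t^{(g)}\ge n\land\frac{1440M^2\log^2(2T/\xi)}{\epsilon^2};$$ and for $t$ with $t\bmod S^{(h)}=0$, $$B_t^{(h)}\ge n\land\frac{800L^2\log^2(2Td/\xi)}{\rho\epsilon}.$$ Then with probability at least $1-\xi$, SRVRC outputs (within its $T$ iterations) a point $\mathbf{x}_{\mathrm{out}}$ satisfying $\mu(\mathbf{x}_{\mathrm{out}})\le 600\,\epsilon^{3/2}$, i.e. $\mathbf{x}_{\mathrm{out}}$ is, up to absolute constants, an $(\epsilon,\sqrt{\rho\epsilon})$-approximate local minimum of $F$.
   Context: Notation: $a\land b=\min\{a,b\}$; $\|\cdot\|_2$ is the Euclidean norm for vectors and the spectral norm for matrices; $\lambda_{\min}$ is the minimum eigenvalue of a symmetric matrix. All functions $f_i$ are twice differentiable. Define $\mu(\mathbf{x})=\max\{\|\nabla F(\mathbf{x})\|_2^{3/2},\,-\lambda_{\min}^3(\nabla^2F(\mathbf{x}))/\rho^{3/2}\}$. A point $\mathbf{x}$ is an $(\epsilon_g,\epsilon_H)$-approximate local minimum if $\|\nabla F(\mathbf{x})\|_2\le\epsilon_g$ and $\lambda_{\min}(\nabla^2F(\mathbf{x}))\ge-\epsilon_H$; thus $\mu(\mathbf{x})\le\epsilon^{3/2}$ iff $\mathbf{x}$ is an $(\epsilon,\sqrt{\rho\epsilon})$-approximate local minimum. Index sets are multisets. For an index multiset $\mathcal{I}$, $\nabla f_{\mathcal{I}}(\mathbf{x})=\frac1{|\mathcal{I}|}\sum_{i\in\mathcal{I}}\nabla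 f_i(\mathbf{x})$ if $|\mathcal{I}|<n$ and $\nabla f_{\mathcal I}(\mathbf{x})=\nabla F(\mathbf{x})$ otherwise; $\nabla^2 f_{\mathcal{I}}(\mathbf{x})$ is defined in the same way with Hessians. Sampling an index set of size $B$ means drawing $B$ indices i.i.d. uniformly from $\{1,\dots,n\}$, independently of everything previously drawn. Batch sizes are positive integers; $B_t^{(g)},B_t^{(h)}$ may depend on the history up to and including $\mathbf{x}_t$. Algorithm SRVRC (inputs $T$, $B^{(g)}_t,B^{(h)}_t$, $M_t$, $S^{(g)},S^{(h)}$, $\mathbf{x}_0$, $\epsilon$, $\rho$). For $t=0,\dots,T-1$: sample $\mathcal{J}_t$ with $|\mathcal{J}_t|=B_t^{(g)}$ and $\mathcal{I}_t$ with $|\mathcal{I}_t|=B_t^{(h)}$; set - $\mathbf{v}_t=\nabla f_{\mathcal{J}_t}(\mathbf{x}_t)$ if $t\bmod S^{(g)}=0$, and $\mathbf{v}_t=\nabla f_{\mathcal{J}_t}(\mathbf{x}_t)-\nabla f_{\mathcal{J}_t}(\mathbf{x}_{t-1})+\mathbf{v}_{t-1}$ otherwise; - $\mathbf{U}_t=\nabla^2 f_{\mathcal{I}_t}(\mathbf{x}_t)$ if $t\bmod S^{(h)}=0$, and $\mathbf{U}_t=\nabla^2 f_{\mathcal{I}_t}(\mathbf{x}_t)-\nabla^2 f_{\mathcal{I}_t}(\mathbf{x}_{t-1})+\mathbf{U}_{t-1}$ otherwise; - $\mathbf{h}_t\in\arg\min_{\mathbf{h}\in\mathbb{R}^d}m_t(\mathbf{h})$,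 where $m_t(\mathbf{h})=\langle\mathbf{v}_t,\mathbf{h}\rangle+\frac12\langle\mathbf{U}_t\mathbf{h},\mathbf{h}\rangle+\frac{M_t}{6}\|\mathbf{h}\|_2^3$; - $\mathbf{x}_{t+1}=\mathbf{x}_t+\mathbf{h}_t$. If $\|\mathbf{h}_t\|_2\le\sqrt{\epsilon/\rho}$, stop and output $\mathbf{x}_{\mathrm{out}}=\mathbf{x}_{t+1}$. *)

theory Defs
  imports "HOL-Probability.Probability" "HOL-Library.Multiset"
begin

definition gradient :: "('a::real_inner \<Rightarrow> real) \<Rightarrow> 'a \<Rightarrow> 'a" where
  "gradient f x = (THE D. GDERIV f x :> D)"

definition hessian :: "(real^'d \<Rightarrow> real) \<Rightarrow> real^'d \<Rightarrow> real^'d^'d" where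
  "hessian f x = jacobian (gradient f) (at x)"

definition twice_differentiable :: "(real^'d \<Rightarrow> real) \<Rightarrow> bool" where
  "twice_differentiable f \<longleftrightarrow>
     (\<forall>x. f differentiable (at x)) \<and> (\<forall>x. gradient f differentiable (at x))"

definition spectral_norm :: "real^'d^'d \<Rightarrow> real" where
  "spectral_norm A = onorm ((*v) A)"

text \<open>The spectrum is finite; it is nonempty, so that \<open>Min\<close> is meaningful, for symmetric \<open>A\<close>.\<close>

definition lambda_min :: "real^'d^'d \<Rightarrow> real" where
  "lambda_min A = Min {c. \<exists>v. v \<noteq> 0 \<and> A *v v = c *\<^sub>R v}"

definition mu :: "real \<Rightarrow> (real^'d \<Rightarrow> real) \<Rightarrow> real^'d \<Rightarrow> real" where
  "mu \<rho> F x = max (norm (gradient F x) powr (3/2))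
                    (- (lambda_min (hessian F x) ^ 3) / \<rho> powr (3/2))"

definition approx_local_min ::
    "(real^'d \<Rightarrow> real) \<Rightarrow> real \<Rightarrow> real \<Rightarrow> real^'d \<Rightarrow> bool" where
  "approx_local_min F \<epsilon>g \<epsilon>H x \<longleftrightarrow>
     norm (gradient F x) \<le> \<epsilon>g \<and> lambda_min (hessian F x) \<ge> - \<epsilon>H"

definition average :: "nat \<Rightarrow> (nat \<Rightarrow> 'a \<Rightarrow> real) \<Rightarrow> 'a \<Rightarrow> real" where
  "average n f x = (1 / real n) * (\<Sum>i\<in>{1..n}. f i x)"

text \<open>Subsampled derivatives; an index multiset of size at least \<open>n\<close> gives the exact ones.\<close>

definition batch_gradient ::
    "nat \<Rightarrow> (nat \<Rightarrow> real^'d \<Rightarrow> real) \<Rightarrow> nat multiset \<Rightarrow> real^'d \<Rightarrow> real^'d" where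
  "batch_gradient n f I x =
     (if size I < n then (1 / real (size I)) *\<^sub>R (\<Sum>i\<in>#I. gradient (f i) x)
      else gradient (average n f) x)"

definition batch_hessian ::
    "nat \<Rightarrow> (nat \<Rightarrow> real^'d \<Rightarrow> real) \<Rightarrow> nat multiset \<Rightarrow> real^'d \<Rightarrow> real^'d^'d" where
  "batch_hessian n f I x =
     (if size I < n then (1 / real (size I)) *\<^sub>R (\<Sum>i\<in>#I. hessian (f i) x)
      else hessian (average n f) x)"

definition sample_indices :: "nat \<Rightarrow> nat \<Rightarrow> nat multiset pmf" where
  "sample_indices n B = map_pmf mset (replicate_pmf B (pmf_of_set {1..n}))"

definition cubic_model ::
    "real^'d \<Rightarrow> real^'d^'d \<Rightarrow> real \<Rightarrow> real^'d \<Rightarrow> real" where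
  "cubic_model v U M h = inner v h + (1/2) * inner (U *v h) h + (M/6) * norm h ^ 3"

record ('d::finite) iteration =
  iter_x :: "real^'d"
  iter_J :: "nat multiset"
  iter_I :: "nat multiset"
  iter_v :: "real^'d"
  iter_U :: "real^'d^'d"
  iter_h :: "real^'d"

text \<open>
  A history is the list of the iterations performed so far, most recent first: while the
  algorithm is running, \<open>length \<omega> = t\<close> at the start of iteration \<open>t\<close>, and \<open>hd \<omega>\<close> is
  iteration \<open>t - 1\<close>.
\<close>

type_synonym 'd history = "'d iteration list"

definition current_point :: "real^'d \<Rightarrow> 'd history \<Rightarrow> real^'d" where
  "current_point x0 \<omega> = (if \<omega> = [] then x0 else iter_x (hd \<omega>) + iter_h (hd \<omega>))"

definition stopped :: "real \<Rightarrow> real \<Rightarrow> 'd::finite history \<Rightarrow> bool" where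
  "stopped \<epsilon> \<rho> \<omega> \<longleftrightarrow> \<omega> \<noteq> [] \<and> norm (iter_h (hd \<omega>)) \<le> sqrt (\<epsilon> / \<rho>)"

text \<open>
  The batch size rules \<open>Bg\<close>, \<open>Bh\<close> are functions of the history, which determines the current
  point. The minimizer of the cubic model need not be unique: \<open>pick \<omega> J I S\<close> selects an element
  of the set \<open>S\<close> of minimizers by a rule, possibly randomized, that may depend on everything
  drawn so far.
\<close>

definition srvrc_step ::
    "nat \<Rightarrow> (nat \<Rightarrow> real^'d \<Rightarrow> real) \<Rightarrow> real^'d \<Rightarrow> real \<Rightarrow> real \<Rightarrow> (nat \<Rightarrow> real)
     \<Rightarrow> nat \<Rightarrow> nat \<Rightarrow> ('d history \<Rightarrow> nat) \<Rightarrow> ('d history \<Rightarrow> nat)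
     \<Rightarrow> ('d history \<Rightarrow> nat multiset \<Rightarrow> nat multiset \<Rightarrow> (real^'d) set \<Rightarrow> (real^'d) pmf)
     \<Rightarrow> 'd history \<Rightarrow> 'd history pmf" where
  "srvrc_step n f x0 \<epsilon> \<rho> M Sg Sh Bg Bh pick \<omega> =
     (if stopped \<epsilon> \<rho> \<omega> then return_pmf \<omega>
      else do {
        J \<leftarrow> sample_indices n (Bg \<omega>);
        I \<leftarrow> sample_indices n (Bh \<omega>);
        let t = length \<omega>;
        let x = current_point x0 \<omega>;
        let v = (if t mod Sg = 0 then batch_gradient n f J x
                 else batch_gradient n f J x - batch_gradient n f J (iter_x (hd \<omega>))
                      + iter_v (hd \<omega>));
        let U = (if t mod Sh = 0 then batch_hessian n f I x
                 else batch_hessian n f I x - batch_hessian n f I (iter_x (hd \<omega>))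
                      + iter_U (hd \<omega>));
        h \<leftarrow> pick \<omega> J I {h. is_arg_min (cubic_model v U (M t)) (\<lambda>_. True) h};
        return_pmf (\<lparr>iter_x = x, iter_J = J, iter_I = I, iter_v = v, iter_U = U, iter_h = h\<rparr> # \<omega>)
      })"

text \<open>The law of the history after at most \<open>t\<close> iterations; stopped histories are absorbing.\<close>

primrec srvrc ::
    "nat \<Rightarrow> (nat \<Rightarrow> real^'d \<Rightarrow> real) \<Rightarrow> real^'d \<Rightarrow> real \<Rightarrow> real \<Rightarrow> (nat \<Rightarrow> real)
     \<Rightarrow> nat \<Rightarrow> nat \<Rightarrow> ('d history \<Rightarrow> nat) \<Rightarrow> ('d history \<Rightarrow> nat)
     \<Rightarrow> ('d history \<Rightarrow> nat multiset \<Rightarrow> nat multiset \<Rightarrow> (real^'d) set \<Rightarrow> (real^'d) pmf)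
     \<Rightarrow> nat \<Rightarrow> 'd history pmf" where
  "srvrc n f x0 \<epsilon> \<rho> M Sg Sh Bg Bh pick 0 = return_pmf []"
| "srvrc n f x0 \<epsilon> \<rho> M Sg Sh Bg Bh pick (Suc t) =
     srvrc n f x0 \<epsilon> \<rho> M Sg Sh Bg Bh pick t \<bind> srvrc_step n f x0 \<epsilon> \<rho> M Sg Sh Bg Bh pick"

definition srvrc_output ::
    "real^'d \<Rightarrow> real \<Rightarrow> real \<Rightarrow> 'd history \<Rightarrow> (real^'d) option" where
  "srvrc_output x0 \<epsilon> \<rho> \<omega> = (if stopped \<epsilon> \<rho> \<omega> then Some (current_point x0 \<omega>) else None)"

end

theory Submission
  imports Defs
begin

text \<open>
  Call an iteration good if its estimates satisfy \<open>norm (v - \<nabla>F x) \<le> \<epsilon> / 5\<close> and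
  \<open>spectral_norm (U - \<nabla>\<^sup>2F x) \<le> sqrt (\<rho> \<epsilon>) / 4\<close>, and let \<open>s = sqrt (\<epsilon> / \<rho>)\<close> be the stopping radius. The
  argument has a deterministic and a probabilistic half.

  Suppose that all iterations are good. The cubic model bounds \<open>F\<close> from above up to the estimation errors, so a
  step longer than \<open>s\<close> decreases \<open>F\<close> by at least \<open>7/40 \<rho> s\<^sup>3\<close> (\<open>cubic_step_descent\<close>). Since \<open>T\<close> such
  steps would decrease \<open>F\<close> by more than the initial gap \<open>\<Delta>\<close> (\<open>total_descent\<close>), some step is at most \<open>s\<close>. At
  the point reached by that step, optimality in the cubic model gives a gradient of norm at most \<open>3 \<epsilon>\<close> and a
  smallest Hessian eigenvalue of at least \<open>- 7 sqrt (\<rho> \<epsilon>)\<close> (\<open>cubic_step_stop\<close>).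

  It remains to see that all iterations are good with probability at least \<open>1 - \<xi>\<close>. Within an epoch, the errors
  of the recursive estimators are martingales whose increments after the initial one are bounded by a multiple of
  the length of the previous step, and the batch sizes are chosen to cancel that length. Concentration without unwanted dependence on the dimension
  comes from two potentials: \<open>cosh (norm e)\<close> for vectors and the trace of \<open>cosh E\<close> for symmetric matrices. Adding a
  perturbation with mean zero and norm at most \<open>c\<close> increases their mean by a factor of at most \<open>exp (c\<^sup>2 / 2)\<close>
  (\<open>sum_cosh_norm_le\<close>, \<open>sum_trace_cosh_le\<close>). For vectors this is convexity of \<open>cosh (sqrt s)\<close>. For matrices it
  is a comparison of the potential along the line \<open>A + t X\<close> with \<open>cosh (c t)\<close>, based on the trace
  inequality \<open>trace_sandwich_le\<close>; it replaces both the spectral theorem and the Golden-Thompson inequality. The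
  initial value of the matrix potential is the dimension, which enters the tail bound (\<open>estimator_tail\<close>) as a mere
  prefactor and is absorbed by the logarithm in the Hessian batch sizes. A union bound over the two
  estimators and the \<open>T\<close> iterations, each failing with probability at most \<open>\<xi> / (2 T)\<close>, completes the proof.
\<close>

section \<open>Traces of matrix powers\<close>

text \<open>Powers of a square matrix with respect to the matrix product \<open>**\<close>.\<close>

definition matpow :: "real^'d^'d \<Rightarrow> nat \<Rightarrow> real^'d^'d" where
  "matpow A k = (((**) A) ^^ k) (mat 1)"

lemma matpow_0 [simp]: "matpow A 0 = mat 1"
  by (simp add: matpow_def)

lemma matpow_Suc: "matpow A (Suc k) = A ** matpow A k"
  by (simp add: matpow_def)

lemma matpow_add: "matpow A (j + k) = matpow A j ** matpow A k"
  by (induction j) (simp_all add: matpow_Suc matrix_mul_assoc)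

lemma matpow_Suc': "matpow A (Suc k) = matpow A k ** A"
  using matpow_add[of A k 1] by (simp add: matpow_Suc)

lemma transpose_matpow: "transpose A = A \<Longrightarrow> transpose (matpow A k) = matpow A k"
proof (induction k)
  case (Suc k)
  then show ?case
    by (simp add: matpow_Suc matrix_transpose_mul) (metis matpow_Suc matpow_Suc')
qed simp

text \<open>The inner product on matrices is the Frobenius one.\<close>

lemma trace_transpose_mult: "trace (transpose A ** B) = inner A (B :: real^'d^'d)"
proof -
  have "trace (transpose A ** B) = (\<Sum>i\<in>UNIV. \<Sum>k\<in>UNIV. A$k$i * B$k$i)"
    by (simp add: trace_def matrix_matrix_mult_def transpose_def)
  also have "\<dots> = (\<Sum>k\<in>UNIV. \<Sum>i\<in>UNIV. A$k$i * B$k$i)"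
    by (rule sum.swap)
  finally show ?thesis by (simp add: inner_vec_def)
qed

lemma bounded_bilinear_matrix_mult:
  "bounded_bilinear ((**) :: real^'d^'d \<Rightarrow> real^'d^'d \<Rightarrow> real^'d^'d)"
  unfolding bilinear_conv_bounded_bilinear[symmetric] bilinear_def
  by (intro conjI allI linearI)
     (simp_all add: matrix_matrix_mult_def vec_eq_iff sum.distrib sum_distrib_left algebra_simps)

lemmas mmult_zero_left = bounded_bilinear.zero_left[OF bounded_bilinear_matrix_mult]
lemmas mmult_zero_right = bounded_bilinear.zero_right[OF bounded_bilinear_matrix_mult]
lemmas mmult_sum_left = bounded_bilinear.sum_left[OF bounded_bilinear_matrix_mult]
lemmas mmult_sum_right = bounded_bilinear.sum_right[OF bounded_bilinear_matrix_mult]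

lemma bounded_linear_trace: "bounded_linear (trace :: real^'d^'d \<Rightarrow> real)"
proof -
  have "linear (trace :: real^'d^'d \<Rightarrow> real)"
    by (rule linearI) (simp_all add: trace_def sum.distrib sum_distrib_left)
  then show ?thesis by (simp add: linear_conv_bounded_linear)
qed

lemma trace_zero: "trace (0 :: real^'d^'d) = 0"
  by (simp add: trace_def)

lemma has_vector_derivative_matpow:
  fixes A X :: "real^'d^'d" and t :: real
  defines "Y \<equiv> \<lambda>t. A + t *\<^sub>R X"
  shows "((\<lambda>t. matpow (Y t) m) has_vector_derivative
           (\<Sum>j<m. matpow (Y t) j ** X ** matpow (Y t) (m - 1 - j))) (at t)"
proof (induction m)
  case 0
  then show ?case by simp
next
  case (Suc m)
  have Y: "(Y has_vector_derivative X) (at t)"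
    unfolding Y_def by (auto intro!: derivative_eq_intros)
  have "((\<lambda>t. Y t ** matpow (Y t) m) has_vector_derivative
      (Y t ** (\<Sum>j<m. matpow (Y t) j ** X ** matpow (Y t) (m - 1 - j)) + X ** matpow (Y t) m)) (at t)"
    by (rule bounded_bilinear.has_vector_derivative[OF bounded_bilinear_matrix_mult Y Suc])
  moreover have "Y t ** (\<Sum>j<m. matpow (Y t) j ** X ** matpow (Y t) (m - 1 - j)) + X ** matpow (Y t) m
     = (\<Sum>j<Suc m. matpow (Y t) j ** X ** matpow (Y t) (Suc m - 1 - j))"
    unfolding sum.lessThan_Suc_shift mmult_sum_right by (simp add: matpow_Suc matrix_mul_assoc)
  ultimately show ?case by (simp add: matpow_Suc)
qed

text \<open>By cyclicity of the trace, all terms of the noncommutative product rule coincide.\<close>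

lemma trace_matpow_deriv:
  fixes A X :: "real^'d^'d"
  shows "((\<lambda>t. trace (matpow (A + t *\<^sub>R X) m)) has_real_derivative
           real m * trace (matpow (A + t *\<^sub>R X) (m - 1) ** X)) (at t)"
proof -
  let ?Y = "A + t *\<^sub>R X"
  have "((\<lambda>t. trace (matpow (A + t *\<^sub>R X) m)) has_vector_derivative
          trace (\<Sum>j<m. matpow ?Y j ** X ** matpow ?Y (m - 1 - j))) (at t)"
    by (rule bounded_linear.has_vector_derivative[OF bounded_linear_trace has_vector_derivative_matpow])
  moreover have "trace (\<Sum>j<m. matpow ?Y j ** X ** matpow ?Y (m - 1 - j))
      = (\<Sum>j<m. trace (matpow ?Y (m - 1) ** X))"
    unfolding linear_sum[OF bounded_linear.linear[OF bounded_linear_trace]]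
  proof (rule sum.cong)
    fix j assume "j \<in> {..<m}"
    then have "m - 1 = (m - 1 - j) + j" by auto
    then have e: "matpow ?Y (m - 1) = matpow ?Y (m - 1 - j) ** matpow ?Y j"
      by (simp only: matpow_add[symmetric])
    have "trace (matpow ?Y j ** X ** matpow ?Y (m - 1 - j))
        = trace (matpow ?Y (m - 1 - j) ** (matpow ?Y j ** X))"
      by (rule trace_mul_sym)
    also have "\<dots> = trace (matpow ?Y (m - 1) ** X)"
      by (simp only: e matrix_mul_assoc)
    finally show "trace (matpow ?Y j ** X ** matpow ?Y (m - 1 - j)) = trace (matpow ?Y (m - 1) ** X)" .
  qed simp
  ultimately show ?thesis by (simp add: has_real_derivative_iff_has_vector_derivative)
qed

lemma trace_matpow_mult_deriv:
  fixes A X :: "real^'d^'d"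
  shows "((\<lambda>t. trace (matpow (A + t *\<^sub>R X) m ** X)) has_real_derivative
           (\<Sum>j<m. trace (matpow (A + t *\<^sub>R X) j ** X ** matpow (A + t *\<^sub>R X) (m - 1 - j) ** X))) (at t)"
proof -
  have *: "bounded_linear (\<lambda>Z. trace (Z ** X))"
    by (rule bounded_linear_compose[OF bounded_linear_trace
              bounded_bilinear.bounded_linear_left[OF bounded_bilinear_matrix_mult]])
  have "((\<lambda>t. trace (matpow (A + t *\<^sub>R X) m ** X)) has_vector_derivative
          trace ((\<Sum>j<m. matpow (A + t *\<^sub>R X) j ** X ** matpow (A + t *\<^sub>R X) (m - 1 - j)) ** X)) (at t)"
    by (rule bounded_linear.has_vector_derivative[OF * has_vector_derivative_matpow])
  then show ?thesis
    by (simp add: has_real_derivative_iff_has_vector_derivative mmult_sum_left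
        linear_sum[OF bounded_linear.linear[OF bounded_linear_trace]])
qed

lemma norm_matrix_mult_le:
  fixes X Z :: "real^'d^'d"
  assumes "\<And>u. norm (X *v u) \<le> c * norm u" "c \<ge> 0"
  shows "norm (X ** Z) \<le> c * norm Z"
proof -
  have tr: "norm Z ^ 2 = (\<Sum>j\<in>UNIV. norm (column j Z) ^ 2)" for Z :: "real^'d^'d"
  proof -
    have "norm Z ^ 2 = (\<Sum>i\<in>UNIV. \<Sum>j\<in>UNIV. Z$i$j ^ 2)"
      by (simp only: power2_norm_eq_inner) (simp add: inner_vec_def power2_eq_square)
    also have "\<dots> = (\<Sum>j\<in>UNIV. \<Sum>i\<in>UNIV. Z$i$j ^ 2)" by (rule sum.swap)
    also have "\<dots> = (\<Sum>j\<in>UNIV. norm (column j Z) ^ 2)"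
      by (simp only: power2_norm_eq_inner) (simp add: inner_vec_def column_def power2_eq_square)
    finally show ?thesis .
  qed
  have col: "column j (X ** Z) = X *v column j Z" for j
    by (simp add: vec_eq_iff column_def matrix_matrix_mult_def matrix_vector_mult_def)
  have "norm (X ** Z) ^ 2 \<le> (\<Sum>j\<in>UNIV. (c * norm (column j Z)) ^ 2)"
    unfolding tr col by (intro sum_mono power_mono assms) auto
  also have "\<dots> = (c * norm Z) ^ 2"
    by (simp add: power_mult_distrib tr sum_distrib_left)
  finally show ?thesis by (rule power2_le_imp_le) (simp add: assms(2))
qed

text \<open>A maximum principle: a discretely convex function is bounded by its values at the end points.\<close>

lemma discrete_convex_le_ends:
  fixes b :: "nat \<Rightarrow> real"
  assumes conv: "\<And>p. 0 < p \<Longrightarrow> p < k \<Longrightarrow> 2 * b p \<le> b (p - 1) + b (p + 1)"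
    and ends: "b 0 \<le> B" "b k \<le> B" and "p \<le> k"
  shows "b p \<le> B"
proof (rule ccontr)
  assume "\<not> b p \<le> B"
  define m where "m = Max (b ` {..k})"
  have mle: "b q \<le> m" if "q \<le> k" for q unfolding m_def using that by auto
  have "m > B" using mle[OF \<open>p \<le> k\<close>] \<open>\<not> b p \<le> B\<close> by simp
  have "m \<in> b ` {..k}" unfolding m_def by (rule Max_in) auto
  then have ex: "\<exists>q. q \<le> k \<and> b q = m" by auto
  define q where "q = (LEAST q. q \<le> k \<and> b q = m)"
  have q: "q \<le> k" "b q = m" using LeastI_ex[OF ex] by (auto simp: q_def)
  have "0 < q" "q < k" using q ends \<open>m > B\<close> by (auto intro!: gr0I simp: le_less)
  have "b (q - 1) \<noteq> m"
    using not_less_Least[of "q - 1" "\<lambda>q. q \<le> k \<and> b q = m"] \<open>0 < q\<close> q(1)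
    unfolding q_def[symmetric] by auto
  moreover have "b (q - 1) \<le> m" using mle q(1) by simp
  ultimately have "b (q - 1) < m" by simp
  moreover have "b (q + 1) \<le> m" using mle \<open>q < k\<close> by simp
  ultimately show False using conv[OF \<open>0 < q\<close> \<open>q < k\<close>] q(2) by simp
qed

text \<open>The key estimate on the second derivative of a power trace. For even exponents \<open>j = 2 p\<close> the
  left-hand side is the squared Frobenius norm \<open>b p\<close> of \<open>Y\<^sup>p X Y\<^sup>k\<^sup>-\<^sup>p\<close>. By the Cauchy-Schwarz inequality
  \<open>b\<close> is discretely convex and dominates the odd exponents, and its two end values equal the squared
  norm of \<open>X Y\<^sup>k\<close>. No diagonalization of \<open>Y\<close> is needed.\<close>

lemma trace_sandwich_le:
  fixes X Y :: "real^'d^'d"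
  assumes symX: "transpose X = X" and symY: "transpose Y = Y"
    and X: "\<And>u. norm (X *v u) \<le> c * norm u" "c \<ge> 0" and j: "j \<le> 2 * k"
  shows "trace (matpow Y j ** X ** matpow Y (2 * k - j) ** X) \<le> c\<^sup>2 * trace (matpow Y (2 * k))"
proof -
  define Z where "Z p = matpow Y p ** X ** matpow Y (k - p)" for p
  define b where "b p = inner (Z p) (Z p)" for p
  have mix: "inner (Z p) (Z q) = trace (matpow Y (p + q) ** X ** matpow Y (2 * k - (p + q)) ** X)"
    if "p \<le> k" "q \<le> k" for p q
  proof -
    have "inner (Z p) (Z q) = trace (matpow Y (k - p) ** (X ** (matpow Y p ** (matpow Y q ** X ** matpow Y (k - q)))))"
      by (simp add: trace_transpose_mult[symmetric] Z_def matrix_transpose_mul symX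
            transpose_matpow[OF symY] matrix_mul_assoc)
    also have "\<dots> = trace ((X ** (matpow Y p ** (matpow Y q ** X ** matpow Y (k - q)))) ** matpow Y (k - p))"
      by (rule trace_mul_sym)
    also have "\<dots> = trace (X ** (matpow Y (p + q) ** X ** (matpow Y ((k - q) + (k - p)))))"
      by (simp add: matpow_add matrix_mul_assoc)
    also have "\<dots> = trace ((matpow Y (p + q) ** X ** (matpow Y ((k - q) + (k - p)))) ** X)"
      by (rule trace_mul_sym)
    finally have "inner (Z p) (Z q) = trace ((matpow Y (p + q) ** X ** (matpow Y ((k - q) + (k - p)))) ** X)" .
    moreover have "(k - q) + (k - p) = 2 * k - (p + q)" using that by simp
    ultimately show ?thesis by simp
  qed
  have norm_b: "b p = norm (Z p) ^ 2" for p by (simp add: b_def power2_norm_eq_inner)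
  have cs: "2 * inner (Z p) (Z q) \<le> b p + b q" for p q
  proof -
    have "0 \<le> inner (Z p - Z q) (Z p - Z q)" by simp
    then show ?thesis by (simp add: b_def inner_diff_left inner_diff_right inner_commute)
  qed
  have pw: "norm (matpow Y k) ^ 2 = trace (matpow Y (2 * k))"
    unfolding power2_norm_eq_inner trace_transpose_mult[symmetric] transpose_matpow[OF symY]
    by (simp add: mult_2 matpow_add)
  have bk: "b 0 \<le> c\<^sup>2 * trace (matpow Y (2 * k))"
  proof -
    have "norm (X ** matpow Y k) \<le> c * norm (matpow Y k)" by (rule norm_matrix_mult_le[OF X])
    then have "norm (X ** matpow Y k) ^ 2 \<le> (c * norm (matpow Y k)) ^ 2" by (rule power_mono) simp
    then show ?thesis by (simp add: norm_b Z_def power_mult_distrib pw)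
  qed
  have "b k = b 0"
  proof -
    have "trace (matpow Y (k + k) ** X ** matpow Y (2 * k - (k + k)) ** X)
        = trace (matpow Y (2 * k) ** (X ** X))" by (simp add: mult_2 matrix_mul_assoc)
    also have "\<dots> = trace ((X ** X) ** matpow Y (2 * k))" by (rule trace_mul_sym)
    also have "\<dots> = trace (X ** (X ** matpow Y (2 * k)))" by (simp add: matrix_mul_assoc)
    also have "\<dots> = trace ((X ** matpow Y (2 * k)) ** X)" by (rule trace_mul_sym)
    finally show ?thesis using mix[of k k] mix[of 0 0] by (simp add: b_def)
  qed
  then have ble: "b p \<le> c\<^sup>2 * trace (matpow Y (2 * k))" if "p \<le> k" for p
  proof (intro discrete_convex_le_ends[where b = b, OF _ bk _ that])
    fix p assume p: "0 < p" "p < k"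
    have "(p - 1) + (p + 1) = p + p" using p by simp
    then have "b p = inner (Z (p - 1)) (Z (p + 1))"
      using mix[of p p] mix[of "p - 1" "p + 1"] p unfolding b_def by simp
    then show "2 * b p \<le> b (p - 1) + b (p + 1)" using cs[of "p - 1" "p + 1"] by simp
  qed (use bk in simp)
  obtain p q where pq: "p \<le> k" "q \<le> k" "j = p + q"
  proof
    show "j div 2 \<le> k" "j - j div 2 \<le> k" "j = j div 2 + (j - j div 2)" using j by auto
  qed
  show ?thesis using cs[of p q] ble[OF pq(1)] ble[OF pq(2)] mix[OF pq(1,2)] pq(3) by simp
qed

section \<open>The hyperbolic cosine potential on symmetric matrices\<close>

lemma trace_matpow_even:
  assumes "transpose A = A"
  shows "trace (matpow A (2 * k)) = norm (matpow A k) ^ 2"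
  unfolding power2_norm_eq_inner trace_transpose_mult[symmetric] transpose_matpow[OF assms]
  by (simp add: mult_2 matpow_add)

text \<open>A function with \<open>\<phi>'' \<le> c\<^sup>2 \<phi>\<close> and zero initial slope grows at most like the solution \<open>cosh (c t)\<close> of the
  corresponding equation, because the Wronskian \<open>w\<close> of the two is nonincreasing.\<close>

lemma cosh_comparison:
  fixes \<phi> \<phi>' \<phi>'' :: "real \<Rightarrow> real"
  assumes d1: "\<And>t. (\<phi> has_real_derivative \<phi>' t) (at t)"
    and d2: "\<And>t. (\<phi>' has_real_derivative \<phi>'' t) (at t)"
    and bound: "\<And>t. 0 \<le> t \<Longrightarrow> t \<le> 1 \<Longrightarrow> \<phi>'' t \<le> c\<^sup>2 * \<phi> t" and init: "\<phi>' 0 = 0"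
  shows "\<phi> 1 \<le> cosh c * \<phi> 0"
proof -
  define w where "w t = \<phi>' t * cosh (c * t) - c * \<phi> t * sinh (c * t)" for t
  have dw: "(w has_real_derivative (\<phi>'' t - c\<^sup>2 * \<phi> t) * cosh (c * t)) (at t)" for t
    unfolding w_def
    by (rule derivative_eq_intros d1 d2 refl | simp)+ (simp add: algebra_simps power2_eq_square)
  have w: "w t \<le> 0" if "0 \<le> t" "t \<le> 1" for t
  proof -
    have "w t \<le> w 0"
    proof (rule DERIV_nonpos_imp_nonincreasing[OF that(1)])
      fix x assume "0 \<le> x" "x \<le> t"
      then have "(\<phi>'' x - c\<^sup>2 * \<phi> x) * cosh (c * x) \<le> 0"
        using bound[of x] that by (intro mult_nonpos_nonneg) auto
      then show "\<exists>y. DERIV w x :> y \<and> y \<le> 0" using dw by blast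
    qed
    then show ?thesis by (simp add: w_def init)
  qed
  define q where "q t = \<phi> t / cosh (c * t)" for t
  have dq: "(q has_real_derivative w t / (cosh (c * t))\<^sup>2) (at t)" for t
    unfolding q_def w_def
    by (rule derivative_eq_intros d1 refl | simp)+ (simp add: power2_eq_square algebra_simps)
  have "q 1 \<le> q 0"
  proof (rule DERIV_nonpos_imp_nonincreasing[of 0 1])
    fix x :: real assume "0 \<le> x" "x \<le> 1"
    then have "w x / (cosh (c * x))\<^sup>2 \<le> 0" using w by (simp add: divide_nonpos_nonneg)
    then show "\<exists>y. DERIV q x :> y \<and> y \<le> 0" using dq by blast
  qed simp
  then show ?thesis by (simp add: q_def field_simps)
qed

text \<open>Comparison along the lines \<open>A + t X i\<close>: the first derivative at \<open>0\<close> is linear in \<open>X i\<close>, so it vanishes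
  after summation over \<open>i\<close>, and the second derivative is controlled by \<open>trace_sandwich_le\<close>. Truncating the
  power series keeps everything polynomial in \<open>t\<close>; differentiating twice lowers the order of truncation,
  which only helps since all terms are nonnegative.\<close>

lemma sum_trace_cosh_truncated:
  fixes A :: "real^'d^'d" and X :: "'i \<Rightarrow> real^'d^'d"
  assumes symA: "transpose A = A" and symX: "\<And>i. i \<in> I \<Longrightarrow> transpose (X i) = X i"
    and X: "\<And>i u. i \<in> I \<Longrightarrow> norm (X i *v u) \<le> c * norm u" "c \<ge> 0"
    and mean: "(\<Sum>i\<in>I. X i) = 0"
  shows "(\<Sum>i\<in>I. \<Sum>k<N. trace (matpow (A + X i) (2 * k)) / fact (2 * k))
         \<le> cosh c * (real (card I) * (\<Sum>k<N. trace (matpow A (2 * k)) / fact (2 * k)))"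
proof -
  define Y where "Y i t = A + t *\<^sub>R X i" for i t
  have symY: "transpose (Y i t) = Y i t" if "i \<in> I" for i t
    using symA symX[OF that] by (simp add: Y_def transpose_def vec_eq_iff)
  define \<phi> where "\<phi> t = (\<Sum>i\<in>I. \<Sum>k<N. trace (matpow (Y i t) (2 * k)) / fact (2 * k))" for t
  define \<phi>' where "\<phi>' t = (\<Sum>i\<in>I. \<Sum>k<N. real (2 * k) * trace (matpow (Y i t) (2 * k - 1) ** X i) / fact (2 * k))" for t
  define \<phi>'' where "\<phi>'' t = (\<Sum>i\<in>I. \<Sum>k<N. real (2 * k) *
      (\<Sum>j<2 * k - 1. trace (matpow (Y i t) j ** X i ** matpow (Y i t) (2 * k - 1 - 1 - j) ** X i)) / fact (2 * k))" for t
  have "\<phi> 1 \<le> cosh c * \<phi> 0"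
  proof (rule cosh_comparison[where \<phi>' = \<phi>' and \<phi>'' = \<phi>''])
    show "(\<phi> has_real_derivative \<phi>' t) (at t)" for t
      unfolding \<phi>_def \<phi>'_def Y_def
      by (intro DERIV_sum DERIV_cdivide trace_matpow_deriv)
    show "(\<phi>' has_real_derivative \<phi>'' t) (at t)" for t
      unfolding \<phi>'_def \<phi>''_def Y_def
      by (intro DERIV_sum DERIV_cdivide DERIV_cmult trace_matpow_mult_deriv)
    show "\<phi>'' t \<le> c\<^sup>2 * \<phi> t" for t
      unfolding \<phi>''_def \<phi>_def sum_distrib_left[of "c\<^sup>2"]
    proof (rule sum_mono)
      fix i assume i: "i \<in> I"
      have nn: "0 \<le> trace (matpow (Y i t) (2 * k))" for k
        by (simp add: trace_matpow_even[OF symY[OF i]])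
      let ?g = "\<lambda>k. trace (matpow (Y i t) (2 * k)) / fact (2 * k)"
      have step: "real (2 * Suc k) * (\<Sum>j<2 * Suc k - 1. trace (matpow (Y i t) j ** X i
            ** matpow (Y i t) (2 * Suc k - 1 - 1 - j) ** X i)) / fact (2 * Suc k) \<le> c\<^sup>2 * ?g k" for k
      proof -
        have "(\<Sum>j<2 * Suc k - 1. trace (matpow (Y i t) j ** X i
            ** matpow (Y i t) (2 * Suc k - 1 - 1 - j) ** X i)) \<le> (\<Sum>j<2 * Suc k - 1. c\<^sup>2 * trace (matpow (Y i t) (2 * k)))"
          by (rule sum_mono, simp, rule trace_sandwich_le[OF symX[OF i] symY[OF i] X(1)[OF i] X(2)]) auto
        also have "\<dots> = real (2 * k + 1) * (c\<^sup>2 * trace (matpow (Y i t) (2 * k)))" by simp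
        finally have "real (2 * Suc k) * (\<Sum>j<2 * Suc k - 1. trace (matpow (Y i t) j ** X i
            ** matpow (Y i t) (2 * Suc k - 1 - 1 - j) ** X i)) / fact (2 * Suc k)
            \<le> real (2 * Suc k) * (real (2 * k + 1) * (c\<^sup>2 * trace (matpow (Y i t) (2 * k)))) / fact (2 * Suc k)"
          by (intro divide_right_mono mult_left_mono) auto
        also have "\<dots> = c\<^sup>2 * ?g k"
        proof -
          have "fact (2 * Suc k) = real (2 * Suc k) * (real (2 * k + 1) * fact (2 * k))"
            by (simp add: algebra_simps)
          moreover have "p * (q * (a * b)) / (p * (q * e)) = a * (b / e)" if "p \<noteq> 0" "q \<noteq> 0" for p q a b e :: real
            using that by simp
          ultimately show ?thesis by (metis of_nat_eq_0_iff add_is_0 mult_is_0 nat.simps(3) zero_neq_numeral one_neq_zero)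
        qed
        finally show ?thesis .
      qed
      show "(\<Sum>k<N. real (2 * k) * (\<Sum>j<2 * k - 1. trace (matpow (Y i t) j ** X i
            ** matpow (Y i t) (2 * k - 1 - 1 - j) ** X i)) / fact (2 * k)) \<le> (\<Sum>k<N. c\<^sup>2 * ?g k)"
      proof (cases N)
        case (Suc N')
        have "(\<Sum>k<N. real (2 * k) * (\<Sum>j<2 * k - 1. trace (matpow (Y i t) j ** X i
            ** matpow (Y i t) (2 * k - 1 - 1 - j) ** X i)) / fact (2 * k)) \<le> (\<Sum>k<N'. c\<^sup>2 * ?g k)"
          unfolding Suc sum.lessThan_Suc_shift using sum_mono[of "{..<N'}", OF step] by simp
        also have "\<dots> \<le> (\<Sum>k<N. c\<^sup>2 * ?g k)"
          by (rule sum_mono2) (use Suc nn in auto)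
        finally show ?thesis .
      qed simp
    qed
    show "\<phi>' 0 = 0"
    proof -
      have "\<phi>' 0 = (\<Sum>k<N. real (2 * k) * trace (matpow A (2 * k - 1) ** (\<Sum>i\<in>I. X i)) / fact (2 * k))"
        unfolding \<phi>'_def mmult_sum_right linear_sum[OF bounded_linear.linear[OF bounded_linear_trace]]
        by (subst sum.swap) (simp add: Y_def sum_distrib_left sum_divide_distrib)
      then show ?thesis unfolding mean by (simp add: mmult_zero_right trace_zero)
    qed
  qed
  then show ?thesis by (simp add: \<phi>_def Y_def)
qed

lemma cosh_sums_even: "(\<lambda>k. x ^ (2 * k) / fact (2 * k)) sums cosh (x::real)"
proof -
  have "(\<lambda>k. if even (2 * k) then x ^ (2 * k) /\<^sub>R fact (2 * k) else 0) sums cosh x"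
    by (subst sums_mono_reindex[of "\<lambda>k. 2 * k" "\<lambda>n. if even n then x ^ n /\<^sub>R fact n else 0"])
       (auto simp: strict_mono_def cosh_converges image_iff elim!: evenE)
  then show ?thesis by (simp add: divide_inverse mult.commute)
qed

lemma cosh_le_exp_square: "cosh (x::real) \<le> exp (x\<^sup>2 / 2)"
proof -
  have exp_sums: "(\<lambda>k. y ^ k / fact k) sums exp y" for y :: real
    using exp_converges[of y] by (simp add: divide_inverse mult.commute)
  have f: "2 ^ k * fact k \<le> (fact (2 * k) :: real)" for k
  proof (induction k)
    case (Suc k)
    have "2 ^ Suc k * fact (Suc k) = real (2 * Suc k) * (2 ^ k * fact k)" by simp
    also have "\<dots> \<le> real (2 * Suc k) * (real (2 * k + 1) * fact (2 * k))"
      using Suc.IH by (intro mult_left_mono order_trans[OF Suc.IH]) auto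
    also have "\<dots> = fact (2 * Suc k)" by (simp add: algebra_simps)
    finally show ?case .
  qed simp
  show ?thesis
  proof (rule sums_le[OF _ cosh_sums_even exp_sums])
    fix k
    have "x ^ (2 * k) / fact (2 * k) \<le> x ^ (2 * k) / (2 ^ k * fact k)"
      by (intro divide_left_mono f) (auto simp: power_mult)
    also have "\<dots> = (x\<^sup>2 / 2) ^ k / fact k" by (simp add: power_mult power_divide)
    finally show "x ^ (2 * k) / fact (2 * k) \<le> (x\<^sup>2 / 2) ^ k / fact k" .
  qed
qed

text \<open>The trace of the hyperbolic cosine of a matrix, through its power series. With values in
  \<^typ>\<open>ennreal\<close>, no convergence has to be discussed; the definition is meant for symmetric
  matrices, where all terms are nonnegative.\<close>

definition trace_cosh :: "real^'d^'d \<Rightarrow> ennreal" where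
  "trace_cosh A = (\<Sum>k. ennreal (trace (matpow A (2 * k)) / fact (2 * k)))"

lemma trace_cosh_0: "trace_cosh (0 :: real^'d^'d) = ennreal (real CARD('d))"
proof -
  have "trace (matpow (0 :: real^'d^'d) (2 * k)) = 0" if "k > 0" for k
    using that by (cases k) (simp_all add: matpow_Suc mmult_zero_left trace_zero)
  then have "trace_cosh (0 :: real^'d^'d) = (\<Sum>k\<in>{0}. ennreal (trace (matpow (0 :: real^'d^'d) (2 * k)) / fact (2 * k)))"
    unfolding trace_cosh_def by (intro suminf_finite) auto
  then show ?thesis by (simp add: trace_I)
qed

text \<open>The one-step bound of matrix concentration.\<close>

lemma sum_trace_cosh_le:
  fixes A :: "real^'d^'d" and X :: "'i \<Rightarrow> real^'d^'d"
  assumes symA: "transpose A = A" and symX: "\<And>i. i \<in> I \<Longrightarrow> transpose (X i) = X i"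
    and X: "\<And>i u. i \<in> I \<Longrightarrow> norm (X i *v u) \<le> c * norm u" "c \<ge> 0"
    and mean: "(\<Sum>i\<in>I. X i) = 0"
  shows "(\<Sum>i\<in>I. trace_cosh (A + X i)) \<le> of_nat (card I) * ennreal (exp (c\<^sup>2 / 2)) * trace_cosh A"
proof (rule LIMSEQ_le)
  let ?g = "\<lambda>A k. trace (matpow A (2 * k)) / fact (2 * k)"
  have nn: "0 \<le> ?g A k" if "transpose A = A" for A :: "real^'d^'d" and k
    by (simp add: trace_matpow_even[OF that])
  have symAX: "transpose (A + X i) = A + X i" if "i \<in> I" for i
    using symA symX[OF that] by (simp add: transpose_def vec_eq_iff)
  show "(\<lambda>N. \<Sum>i\<in>I. \<Sum>k<N. ennreal (?g (A + X i) k)) \<longlonglongrightarrow> (\<Sum>i\<in>I. trace_cosh (A + X i))"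
    unfolding trace_cosh_def by (intro tendsto_sum summable_LIMSEQ) simp
  show "(\<lambda>N. of_nat (card I) * ennreal (exp (c\<^sup>2 / 2)) * (\<Sum>k<N. ennreal (?g A k)))
      \<longlonglongrightarrow> of_nat (card I) * ennreal (exp (c\<^sup>2 / 2)) * trace_cosh A"
    unfolding trace_cosh_def by (intro ennreal_tendsto_cmult summable_LIMSEQ) (auto simp: ennreal_mult_less_top ennreal_of_nat_eq_real_of_nat)
  have "(\<Sum>i\<in>I. \<Sum>k<N. ennreal (?g (A + X i) k))
      \<le> of_nat (card I) * ennreal (exp (c\<^sup>2 / 2)) * (\<Sum>k<N. ennreal (?g A k))" for N
  proof -
    have "(\<Sum>i\<in>I. \<Sum>k<N. ennreal (?g (A + X i) k)) = ennreal (\<Sum>i\<in>I. \<Sum>k<N. ?g (A + X i) k)"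
      using nn[OF symAX] by (simp add: sum_ennreal sum_nonneg)
    also have "\<dots> \<le> ennreal (cosh c * (real (card I) * (\<Sum>k<N. ?g A k)))"
      by (rule ennreal_leI[OF sum_trace_cosh_truncated[OF assms]])
    also have "\<dots> \<le> ennreal (exp (c\<^sup>2 / 2) * (real (card I) * (\<Sum>k<N. ?g A k)))"
      using nn[OF symA] by (intro ennreal_leI mult_right_mono cosh_le_exp_square mult_nonneg_nonneg sum_nonneg) auto
    also have "\<dots> = of_nat (card I) * ennreal (exp (c\<^sup>2 / 2)) * (\<Sum>k<N. ennreal (?g A k))"
      using nn[OF symA]
      by (simp add: ennreal_mult' sum_ennreal sum_nonneg ennreal_of_nat_eq_real_of_nat mult_ac)
    finally show ?thesis .
  qed
  then show "\<exists>N0. \<forall>N\<ge>N0. (\<Sum>i\<in>I. \<Sum>k<N. ennreal (?g (A + X i) k))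
      \<le> of_nat (card I) * ennreal (exp (c\<^sup>2 / 2)) * (\<Sum>k<N. ennreal (?g A k))" by blast
qed

lemma inner_symmetric_matrix: "transpose A = A \<Longrightarrow> inner (A *v x) y = inner x (A *v (y :: real^'d))"
  by (metis dot_lmul_matrix transpose_matrix_vector)

text \<open>The sequence of norms of \<open>A\<^sup>k u\<close> is log-convex for symmetric \<open>A\<close>, hence grows at least geometrically.\<close>

lemma norm_matpow_vec_ge:
  fixes A :: "real^'d^'d"
  assumes sym: "transpose A = A" and u: "norm u = 1"
  shows "norm (A *v u) ^ k \<le> norm (matpow A k *v u)"
proof -
  define w where "w k = norm (matpow A k *v u)" for k
  have w0: "w 0 = 1" by (simp add: w_def u)
  have conv: "w (Suc k) ^ 2 \<le> w k * w (Suc (Suc k))" for k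
  proof -
    have "w (Suc k) ^ 2 = inner (A *v (matpow A k *v u)) (matpow A (Suc k) *v u)"
      unfolding w_def power2_norm_eq_inner by (simp add: matpow_Suc matrix_vector_mul_assoc)
    also have "\<dots> = inner (matpow A k *v u) (matpow A (Suc (Suc k)) *v u)"
      by (simp only: inner_symmetric_matrix[OF sym]) (simp add: matpow_Suc matrix_vector_mul_assoc[symmetric])
    also have "\<dots> \<le> w k * w (Suc (Suc k))" unfolding w_def by (rule norm_cauchy_schwarz)
    finally show ?thesis .
  qed
  have wnn: "0 \<le> w k" for k by (simp add: w_def)
  have ratio: "w 1 * w k \<le> w (Suc k)" for k
  proof (induction k)
    case 0 then show ?case by (simp add: w0)
  next
    case (Suc k)
    show ?case
    proof (cases "w (Suc k) = 0")
      case False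
      have "0 < w (Suc k) ^ 2" using False by simp
      then have "w k \<noteq> 0" using conv[of k] by auto
      then have "0 < w k" using wnn[of k] by simp
      have "w k * (w 1 * w (Suc k)) \<le> w (Suc k) * w (Suc k)"
        using mult_right_mono[OF Suc wnn[of "Suc k"]] by (simp add: mult_ac)
      also have "\<dots> \<le> w k * w (Suc (Suc k))" using conv[of k] by (simp add: power2_eq_square)
      finally show ?thesis using \<open>0 < w k\<close> by simp
    qed (use wnn in simp)
  qed
  have "w 1 ^ k \<le> w k"
  proof (induction k)
    case (Suc k)
    have "w 1 ^ Suc k \<le> w 1 * w k" using Suc wnn[of 1] by (simp add: mult_left_mono)
    then show ?case using ratio[of k] by simp
  qed (simp add: w0)
  then show ?thesis by (simp add: w_def matpow_Suc)
qed

lemma norm_matrix_vector_le: "norm (A *v u) \<le> norm A * norm (u :: real^'d)" for A :: "real^'d^'d"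
proof -
  have "norm (A *v u) ^ 2 = (\<Sum>i\<in>UNIV. (inner (A$i) u) ^ 2)"
    unfolding power2_norm_eq_inner by (simp add: inner_vec_def[of "A *v u" "A *v u"] matrix_mult_dot[of A u] power2_eq_square del: inner_real_def) (simp add: inner_vec_def power2_eq_square)
  also have "\<dots> \<le> (\<Sum>i\<in>UNIV. (norm (A$i) * norm u) ^ 2)"
    by (intro sum_mono) (metis Cauchy_Schwarz_ineq2 abs_ge_zero power2_abs power_mono)
  also have "\<dots> = (norm A * norm u) ^ 2"
    by (simp add: power_mult_distrib sum_distrib_right power2_norm_eq_inner inner_vec_def[of A])
  finally show ?thesis by (rule power2_le_imp_le) simp
qed

lemma cosh_le_trace_cosh:
  fixes A :: "real^'d^'d"
  assumes sym: "transpose A = A" and u: "norm u = 1"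
  shows "ennreal (cosh (norm (A *v u))) \<le> trace_cosh A"
proof -
  let ?x = "norm (A *v u)"
  have "ennreal (cosh ?x) = (\<Sum>k. ennreal (?x ^ (2 * k) / fact (2 * k)))"
    using cosh_sums_even[of ?x] by (subst suminf_ennreal_eq[of _ "cosh ?x"]) auto
  also have "\<dots> \<le> trace_cosh A"
    unfolding trace_cosh_def
  proof (intro suminf_le ennreal_leI divide_right_mono)
    fix k
    have "?x ^ k \<le> norm (matpow A k)"
      using norm_matpow_vec_ge[OF assms, of k] norm_matrix_vector_le[of "matpow A k" u] u by simp
    then have "(?x ^ k) ^ 2 \<le> norm (matpow A k) ^ 2" by (rule power_mono) simp
    then show "?x ^ (2 * k) \<le> trace (matpow A (2 * k))"
      unfolding trace_matpow_even[OF sym] by (simp add: power_mult[symmetric] mult.commute)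
  qed auto
  finally show ?thesis .
qed

section \<open>The hyperbolic cosine potential on an inner product space\<close>

text \<open>Termwise convexity of the power series \<open>\<Sum>k. s\<^sup>k / (2 k)!\<close>.\<close>

lemma convex_on_cosh_sqrt: "convex_on {0..} (\<lambda>s::real. cosh (sqrt s))"
proof (rule convex_onI)
  fix t x y :: real
  assume t: "0 < t" "t < 1" and xy: "x \<in> {0..}" "y \<in> {0..}"
  have s: "(\<lambda>k. z ^ k / fact (2 * k)) sums cosh (sqrt z)" if "z \<ge> 0" for z :: real
    using cosh_sums_even[of "sqrt z"] that by (simp add: power_mult)
  have p: "((1 - t) * x + t * y) ^ k \<le> (1 - t) * x ^ k + t * y ^ k" for k
  proof -
    have "convex_on {0..} (\<lambda>z::real. z ^ k)"
      by (cases "even k") (auto intro: convex_power_odd convex_on_subset[OF convex_power_even])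
    from convex_onD[OF this, of t x y] t xy show ?thesis by simp
  qed
  have "cosh (sqrt ((1 - t) * x + t * y)) \<le> (1 - t) * cosh (sqrt x) + t * cosh (sqrt y)"
  proof (rule sums_le)
    show "(\<lambda>k. ((1 - t) * x + t * y) ^ k / fact (2 * k)) sums cosh (sqrt ((1 - t) * x + t * y))"
      using t xy by (intro s add_nonneg_nonneg mult_nonneg_nonneg) auto
    show "(\<lambda>k. (1 - t) * (x ^ k / fact (2 * k)) + t * (y ^ k / fact (2 * k)))
        sums ((1 - t) * cosh (sqrt x) + t * cosh (sqrt y))"
      using xy by (intro sums_add sums_mult s) auto
    show "((1 - t) * x + t * y) ^ k / fact (2 * k)
        \<le> (1 - t) * (x ^ k / fact (2 * k)) + t * (y ^ k / fact (2 * k))" for k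
      using divide_right_mono[OF p[of k], of "fact (2 * k)"] by (simp add: add_divide_distrib)
  qed
  then show "cosh (sqrt ((1 - t) *\<^sub>R x + t *\<^sub>R y)) \<le> (1 - t) * cosh (sqrt x) + t * cosh (sqrt y)"
    by simp
qed simp

text \<open>The squared norm of \<open>e + a\<close> is affine in \<open>inner e a\<close>, so convexity of \<open>cosh (sqrt s)\<close> gives a chord bound
  between the two extreme cases where \<open>a\<close> is parallel to \<open>e\<close> and of norm \<open>c\<close>. The bound is affine in \<open>a\<close> and therefore
  survives averaging over mean zero perturbations.\<close>

lemma cosh_norm_add_le:
  fixes e a :: "'a::real_inner"
  assumes a: "norm a \<le> c" and c: "0 < c" and e: "e \<noteq> 0"
  shows "cosh (norm (e + a)) \<le> cosh (norm e) * cosh c + inner e a / (norm e * c) * (sinh (norm e) * sinh c)"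
proof -
  define p where "p = norm e"
  define \<tau> where "\<tau> = inner e a / (p * c)"
  have p: "0 < p" using e by (simp add: p_def)
  have "\<bar>inner e a\<bar> \<le> p * c"
    unfolding p_def using Cauchy_Schwarz_ineq2[of e a] mult_left_mono[OF a, of "norm e"] by simp
  then have tau: "-1 \<le> \<tau>" "\<tau> \<le> 1" using p c by (auto simp: \<tau>_def field_simps abs_le_iff)
  define t where "t = (1 + \<tau>) / 2"
  have t: "0 \<le> t" "t \<le> 1" using tau by (auto simp: t_def)
  have "norm (e + a) ^ 2 = p\<^sup>2 + 2 * inner e a + norm a ^ 2"
    unfolding p_def power2_norm_eq_inner by (simp add: inner_add_left inner_add_right inner_commute)
  also have "\<dots> \<le> p\<^sup>2 + 2 * (p * c * \<tau>) + c\<^sup>2"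
    using a p c by (simp add: \<tau>_def power_mono)
  also have "\<dots> = (1 - t) * (p - c)\<^sup>2 + t * (p + c)\<^sup>2"
    by (simp add: t_def power2_eq_square field_simps)
  finally have *: "norm (e + a) ^ 2 \<le> (1 - t) * (p - c)\<^sup>2 + t * (p + c)\<^sup>2" .
  have "norm (e + a) \<le> sqrt ((1 - t) * (p - c)\<^sup>2 + t * (p + c)\<^sup>2)"
    using * by (rule real_le_rsqrt)
  then have "cosh (norm (e + a)) \<le> cosh (sqrt ((1 - t) * (p - c)\<^sup>2 + t * (p + c)\<^sup>2))"
    by (subst cosh_real_nonneg_le_iff) (auto intro!: add_nonneg_nonneg mult_nonneg_nonneg t simp: t)
  also have "\<dots> \<le> (1 - t) * cosh (sqrt ((p - c)\<^sup>2)) + t * cosh (sqrt ((p + c)\<^sup>2))"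
    using convex_onD[OF convex_on_cosh_sqrt t, of "(p - c)\<^sup>2" "(p + c)\<^sup>2"] by simp
  also have "\<dots> = (1 - t) * cosh (p - c) + t * cosh (p + c)"
    by (simp add: cosh_real_abs)
  also have "\<dots> = cosh p * cosh c + \<tau> * (sinh p * sinh c)"
    by (simp add: cosh_add cosh_diff t_def field_simps)
  finally show ?thesis by (simp add: \<tau>_def p_def)
qed

lemma sum_cosh_norm_le:
  fixes e :: "'a::real_inner" and a :: "'i \<Rightarrow> 'a"
  assumes a: "\<And>i. i \<in> I \<Longrightarrow> norm (a i) \<le> c" "c \<ge> 0" and mean: "(\<Sum>i\<in>I. a i) = 0"
  shows "(\<Sum>i\<in>I. cosh (norm (e + a i))) \<le> real (card I) * exp (c\<^sup>2 / 2) * cosh (norm e)"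
proof -
  have "(\<Sum>i\<in>I. cosh (norm (e + a i))) \<le> real (card I) * (cosh (norm e) * cosh c)"
  \<comment> \<open>The chord bound divides by \<open>norm e * c\<close>; in the degenerate cases the claim holds termwise.\<close>
  proof (cases "c = 0 \<or> e = 0")
    case True
    have "cosh (norm (e + a i)) \<le> cosh (norm e) * cosh c" if "i \<in> I" for i
      using a(1)[OF that] a(2) True by (auto simp: cosh_real_nonneg_le_iff)
    then show ?thesis using sum_mono[of I "\<lambda>i. cosh (norm (e + a i))" "\<lambda>_. cosh (norm e) * cosh c"] by simp
  next
    case False
    have "(\<Sum>i\<in>I. cosh (norm (e + a i)))
      \<le> (\<Sum>i\<in>I. cosh (norm e) * cosh c + inner e (a i) / (norm e * c) * (sinh (norm e) * sinh c))"
      using False a by (intro sum_mono cosh_norm_add_le) auto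
    also have "\<dots> = real (card I) * (cosh (norm e) * cosh c)
        + inner e (\<Sum>i\<in>I. a i) / (norm e * c) * (sinh (norm e) * sinh c)"
      by (simp add: sum.distrib inner_sum_right sum_divide_distrib sum_distrib_right)
    finally show ?thesis by (simp add: mean)
  qed
  also have "\<dots> \<le> real (card I) * (cosh (norm e) * exp (c\<^sup>2 / 2))"
    by (intro mult_left_mono cosh_le_exp_square) auto
  finally show ?thesis by (simp add: mult_ac)
qed

section \<open>Sampling with a potential\<close>

text \<open>A growth factor \<open>K\<close> per summand compounds to \<open>K\<^sup>B\<close> for a sum of \<open>B\<close> independent samples.\<close>

lemma nn_integral_replicate_pmf_sum_list:
  fixes \<Phi> :: "'b::real_normed_vector \<Rightarrow> ennreal"
  assumes step: "\<And>e. e \<in> V \<Longrightarrow> (\<integral>\<^sup>+i. \<Phi> (e + a i) \<partial>measure_pmf p) \<le> K * \<Phi> e"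
    and V: "\<And>e i. e \<in> V \<Longrightarrow> i \<in> set_pmf p \<Longrightarrow> e + a i \<in> V"
    and e: "e \<in> V"
  shows "(\<integral>\<^sup>+xs. \<Phi> (e + sum_list (map a xs)) \<partial>measure_pmf (replicate_pmf B p)) \<le> K ^ B * \<Phi> e"
  using e
proof (induction B arbitrary: e)
  case (Suc B)
  have "(\<integral>\<^sup>+xs. \<Phi> (e + sum_list (map a xs)) \<partial>measure_pmf (replicate_pmf (Suc B) p))
      = (\<integral>\<^sup>+x. \<integral>\<^sup>+xs. \<Phi> (e + a x + sum_list (map a xs)) \<partial>measure_pmf (replicate_pmf B p) \<partial>measure_pmf p)"
    by (simp add: add.assoc)
  also have "\<dots> \<le> (\<integral>\<^sup>+x. K ^ B * \<Phi> (e + a x) \<partial>measure_pmf p)"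
    by (intro nn_integral_mono_AE) (auto simp: AE_measure_pmf_iff intro!: Suc V)
  also have "\<dots> = K ^ B * (\<integral>\<^sup>+x. \<Phi> (e + a x) \<partial>measure_pmf p)"
    by (rule nn_integral_cmult) simp
  also have "\<dots> \<le> K ^ B * (K * \<Phi> e)"
    by (intro mult_left_mono step Suc.prems) simp
  finally show ?case by (simp add: mult_ac)
qed simp

lemma set_sample_indices:
  assumes "n \<ge> 1" "J \<in> set_pmf (sample_indices n B)"
  shows "size J = B" "set_mset J \<subseteq> {1..n}"
  using assms by (auto simp: sample_indices_def set_replicate_pmf)

text \<open>What a potential \<open>\<Phi>\<close> must satisfy for an exponential moment argument on the subspace \<open>V\<close> with gauge \<open>N\<close>:
  perturbations with mean zero and gauge at most \<open>c\<close> increase its mean by a factor of at most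
  \<open>exp (c\<^sup>2 / 2)\<close>, and it dominates the hyperbolic cosine of the gauge. The constant \<open>D\<close> becomes the
  dimensional prefactor of the tail bound.\<close>

locale cosh_potential =
  fixes V :: "'b::real_normed_vector set" and N :: "'b \<Rightarrow> real" and \<Phi> :: "'b \<Rightarrow> ennreal" and D :: real
  assumes V: "subspace V"
    and N_scaleR: "\<And>c x. N (c *\<^sub>R x) = \<bar>c\<bar> * N x"
    and Phi_0: "\<Phi> 0 = ennreal D"
    and D_nonneg: "0 \<le> D"
    and Phi_mean: "\<And>(I :: nat set) a c e. finite I \<Longrightarrow> (\<And>i. i \<in> I \<Longrightarrow> a i \<in> V) \<Longrightarrow> (\<And>i. i \<in> I \<Longrightarrow> N (a i) \<le> c)
        \<Longrightarrow> 0 \<le> c \<Longrightarrow> (\<Sum>i\<in>I. a i) = 0 \<Longrightarrow> e \<in> V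
        \<Longrightarrow> (\<Sum>i\<in>I. \<Phi> (e + a i)) \<le> of_nat (card I) * ennreal (exp (c\<^sup>2 / 2)) * \<Phi> e"
    and Phi_tail: "\<And>e r. e \<in> V \<Longrightarrow> 0 \<le> r \<Longrightarrow> r < N e \<Longrightarrow> ennreal (cosh r) \<le> \<Phi> e"
begin

lemma nn_integral_sample_mean:
  assumes n: "n \<ge> 1" and B: "B > 0" and lam: "\<theta> \<ge> 0" and c: "c \<ge> 0"
    and a: "\<And>i. i \<in> {1..n} \<Longrightarrow> a i \<in> V" "\<And>i. i \<in> {1..n} \<Longrightarrow> N (a i) \<le> c"
    and mean: "(\<Sum>i\<in>{1..n}. a i) = 0" and e: "e \<in> V"
  shows "(\<integral>\<^sup>+J. \<Phi> (\<theta> *\<^sub>R (e + (1 / real B) *\<^sub>R (\<Sum>i\<in>#J. a i))) \<partial>measure_pmf (sample_indices n B))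
          \<le> ennreal (exp (\<theta>\<^sup>2 * (c\<^sup>2 / real B) / 2)) * \<Phi> (\<theta> *\<^sub>R e)"
proof -
  define b where "b i = (\<theta> / real B) *\<^sub>R a i" for i
  define K where "K = ennreal (exp ((\<theta> / real B * c)\<^sup>2 / 2))"
  have bV: "b i \<in> V" if "i \<in> {1..n}" for i
    unfolding b_def by (intro subspace_scale[OF V] a that)
  have bN: "N (b i) \<le> \<theta> / real B * c" if "i \<in> {1..n}" for i
    unfolding b_def N_scaleR using lam a(2)[OF that] by (simp add: mult_left_mono divide_right_mono)
  have nz: "{1..n} \<noteq> {}" using n by simp
  have step: "(\<integral>\<^sup>+i. \<Phi> (e + b i) \<partial>measure_pmf (pmf_of_set {1..n})) \<le> K * \<Phi> e" if "e \<in> V" for e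
  proof -
    have "(\<Sum>i\<in>{1..n}. b i) = 0" unfolding b_def scaleR_sum_right[symmetric] mean by simp
    then have "(\<Sum>i\<in>{1..n}. \<Phi> (e + b i)) \<le> of_nat (card {1..n}) * K * \<Phi> e"
      unfolding K_def using lam c that by (intro Phi_mean bV bN) auto
    also have "\<dots> = of_nat n * (K * \<Phi> e)" by (simp add: mult.assoc)
    finally have "(\<Sum>i\<in>{1..n}. \<Phi> (e + b i)) / of_nat n \<le> K * \<Phi> e"
      using n by (intro divide_le_posI_ennreal) auto
    then show ?thesis using n by (simp add: nn_integral_pmf_of_set)
  qed
  have "(\<integral>\<^sup>+J. \<Phi> (\<theta> *\<^sub>R (e + (1 / real B) *\<^sub>R (\<Sum>i\<in>#J. a i))) \<partial>measure_pmf (sample_indices n B))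
      = (\<integral>\<^sup>+xs. \<Phi> (\<theta> *\<^sub>R e + sum_list (map b xs)) \<partial>measure_pmf (replicate_pmf B (pmf_of_set {1..n})))"
  proof -
    have "(\<theta> / real B) *\<^sub>R sum_list (map a xs) = sum_list (map b xs)" for xs
      by (induction xs) (simp_all add: b_def scaleR_add_right)
    moreover have "\<theta> *\<^sub>R (e + (1 / real B) *\<^sub>R (\<Sum>i\<in>#mset xs. a i)) = \<theta> *\<^sub>R e + (\<theta> / real B) *\<^sub>R sum_list (map a xs)" for xs
      by (simp add: scaleR_add_right flip: sum_mset_sum_list mset_map)
    ultimately show ?thesis by (simp add: sample_indices_def)
  qed
  also have "\<dots> \<le> K ^ B * \<Phi> (\<theta> *\<^sub>R e)"
    using nz e by (intro nn_integral_replicate_pmf_sum_list[where V = V] step)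
       (auto intro!: subspace_add[OF V] bV subspace_scale[OF V])
  also have "K ^ B = ennreal (exp (\<theta>\<^sup>2 * (c\<^sup>2 / real B) / 2))"
    using B by (simp add: K_def ennreal_power exp_of_nat_mult[symmetric] power2_eq_square field_simps)
  finally show ?thesis .
qed

text \<open>A batch of size at least \<open>n\<close> is replaced by the exact mean, in which case the correction vanishes.\<close>

lemma nn_integral_sample_correction:
  assumes n: "n \<ge> 1" and B: "B > 0" and lam: "\<theta> \<ge> 0" and c: "c \<ge> 0" and q: "q \<ge> 0"
    and cq: "B < n \<Longrightarrow> c\<^sup>2 \<le> q * real B"
    and a: "\<And>i. i \<in> {1..n} \<Longrightarrow> a i \<in> V" "\<And>i. i \<in> {1..n} \<Longrightarrow> N (a i) \<le> c"
    and mean: "(\<Sum>i\<in>{1..n}. a i) = 0" and e: "e \<in> V"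
    and G: "\<And>J. size J = B \<Longrightarrow> G J = e + (if B < n then (1 / real B) *\<^sub>R (\<Sum>i\<in>#J. a i) else 0)"
  shows "(\<integral>\<^sup>+J. \<Phi> (\<theta> *\<^sub>R G J) \<partial>measure_pmf (sample_indices n B))
          \<le> ennreal (exp (\<theta>\<^sup>2 * q / 2)) * \<Phi> (\<theta> *\<^sub>R e)"
proof -
  have "(\<integral>\<^sup>+J. \<Phi> (\<theta> *\<^sub>R G J) \<partial>measure_pmf (sample_indices n B))
     = (\<integral>\<^sup>+J. \<Phi> (\<theta> *\<^sub>R (e + (if B < n then (1 / real B) *\<^sub>R (\<Sum>i\<in>#J. a i) else 0))) \<partial>measure_pmf (sample_indices n B))"
    by (intro nn_integral_cong_AE) (auto simp: AE_measure_pmf_iff G dest!: set_sample_indices(1)[OF n])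
  also have "\<dots> \<le> ennreal (exp (\<theta>\<^sup>2 * q / 2)) * \<Phi> (\<theta> *\<^sub>R e)"
  proof (cases "B < n")
    case True
    have "c\<^sup>2 / real B \<le> q" using cq[OF True] B by (simp add: field_simps)
    then have "\<theta>\<^sup>2 * (c\<^sup>2 / real B) / 2 \<le> \<theta>\<^sup>2 * q / 2"
      by (intro divide_right_mono mult_left_mono) auto
    then have "ennreal (exp (\<theta>\<^sup>2 * (c\<^sup>2 / real B) / 2)) * \<Phi> (\<theta> *\<^sub>R e)
        \<le> ennreal (exp (\<theta>\<^sup>2 * q / 2)) * \<Phi> (\<theta> *\<^sub>R e)"
      by (intro mult_right_mono ennreal_leI) auto
    then show ?thesis using True nn_integral_sample_mean[OF n B lam c a mean e] by (auto intro: order_trans)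
  next
    case False
    have "1 * \<Phi> (\<theta> *\<^sub>R e) \<le> ennreal (exp (\<theta>\<^sup>2 * q / 2)) * \<Phi> (\<theta> *\<^sub>R e)"
      using q by (intro mult_right_mono) auto
    then show ?thesis using False by simp
  qed
  finally show ?thesis .
qed

end

section \<open>Processes with an absorbing stopping rule\<close>

text \<open>A process that records its past: each step either extends the history by one state or, once
  stopped, leaves it unchanged.\<close>

locale history_process =
  fixes stop :: "'s list \<Rightarrow> bool" and step :: "'s list \<Rightarrow> 's list pmf" and law :: "nat \<Rightarrow> 's list pmf"
  assumes law_0: "law 0 = return_pmf []"
    and law_Suc: "law (Suc t) = law t \<bind> step"
    and step_stop: "stop \<omega> \<Longrightarrow> step \<omega> = return_pmf \<omega>"
    and step_run: "\<not> stop \<omega> \<Longrightarrow> set_pmf (step \<omega>) \<subseteq> range (\<lambda>s. s # \<omega>)"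
begin

lemma length_law:
  assumes "\<omega> \<in> set_pmf (law t)"
  shows "length \<omega> \<le> t" "\<not> stop \<omega> \<Longrightarrow> length \<omega> = t"
proof -
  have "length \<omega> \<le> t \<and> (\<not> stop \<omega> \<longrightarrow> length \<omega> = t)" using assms
  proof (induction t arbitrary: \<omega>)
    case 0
    then show ?case by (simp add: law_0)
  next
    case (Suc t)
    then obtain \<omega>' where w: "\<omega>' \<in> set_pmf (law t)" "\<omega> \<in> set_pmf (step \<omega>')" by (auto simp: law_Suc)
    then show ?case using Suc.IH[OF w(1)] step_stop[of \<omega>'] step_run[of \<omega>']
      by (cases "stop \<omega>'") auto
  qed
  then show "length \<omega> \<le> t" "\<not> stop \<omega> \<Longrightarrow> length \<omega> = t" by auto
qed

text \<open>Union bound over the time at which a bad state is appended.\<close>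

lemma emeasure_ex_le_sum:
  "emeasure (law T) {\<omega>. \<exists>s\<in>set \<omega>. bad s}
     \<le> (\<Sum>t<T. emeasure (law (Suc t)) {\<omega>. length \<omega> = Suc t \<and> bad (hd \<omega>)})"
proof (induction T)
  case 0
  then show ?case by (simp add: law_0)
next
  case (Suc T)
  let ?E = "{\<omega>. \<exists>s\<in>set \<omega>. bad s}" and ?H = "{\<omega>. length \<omega> = Suc T \<and> bad (hd \<omega>)}"
  have "emeasure (law (Suc T)) ?E = (\<integral>\<^sup>+\<omega>. emeasure (step \<omega>) ?E \<partial>law T)"
    by (simp add: law_Suc)
  also have "\<dots> \<le> (\<integral>\<^sup>+\<omega>. indicator ?E \<omega> + emeasure (step \<omega>) ?H \<partial>law T)"
  proof (intro nn_integral_mono_AE, unfold AE_measure_pmf_iff, intro ballI)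
    fix \<omega> assume w: "\<omega> \<in> set_pmf (law T)"
    show "emeasure (step \<omega>) ?E \<le> indicator ?E \<omega> + emeasure (step \<omega>) ?H"
    proof (cases "stop \<omega>")
      case True
      then show ?thesis by (simp add: step_stop)
    next
      case False
      show ?thesis
      proof (cases "\<omega> \<in> ?E")
        case True
        then show ?thesis
          by (auto simp: indicator_def intro!: order_trans[OF measure_pmf.emeasure_le_1] add_increasing2)
      next
        case nE: False
        have "emeasure (step \<omega>) ?E \<le> emeasure (step \<omega>) ?H"
          using subsetD[OF step_run[OF False]] length_law(2)[OF w False] nE
          by (intro emeasure_mono_AE) (force simp: AE_measure_pmf_iff)+
        then show ?thesis using nE by simp
      qed
    qed
  qed
  also have "\<dots> = emeasure (law T) ?E + emeasure (law (Suc T)) ?H"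
    by (subst nn_integral_add) (simp_all add: law_Suc)
  finally show ?case using Suc by (simp add: add_mono order_trans)
qed

text \<open>The supermartingale estimate for an estimator that is refreshed every \<open>S\<close> steps and updated in between.
  The refresh contributes \<open>q\<close> to the exponent and each of the fewer than \<open>S\<close> later updates contributes
  \<open>q / S\<close>, hence the total \<open>2 q\<close>. Restricting to histories of full length discards stopped runs.\<close>

lemma nn_integral_last_le:
  fixes \<Psi> :: "'s \<Rightarrow> ennreal"
  assumes S: "S > 0" and q: "q \<ge> 0" and D: "D \<ge> 0"
    and refresh: "\<And>t \<omega>. t < T \<Longrightarrow> \<omega> \<in> set_pmf (law t) \<Longrightarrow> \<not> stop \<omega> \<Longrightarrow> t mod S = 0 \<Longrightarrow>
          (\<integral>\<^sup>+\<omega>'. \<Psi> (hd \<omega>') \<partial>step \<omega>) \<le> ennreal (exp q) * ennreal D"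
    and update: "\<And>t \<omega>. t < T \<Longrightarrow> \<omega> \<in> set_pmf (law t) \<Longrightarrow> \<not> stop \<omega> \<Longrightarrow> t mod S \<noteq> 0 \<Longrightarrow>
          (\<integral>\<^sup>+\<omega>'. \<Psi> (hd \<omega>') \<partial>step \<omega>) \<le> ennreal (exp (q / real S)) * \<Psi> (hd \<omega>)"
    and t: "t < T"
  shows "(\<integral>\<^sup>+\<omega>. indicator {\<omega>. length \<omega> = Suc t} \<omega> * \<Psi> (hd \<omega>) \<partial>law (Suc t)) \<le> ennreal (exp (2 * q) * D)"
proof -
  define A where "A t = (\<integral>\<^sup>+\<omega>. indicator {\<omega>. length \<omega> = t} \<omega> * \<Psi> (hd \<omega>) \<partial>law t)" for t
  have pre: "A (Suc t) \<le> (\<integral>\<^sup>+\<omega>. (if stop \<omega> then 0 else (\<integral>\<^sup>+\<omega>'. \<Psi> (hd \<omega>') \<partial>step \<omega>)) \<partial>law t)" for t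
    unfolding A_def law_Suc nn_integral_bind_pmf
  proof (intro nn_integral_mono_AE, unfold AE_measure_pmf_iff, intro ballI)
    fix \<omega> assume w: "\<omega> \<in> set_pmf (law t)"
    show "(\<integral>\<^sup>+\<omega>'. indicator {\<omega>. length \<omega> = Suc t} \<omega>' * \<Psi> (hd \<omega>') \<partial>step \<omega>)
        \<le> (if stop \<omega> then 0 else (\<integral>\<^sup>+\<omega>'. \<Psi> (hd \<omega>') \<partial>step \<omega>))"
      using length_law(1)[OF w]
      by (auto simp: step_stop indicator_def intro!: nn_integral_mono)
  qed
  have A_refresh: "A (Suc t) \<le> ennreal (exp q) * ennreal D" if "t < T" "t mod S = 0" for t
  proof -
    have "A (Suc t) \<le> (\<integral>\<^sup>+\<omega>. ennreal (exp q) * ennreal D \<partial>law t)"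
      using refresh[OF that(1) _ _ that(2)]
      by (intro order_trans[OF pre] nn_integral_mono_AE) (auto simp: AE_measure_pmf_iff)
    then show ?thesis by simp
  qed
  have A_update: "A (Suc t) \<le> ennreal (exp (q / real S)) * A t" if "t < T" "t mod S \<noteq> 0" for t
  proof -
    have "A (Suc t) \<le> (\<integral>\<^sup>+\<omega>. ennreal (exp (q / real S)) * (indicator {\<omega>. length \<omega> = t} \<omega> * \<Psi> (hd \<omega>)) \<partial>law t)"
      using update[OF that(1) _ _ that(2)]
      by (intro order_trans[OF pre] nn_integral_mono_AE) (auto simp: AE_measure_pmf_iff length_law(2))
    then show ?thesis unfolding A_def by (simp add: nn_integral_cmult)
  qed
  have "A (Suc t) \<le> ennreal (exp (q + real (t mod S) * (q / real S)) * D)" if "t < T" for t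
    using that
  proof (induction t)
    case 0
    then show ?case using A_refresh[of 0] by (simp add: ennreal_mult')
  next
    case (Suc t)
    show ?case
    proof (cases "Suc t mod S = 0")
      case True
      then show ?thesis using A_refresh[OF Suc.prems] by (simp add: ennreal_mult')
    next
      case False
      then have m: "Suc t mod S = Suc (t mod S)" by (simp add: mod_Suc split: if_splits)
      have "A (Suc (Suc t)) \<le> ennreal (exp (q / real S)) * A (Suc t)" by (rule A_update[OF Suc.prems False])
      also have "\<dots> \<le> ennreal (exp (q / real S)) * ennreal (exp (q + real (t mod S) * (q / real S)) * D)"
        using Suc by (intro mult_left_mono) auto
      also have "\<dots> = ennreal (exp (q + real (Suc t mod S) * (q / real S)) * D)"
        using D by (simp add: m ennreal_mult'[symmetric] exp_add[symmetric] mult.assoc[symmetric] algebra_simps)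
      finally show ?thesis .
    qed
  qed
  from this[OF t] have "A (Suc t) \<le> ennreal (exp (q + real (t mod S) * (q / real S)) * D)" .
  also have "\<dots> \<le> ennreal (exp (2 * q) * D)"
  proof (intro ennreal_leI mult_right_mono D)
    have "real (t mod S) * (q / real S) \<le> real S * (q / real S)"
      using S q by (intro mult_right_mono) (auto simp: less_imp_le)
    then show "exp (q + real (t mod S) * (q / real S)) \<le> exp (2 * q)" using S by simp
  qed
  finally show ?thesis by (simp add: A_def)
qed

text \<open>Markov inequality for the potential of the last state.\<close>

lemma emeasure_last_le:
  fixes \<Psi> :: "'s \<Rightarrow> ennreal"
  assumes bad: "\<And>\<omega>. \<omega> \<in> set_pmf (law t) \<Longrightarrow> \<omega> \<noteq> [] \<Longrightarrow> bad (hd \<omega>) \<Longrightarrow> ennreal K \<le> \<Psi> (hd \<omega>)" and K: "K > 0"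
    and A: "(\<integral>\<^sup>+\<omega>. indicator {\<omega>. length \<omega> = t} \<omega> * \<Psi> (hd \<omega>) \<partial>law t) \<le> ennreal A" and "A \<ge> 0" and t: "t > 0"
  shows "emeasure (law t) {\<omega>. length \<omega> = t \<and> bad (hd \<omega>)} \<le> ennreal (A / K)"
proof -
  let ?H = "{\<omega>. length \<omega> = t \<and> bad (hd \<omega>)}"
  have "ennreal K * emeasure (law t) ?H = (\<integral>\<^sup>+\<omega>. ennreal K * indicator ?H \<omega> \<partial>law t)"
    by (simp add: nn_integral_cmult)
  also have "\<dots> \<le> (\<integral>\<^sup>+\<omega>. indicator {\<omega>. length \<omega> = t} \<omega> * \<Psi> (hd \<omega>) \<partial>law t)"
    using bad t by (intro nn_integral_mono_AE) (auto simp: AE_measure_pmf_iff indicator_def)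
  also note A
  finally have "ennreal K * emeasure (law t) ?H \<le> ennreal A" .
  then have "emeasure (law t) ?H * ennreal K / ennreal K \<le> ennreal A / ennreal K"
    by (intro divide_right_mono_ennreal) (simp add: mult.commute)
  then have "emeasure (law t) ?H \<le> ennreal A / ennreal K"
    using K by (simp add: mult_divide_eq_ennreal)
  then show ?thesis using K \<open>A \<ge> 0\<close> by (simp add: divide_ennreal)
qed

end

section \<open>Gradients and Hessians\<close>

lemma GDERIV_unique:
  assumes "GDERIV f x :> D" "GDERIV f x :> D'"
  shows "D = D'"
proof -
  have "(\<lambda>h. inner h D) = (\<lambda>h. inner h D')"
    using assms unfolding gderiv_def by (rule has_derivative_unique)
  from fun_cong[OF this] have "\<forall>h. inner h D = inner h D'" by (intro allI)
  then show ?thesis by (rule vector_eq_ldot[THEN iffD1])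
qed

lemma gradient_eqI: "GDERIV f x :> D \<Longrightarrow> gradient f x = D"
  unfolding gradient_def by (rule the_equality) (auto intro: GDERIV_unique)

lemma GDERIV_gradient:
  fixes f :: "real^'d \<Rightarrow> real"
  assumes "f differentiable (at x)"
  shows "GDERIV f x :> gradient f x"
proof -
  obtain f' where f': "(f has_derivative f') (at x)" using assms by (auto simp: differentiable_def)
  then interpret f': bounded_linear f' by (rule has_derivative_bounded_linear)
  have "f' = (\<lambda>h. inner h (adjoint f' 1))"
    using adjoint_works[OF f'.linear, of _ 1] by (auto simp: fun_eq_iff)
  then have "GDERIV f x :> adjoint f' 1" using f' by (simp add: gderiv_def)
  then show ?thesis using gradient_eqI by metis
qed

lemma has_derivative_gradient:
  assumes "twice_differentiable f"
  shows "(gradient f has_derivative (\<lambda>h. hessian f x *v h)) (at x)"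
  using assms jacobian_works unfolding twice_differentiable_def hessian_def by blast

lemma hessian_eqI:
  fixes f :: "real^'d \<Rightarrow> real"
  assumes "(gradient f has_derivative (\<lambda>h. A *v h)) (at x)"
  shows "hessian f x = A"
  by (simp add: hessian_def jacobian_def frechet_derivative_at[OF assms, symmetric])

lemma gradient_average:
  fixes f :: "nat \<Rightarrow> real^'d \<Rightarrow> real"
  assumes "\<And>i. i \<in> {1..n} \<Longrightarrow> twice_differentiable (f i)"
  shows "GDERIV (average n f) x :> (1 / real n) *\<^sub>R (\<Sum>i\<in>{1..n}. gradient (f i) x)"
proof -
  have "(f i has_derivative (\<lambda>h. inner h (gradient (f i) x))) (at x)" if "i \<in> {1..n}" for i
    using GDERIV_gradient[of "f i" x] assms[OF that] by (simp add: twice_differentiable_def gderiv_def)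
  then have "((\<lambda>x. (1 / real n) * (\<Sum>i\<in>{1..n}. f i x)) has_derivative
      (\<lambda>h. (1 / real n) * (\<Sum>i\<in>{1..n}. inner h (gradient (f i) x)))) (at x)"
    by (intro has_derivative_mult_right has_derivative_sum)
  moreover have "average n f = (\<lambda>x. (1 / real n) * (\<Sum>i\<in>{1..n}. f i x))"
    by (simp add: average_def fun_eq_iff)
  ultimately show ?thesis by (simp add: gderiv_def inner_sum_right)
qed

lemma sum_matrix_vector: "(\<Sum>i\<in>I. A i *v h) = (\<Sum>i\<in>I. A i) *v (h :: real^'d)"
  for I :: "'i set" and A :: "'i \<Rightarrow> real^'d^'d"
  by (induction I rule: infinite_finite_induct) (simp_all add: matrix_vector_mult_add_rdistrib)

lemma hessian_average:
  fixes f :: "nat \<Rightarrow> real^'d \<Rightarrow> real"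
  assumes "\<And>i. i \<in> {1..n} \<Longrightarrow> twice_differentiable (f i)"
  shows "(gradient (average n f) has_derivative (\<lambda>h. ((1 / real n) *\<^sub>R (\<Sum>i\<in>{1..n}. hessian (f i) x)) *v h)) (at x)"
proof -
  have "gradient (average n f) = (\<lambda>x. (1 / real n) *\<^sub>R (\<Sum>i\<in>{1..n}. gradient (f i) x))"
    using gradient_eqI[OF gradient_average[OF assms]] by (simp add: fun_eq_iff)
  moreover have "((\<lambda>x. (1 / real n) *\<^sub>R (\<Sum>i\<in>{1..n}. gradient (f i) x)) has_derivative
      (\<lambda>h. (1 / real n) *\<^sub>R (\<Sum>i\<in>{1..n}. hessian (f i) x *v h))) (at x)"
    using assms by (intro has_derivative_scaleR_right has_derivative_sum has_derivative_gradient)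
  ultimately show ?thesis by (simp add: sum_matrix_vector scaleR_matrix_vector_assoc)
qed

lemma twice_differentiable_average:
  fixes f :: "nat \<Rightarrow> real^'d \<Rightarrow> real"
  assumes "\<And>i. i \<in> {1..n} \<Longrightarrow> twice_differentiable (f i)"
  shows "twice_differentiable (average n f)"
  using gradient_average[of n f, OF assms] hessian_average[of n f, OF assms]
  unfolding twice_differentiable_def gderiv_def differentiable_def by blast

lemma norm_mult_spectral_norm_le: "norm (A *v u) \<le> spectral_norm A * norm u"
  unfolding spectral_norm_def by (rule onorm) simp

lemma spectral_norm_leI: "(\<And>u. norm (A *v u) \<le> c * norm u) \<Longrightarrow> 0 \<le> c \<Longrightarrow> spectral_norm A \<le> c"
  unfolding spectral_norm_def by (rule onorm_bound) auto

lemma spectral_norm_nonneg: "0 \<le> spectral_norm A"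
  unfolding spectral_norm_def by (rule onorm_pos_le) simp

lemma spectral_norm_scaleR: "spectral_norm (c *\<^sub>R A) = \<bar>c\<bar> * spectral_norm A"
proof -
  have "(*v) (c *\<^sub>R A) = (\<lambda>u. c *\<^sub>R (A *v u))"
    by (simp add: fun_eq_iff scaleR_matrix_vector_assoc)
  then show ?thesis unfolding spectral_norm_def by (simp only:) (rule onorm_scaleR, simp)
qed

lemma spectral_norm_triangle: "spectral_norm (A + B) \<le> spectral_norm A + spectral_norm B"
proof -
  have "(*v) (A + B) = (\<lambda>u. A *v u + B *v u)"
    by (simp add: fun_eq_iff matrix_vector_mult_add_rdistrib)
  then show ?thesis unfolding spectral_norm_def by (simp only:) (rule onorm_triangle, simp_all)
qed

lemma increment_le_linear_rate:
  fixes g :: "real \<Rightarrow> real"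
  assumes "\<And>t. 0 \<le> t \<Longrightarrow> t \<le> 1 \<Longrightarrow> (g has_real_derivative g' t) (at t)"
    and "\<And>t. 0 \<le> t \<Longrightarrow> t \<le> 1 \<Longrightarrow> g' t \<le> c * t ^ m"
  shows "g 1 - g 0 \<le> c / real (Suc m)"
proof -
  define k where "k t = g t - c * t ^ Suc m / real (Suc m)" for t
  have "k 1 \<le> k 0"
  proof (rule DERIV_nonpos_imp_nonincreasing[of 0 1 k])
    fix t :: real assume t: "0 \<le> t" "t \<le> 1"
    have "(k has_real_derivative g' t - c * t ^ m) (at t)"
      unfolding k_def using t
      by (auto intro!: derivative_eq_intros assms(1) simp del: power_Suc of_nat_Suc)
    then show "\<exists>y. DERIV k t :> y \<and> y \<le> 0" using assms(2)[OF t] by fastforce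
  qed simp
  then show ?thesis by (simp add: k_def)
qed

lemma gradient_line_deriv:
  assumes "twice_differentiable f"
  shows "((\<lambda>t. inner (gradient f (x + t *\<^sub>R h)) w) has_real_derivative
           inner (hessian f (x + t *\<^sub>R h) *v h) w) (at t)"
proof -
  have "((\<lambda>t. gradient f (x + t *\<^sub>R h)) has_derivative (\<lambda>s. hessian f (x + t *\<^sub>R h) *v (s *\<^sub>R h))) (at t)"
    by (rule has_derivative_compose[OF _ has_derivative_gradient[OF assms], where f = "\<lambda>t. x + t *\<^sub>R h"])
       (auto intro!: derivative_eq_intros)
  then have "((\<lambda>t. inner (gradient f (x + t *\<^sub>R h)) w) has_derivative
      (\<lambda>s. inner (hessian f (x + t *\<^sub>R h) *v (s *\<^sub>R h)) w)) (at t)"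
    by (rule has_derivative_inner_left)
  then show ?thesis
    by (simp add: has_field_derivative_def matrix_vector_mult_scaleR mult.commute[of _ "inner _ _"])
qed

lemma line_deriv:
  assumes "twice_differentiable f"
  shows "((\<lambda>t. f (x + t *\<^sub>R h)) has_real_derivative inner (gradient f (x + t *\<^sub>R h)) h) (at t)"
proof -
  have "GDERIV f (x + t *\<^sub>R h) :> gradient f (x + t *\<^sub>R h)"
    using assms by (intro GDERIV_gradient) (simp add: twice_differentiable_def)
  then have "((\<lambda>t. f (x + t *\<^sub>R h)) has_derivative (\<lambda>s. inner (s *\<^sub>R h) (gradient f (x + t *\<^sub>R h)))) (at t)"
    unfolding gderiv_def
    by (rule has_derivative_compose[rotated, where f = "\<lambda>t. x + t *\<^sub>R h"]) (auto intro!: derivative_eq_intros)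
  then show ?thesis by (simp add: has_field_derivative_def inner_commute mult.commute[of _ "inner _ _"])
qed

text \<open>Twice differentiable functions with a Lipschitz continuous Hessian.\<close>

locale lipschitz_hessian =
  fixes f :: "real^'d \<Rightarrow> real" and \<rho> :: real
  assumes twice: "twice_differentiable f"
    and rho_nonneg: "0 \<le> \<rho>"
    and lip: "\<And>x y. spectral_norm (hessian f x - hessian f y) \<le> \<rho> * norm (x - y)"
begin

lemma hessian_diff_le: "norm ((hessian f x - hessian f y) *v u) \<le> \<rho> * norm (x - y) * norm u"
  by (rule order_trans[OF norm_mult_spectral_norm_le mult_right_mono[OF lip]]) simp

lemma gradient_taylor:
  "norm (gradient f (x + h) - gradient f x - hessian f x *v h) \<le> \<rho> / 2 * norm h ^ 2"
proof -
  define w where "w = gradient f (x + h) - gradient f x - hessian f x *v h"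
  have "inner (gradient f (x + 1 *\<^sub>R h)) w - 1 * inner (hessian f x *v h) w
      - (inner (gradient f (x + 0 *\<^sub>R h)) w - 0 * inner (hessian f x *v h) w) \<le> \<rho> * norm h ^ 2 * norm w / real (Suc 1)"
  proof (rule increment_le_linear_rate)
    fix t :: real assume t: "0 \<le> t" "t \<le> 1"
    show "((\<lambda>t. inner (gradient f (x + t *\<^sub>R h)) w - t * inner (hessian f x *v h) w) has_real_derivative
        inner (hessian f (x + t *\<^sub>R h) *v h) w - inner (hessian f x *v h) w) (at t)"
      by (auto intro!: derivative_eq_intros gradient_line_deriv[OF twice])
    have "inner (hessian f (x + t *\<^sub>R h) *v h) w - inner (hessian f x *v h) w
        = inner ((hessian f (x + t *\<^sub>R h) - hessian f x) *v h) w"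
      by (simp add: matrix_vector_mult_diff_rdistrib inner_diff_left)
    also have "\<dots> \<le> norm ((hessian f (x + t *\<^sub>R h) - hessian f x) *v h) * norm w" by (rule norm_cauchy_schwarz)
    also have "\<dots> \<le> (\<rho> * norm (x + t *\<^sub>R h - x) * norm h) * norm w"
      by (intro mult_right_mono hessian_diff_le) auto
    also have "\<dots> = \<rho> * norm h ^ 2 * norm w * t ^ 1" using t by (simp add: eval_nat_numeral)
    finally show "inner (hessian f (x + t *\<^sub>R h) *v h) w - inner (hessian f x *v h) w \<le> \<rho> * norm h ^ 2 * norm w * t ^ 1" .
  qed
  then have "inner (gradient f (x + h)) w - inner (hessian f x *v h) w - inner (gradient f x) w
      \<le> \<rho> * norm h ^ 2 * norm w / 2"
    by (simp only: scaleR_one scaleR_zero_left add_0_right mult_1 mult_zero_left diff_0_right)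
       (simp only: of_nat_Suc of_nat_1 one_add_one One_nat_def of_nat_0 add_0_left add_0_right)
  moreover have "inner w w = inner (gradient f (x + h)) w - inner (gradient f x) w - inner (hessian f x *v h) w"
    by (subst (1) w_def) (simp only: inner_diff_left)
  moreover have "inner w w = norm w * norm w" by (metis power2_eq_square power2_norm_eq_inner)
  ultimately have *: "norm w * norm w \<le> (\<rho> / 2 * norm h ^ 2) * norm w" by simp
  have "norm w \<le> \<rho> / 2 * norm h ^ 2"
  proof (cases "w = 0")
    case True
    then show ?thesis using rho_nonneg by simp
  next
    case False
    then show ?thesis using * by (intro mult_right_le_imp_le[OF *]) simp
  qed
  then show ?thesis by (simp only: w_def)
qed

lemma cubic_taylor:
  "f (x + h) \<le> f x + inner (gradient f x) h + 1 / 2 * inner (hessian f x *v h) h + \<rho> / 6 * norm h ^ 3"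
proof -
  let ?g = "inner (gradient f x) h" and ?q = "inner (hessian f x *v h) h"
  have "(f (x + 1 *\<^sub>R h) - 1 * ?g - 1\<^sup>2 / 2 * ?q) - (f (x + 0 *\<^sub>R h) - 0 * ?g - 0\<^sup>2 / 2 * ?q)
      \<le> \<rho> / 2 * norm h ^ 3 / real (Suc 2)"
  proof (rule increment_le_linear_rate)
    fix t :: real assume t: "0 \<le> t" "t \<le> 1"
    show "((\<lambda>t. f (x + t *\<^sub>R h) - t * ?g - t\<^sup>2 / 2 * ?q) has_real_derivative
        inner (gradient f (x + t *\<^sub>R h)) h - ?g - t * ?q) (at t)"
    proof (intro DERIV_diff line_deriv[OF twice])
      show "((\<lambda>t. t * a) has_real_derivative a) (at t)" for a
        by (auto intro!: derivative_eq_intros)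
      show "((\<lambda>t. t\<^sup>2 / 2 * a) has_real_derivative t * a) (at t)" for a
        by (auto intro!: derivative_eq_intros)
    qed
    have "inner (gradient f (x + t *\<^sub>R h)) h - ?g - t * ?q
        = inner (gradient f (x + t *\<^sub>R h) - gradient f x - hessian f x *v (t *\<^sub>R h)) h"
      by (simp add: inner_diff_left matrix_vector_mult_scaleR)
    also have "\<dots> \<le> norm (gradient f (x + t *\<^sub>R h) - gradient f x - hessian f x *v (t *\<^sub>R h)) * norm h"
      by (rule norm_cauchy_schwarz)
    also have "\<dots> \<le> \<rho> / 2 * norm (t *\<^sub>R h) ^ 2 * norm h"
      by (intro mult_right_mono gradient_taylor) auto
    also have "\<dots> = \<rho> / 2 * norm h ^ 3 * t\<^sup>2" using t by (simp add: power_mult_distrib eval_nat_numeral)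
    finally show "inner (gradient f (x + t *\<^sub>R h)) h - ?g - t * ?q \<le> \<rho> / 2 * norm h ^ 3 * t\<^sup>2" .
  qed
  then have le: "(f (x + h) - 1 * ?g - 1\<^sup>2 / 2 * ?q) - (f x - 0 * ?g - 0\<^sup>2 / 2 * ?q) \<le> \<rho> / 2 * norm h ^ 3 / real (Suc 2)"
    by (simp only: scaleR_one scaleR_zero_left add_0_right)
  have arith: "a \<le> b + g + 1 / 2 * q + r / 6 * m"
    if "(a - 1 * g - 1\<^sup>2 / 2 * q) - (b - 0 * g - 0\<^sup>2 / 2 * q) \<le> r / 2 * m / real (Suc 2)" for a b g q r m :: real
    using that by (simp add: field_simps)
  show ?thesis by (rule arith[OF le])
qed

lemma second_difference:
  "\<bar>f (x + u + v) - f (x + u) - f (x + v) + f x - inner (hessian f x *v u) v\<bar>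
     \<le> (\<rho> / 2 * norm u ^ 2 + \<rho> * norm v * norm u) * norm v"
proof -
  define g where "g \<sigma> t = \<sigma> * (f ((x + u) + t *\<^sub>R v) - f (x + t *\<^sub>R v) - t * inner (hessian f x *v u) v)" for \<sigma> t
  have bd: "g \<sigma> 1 - g \<sigma> 0 \<le> (\<rho> / 2 * norm u ^ 2 + \<rho> * norm v * norm u) * norm v / real (Suc 0)" if \<sigma>: "\<bar>\<sigma>\<bar> = 1" for \<sigma>
  proof (rule increment_le_linear_rate[where g = "g \<sigma>"])
    fix t :: real assume t: "0 \<le> t" "t \<le> 1"
    let ?y = "x + t *\<^sub>R v"
    let ?d = "gradient f (?y + u) - gradient f ?y - hessian f x *v u"
    have l1: "((\<lambda>t. f ((x + u) + t *\<^sub>R v)) has_real_derivative inner (gradient f ((x + u) + t *\<^sub>R v)) v) (at t)"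
      and l2: "((\<lambda>t. f (x + t *\<^sub>R v)) has_real_derivative inner (gradient f ?y) v) (at t)"
      by (rule line_deriv[OF twice])+
    have l3: "((\<lambda>t. t * inner (hessian f x *v u) v) has_real_derivative inner (hessian f x *v u) v) (at t)"
      by (auto intro!: derivative_eq_intros)
    have "\<sigma> * inner ?d v = \<sigma> * (inner (gradient f ((x + u) + t *\<^sub>R v)) v - inner (gradient f ?y) v - inner (hessian f x *v u) v)"
      by (simp add: inner_diff_left add_ac)
    then show "(g \<sigma> has_real_derivative \<sigma> * inner ?d v) (at t)"
      unfolding g_def by (simp only:) (rule DERIV_cmult[OF DERIV_diff[OF DERIV_diff[OF l1 l2] l3]])
    have "?d = (gradient f (?y + u) - gradient f ?y - hessian f ?y *v u) + (hessian f ?y - hessian f x) *v u"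
      by (simp add: matrix_vector_mult_diff_rdistrib)
    then have "norm ?d \<le> \<rho> / 2 * norm u ^ 2 + \<rho> * norm (?y - x) * norm u"
      by (simp only:) (intro norm_triangle_le add_mono gradient_taylor hessian_diff_le)
    also have "\<dots> \<le> \<rho> / 2 * norm u ^ 2 + \<rho> * norm v * norm u"
    proof -
      have "0 \<le> \<rho> * norm v" using rho_nonneg by simp
      then have "t * (\<rho> * norm v) \<le> 1 * (\<rho> * norm v)" using t by (intro mult_right_mono) auto
      then show ?thesis using t by (intro add_left_mono mult_right_mono) (auto simp: mult_ac)
    qed
    finally have "norm ?d * norm v \<le> (\<rho> / 2 * norm u ^ 2 + \<rho> * norm v * norm u) * norm v"
      by (rule mult_right_mono) simp
    moreover have "\<sigma> * inner ?d v \<le> norm ?d * norm v"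
    proof -
      have "\<bar>\<sigma> * inner ?d v\<bar> = \<bar>inner ?d v\<bar>" using \<sigma> by (simp add: abs_mult)
      then show ?thesis using Cauchy_Schwarz_ineq2[of ?d v] by linarith
    qed
    ultimately show "\<sigma> * inner ?d v \<le> (\<rho> / 2 * norm u ^ 2 + \<rho> * norm v * norm u) * norm v * t ^ 0" by simp
  qed
  show ?thesis using bd[of 1] bd[of "-1"] by (simp add: g_def abs_le_iff)
qed

text \<open>The second difference is symmetric in the two directions and agrees with the Hessian form up to
  third order; scaling both directions to zero gives the symmetry of the Hessian.\<close>

lemma hessian_symmetric: "transpose (hessian f x) = hessian f x"
proof -
  have "inner (hessian f x *v u) v = inner (hessian f x *v v) u" for u v
  proof -
    define H where "H u v = inner (hessian f x *v u) v" for u v :: "real^'d"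
    define K where "K u v = (\<rho> / 2 * norm u ^ 2 + \<rho> * norm v * norm u) * norm v" for u v :: "real^'d"
    have *: "\<bar>H u v - H v u\<bar> \<le> K u v + K v u" for u v
      using second_difference[of x u v] second_difference[of x v u]
      by (simp add: H_def K_def add.commute add.left_commute abs_le_iff)
    have "\<bar>H u v - H v u\<bar> \<le> s * (K u v + K v u)" if "s > 0" for s
    proof -
      have "H (s *\<^sub>R u) (s *\<^sub>R v) - H (s *\<^sub>R v) (s *\<^sub>R u) = s\<^sup>2 * (H u v - H v u)"
        by (simp add: H_def matrix_vector_mult_scaleR power2_eq_square algebra_simps)
      moreover have "K (s *\<^sub>R u) (s *\<^sub>R v) + K (s *\<^sub>R v) (s *\<^sub>R u) = s\<^sup>2 * (s * (K u v + K v u))"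
        using that by (simp add: K_def power2_eq_square algebra_simps)
      ultimately have "s\<^sup>2 * \<bar>H u v - H v u\<bar> \<le> s\<^sup>2 * (s * (K u v + K v u))"
        using *[of "s *\<^sub>R u" "s *\<^sub>R v"] by (simp add: abs_mult)
      then show ?thesis using that by simp
    qed
    then have "eventually (\<lambda>s. \<bar>H u v - H v u\<bar> \<le> s * (K u v + K v u)) (at_right 0)"
      by (simp add: eventually_at_right_less eventually_mono[OF eventually_at_right_less])
    moreover have "((\<lambda>s. s * (K u v + K v u)) \<longlongrightarrow> 0) (at_right 0)"
      by (auto intro!: tendsto_eq_intros)
    ultimately have "\<bar>H u v - H v u\<bar> \<le> 0"
      by (intro tendsto_lowerbound[where F = "at_right 0"]) auto
    then show ?thesis by (simp add: H_def)
  qed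
  then have "transpose (hessian f x) *v u = hessian f x *v u" for u
    by (metis dot_lmul_matrix inner_commute transpose_matrix_vector vector_eq_ldot)
  then show ?thesis by (simp add: matrix_eq)
qed

end

section \<open>Minimizers of the cubic model\<close>

lemma cubic_model_0 [simp]: "cubic_model v U M 0 = 0"
  by (simp add: cubic_model_def)

lemma cubic_model_argmin_exists:
  assumes M: "M > 0"
  shows "{h. is_arg_min (cubic_model v U M) (\<lambda>_. True) h} \<noteq> {}"
proof -
  \<comment> \<open>Outside the ball of radius \<open>R\<close>, the cubic term dominates and the model is nonnegative.\<close>
  define R where "R = 1 + 6 * (norm v + norm U) / M"
  have R: "R \<ge> 1" using M by (simp add: R_def)
  have cont: "continuous_on (cball 0 R) (cubic_model v U M)"
    unfolding cubic_model_def
    by (intro continuous_intros bounded_linear.continuous_on[OF matrix_vector_mul_bounded_linear])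
  obtain h0 where h0: "h0 \<in> cball 0 R" "\<And>h. h \<in> cball 0 R \<Longrightarrow> cubic_model v U M h0 \<le> cubic_model v U M h"
    using continuous_attains_inf[OF compact_cball _ cont] R by auto
  have "cubic_model v U M h0 \<le> 0" using h0(2)[of 0] R by simp
  have out: "0 \<le> cubic_model v U M h" if "norm h > R" for h
  proof -
    let ?r = "norm h"
    have r: "1 \<le> ?r" using that R by simp
    have a: "norm v + norm U \<le> M / 6 * ?r"
      using that M by (simp add: R_def field_simps)
    have "\<bar>inner v h\<bar> \<le> norm v * ?r" by (rule Cauchy_Schwarz_ineq2)
    moreover have "norm v * ?r \<le> norm v * ?r\<^sup>2"
      using power_increasing[of 1 2 ?r] r by (intro mult_left_mono) auto
    moreover have "\<bar>inner (U *v h) h\<bar> \<le> norm U * ?r\<^sup>2"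
    proof -
      have "\<bar>inner (U *v h) h\<bar> \<le> norm (U *v h) * ?r" by (rule Cauchy_Schwarz_ineq2)
      also have "\<dots> \<le> norm U * ?r * ?r" by (intro mult_right_mono norm_matrix_vector_le) simp
      finally show ?thesis by (simp add: power2_eq_square mult.assoc)
    qed
    moreover have "(norm v + norm U) * ?r\<^sup>2 \<le> M / 6 * ?r * ?r\<^sup>2"
      by (rule mult_right_mono[OF a]) simp
    moreover have "M / 6 * ?r * ?r\<^sup>2 = M / 6 * ?r ^ 3" by (simp add: eval_nat_numeral)
    moreover have "0 \<le> norm U * ?r\<^sup>2" by simp
    ultimately show ?thesis unfolding cubic_model_def distrib_right by linarith
  qed
  have "cubic_model v U M h0 \<le> cubic_model v U M h" for h
    using h0(2)[of h] out[of h] \<open>cubic_model v U M h0 \<le> 0\<close> by (cases "norm h \<le> R") auto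
  then have "is_arg_min (cubic_model v U M) (\<lambda>_. True) h0" by (simp add: is_arg_min_def not_less)
  then show ?thesis by blast
qed

lemma is_arg_min_le: "is_arg_min f (\<lambda>_. True) h \<Longrightarrow> f h \<le> (f h' :: real)"
  by (auto simp: is_arg_min_def not_less)

lemma cubic_model_add:
  assumes "transpose U = U"
  shows "cubic_model v U M (h + w) = cubic_model v U M h + inner (v + U *v h) w
           + 1 / 2 * inner (U *v w) w + M / 6 * (norm (h + w) ^ 3 - norm h ^ 3)"
proof -
  have "inner (U *v w) h = inner (U *v h) w"
    using inner_symmetric_matrix[OF assms, of w h] by (simp add: inner_commute)
  then show ?thesis
    by (simp add: cubic_model_def inner_add_left inner_add_right matrix_vector_right_distrib algebra_simps)
qed

text \<open>The first-order condition, in the form of a norm bound: compare \<open>h\<close> with \<open>h - t g\<close>, where \<open>g\<close> is the gradient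
  of the quadratic part, and let \<open>t\<close> tend to \<open>0\<close>. This avoids differentiating the cubed norm.\<close>

lemma cubic_argmin_stationary:
  fixes h v :: "real^'d"
  assumes min: "is_arg_min (cubic_model v U M) (\<lambda>_. True) h" and sym: "transpose U = U" and M: "M > 0"
  shows "norm (v + U *v h) \<le> M / 2 * norm h ^ 2"
proof -
  define g where "g = v + U *v h"
  define r where "r = norm h"
  define n where "n = norm g"
  define q where "q = inner (U *v g) g"
  have r0: "0 \<le> r" and n0: "0 \<le> n" by (simp_all add: r_def n_def)
  have ev: "n\<^sup>2 \<le> t / 2 * q + M / 6 * n * (3 * r\<^sup>2 + 3 * r * (t * n) + (t * n)\<^sup>2)" if t: "t > 0" for t
  proof -
    define s where "s = t * n"
    have s0: "0 \<le> s" using t n0 by (simp add: s_def)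
    have "cubic_model v U M h \<le> cubic_model v U M (h + (- t) *\<^sub>R g)" by (rule is_arg_min_le[OF min])
    moreover have "inner (v + U *v h) ((- t) *\<^sub>R g) = - (t * n\<^sup>2)"
      unfolding g_def[symmetric] by (simp add: n_def power2_norm_eq_inner)
    moreover have "inner (U *v ((- t) *\<^sub>R g)) ((- t) *\<^sub>R g) = t\<^sup>2 * q"
      unfolding matrix_vector_mult_scaleR by (simp add: q_def power2_eq_square)
    moreover have "norm (h + (- t) *\<^sub>R g) ^ 3 \<le> (r + s) ^ 3"
      using norm_triangle_ineq[of h "(- t) *\<^sub>R g"] t
      by (intro power_mono) (simp_all add: r_def s_def n_def)
    ultimately have "0 \<le> - (t * n\<^sup>2) + 1 / 2 * (t\<^sup>2 * q) + M / 6 * ((r + s) ^ 3 - r ^ 3)"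
      unfolding cubic_model_add[OF sym] r_def
      using M by (smt (verit) mult_left_mono divide_nonneg_nonneg)
    also have "(r + s) ^ 3 - r ^ 3 = s * (3 * r\<^sup>2 + 3 * r * s + s\<^sup>2)"
      by (simp add: eval_nat_numeral algebra_simps)
    finally have "t * n\<^sup>2 \<le> 1 / 2 * (t\<^sup>2 * q) + M / 6 * (s * (3 * r\<^sup>2 + 3 * r * s + s\<^sup>2))" by linarith
    also have "\<dots> = t * (t / 2 * q + M / 6 * n * (3 * r\<^sup>2 + 3 * r * s + s\<^sup>2))"
      unfolding s_def by (simp add: power2_eq_square algebra_simps)
    finally show ?thesis using t by (simp add: s_def)
  qed
  have "((\<lambda>t. t / 2 * q + M / 6 * n * (3 * r\<^sup>2 + 3 * r * (t * n) + (t * n)\<^sup>2)) \<longlongrightarrow>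
      0 / 2 * q + M / 6 * n * (3 * r\<^sup>2 + 3 * r * (0 * n) + (0 * n)\<^sup>2)) (at_right 0)"
    by (intro tendsto_intros) auto
  moreover have "eventually (\<lambda>t. n\<^sup>2 \<le> t / 2 * q + M / 6 * n * (3 * r\<^sup>2 + 3 * r * (t * n) + (t * n)\<^sup>2)) (at_right 0)"
    by (rule eventually_mono[OF eventually_at_right_less]) (rule ev)
  ultimately have "n\<^sup>2 \<le> 0 / 2 * q + M / 6 * n * (3 * r\<^sup>2 + 3 * r * (0 * n) + (0 * n)\<^sup>2)"
    by (rule tendsto_lowerbound) simp
  then have "n * n \<le> (M / 2 * r\<^sup>2) * n" by (simp add: power2_eq_square mult_ac)
  then have "n \<le> M / 2 * r\<^sup>2"
    using n0 M by (cases "n = 0") (auto intro: mult_right_le_imp_le)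
  then show ?thesis by (simp add: n_def g_def r_def)
qed

text \<open>Comparing \<open>h\<close> with both \<open>h + s u\<close> and \<open>h - s u\<close> cancels the linear term. The constant is not optimal,
  but it needs no first-order condition and no case distinction on the direction of \<open>u\<close>.\<close>

lemma cubic_argmin_curvature:
  fixes h v :: "real^'d"
  assumes min: "is_arg_min (cubic_model v U M) (\<lambda>_. True) h" and sym: "transpose U = U" and M: "M > 0"
    and s: "s > 0" "norm h \<le> s" and u: "norm u = 1"
  shows "inner (U *v u) u \<ge> - (4 * M / 3) * s"
proof -
  define p where "p = norm (h + s *\<^sub>R u)"
  define q where "q = norm (h + (- s) *\<^sub>R u)"
  have le: "p \<le> 2 * s" "q \<le> 2 * s"
    using norm_triangle_ineq[of h "s *\<^sub>R u"] norm_triangle_ineq[of h "(- s) *\<^sub>R u"] s u by (simp_all add: p_def q_def)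
  have "p\<^sup>2 + q\<^sup>2 = 2 * (norm h ^ 2 + s\<^sup>2)"
  proof -
    have "inner u u = 1" using u by (simp add: norm_eq_1)
    then show ?thesis unfolding p_def q_def power2_norm_eq_inner
      by (simp add: inner_add_left inner_add_right inner_diff_left inner_diff_right algebra_simps power2_eq_square)
  qed
  also have "\<dots> \<le> 4 * s\<^sup>2" using power_mono[OF s(2), of 2] by simp
  finally have sq: "p\<^sup>2 + q\<^sup>2 \<le> 4 * s\<^sup>2" .
  have "p ^ 3 + q ^ 3 = p * p\<^sup>2 + q * q\<^sup>2" by (simp add: eval_nat_numeral)
  also have "\<dots> \<le> 2 * s * p\<^sup>2 + 2 * s * q\<^sup>2"
    by (intro add_mono mult_right_mono le) auto
  also have "\<dots> = 2 * s * (p\<^sup>2 + q\<^sup>2)" by (simp add: distrib_left)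
  also have "\<dots> \<le> 2 * s * (4 * s\<^sup>2)" using s by (intro mult_left_mono sq) auto
  finally have cube: "p ^ 3 + q ^ 3 \<le> 8 * s * s\<^sup>2" by simp
  have sc: "inner (U *v (c *\<^sub>R u)) (c *\<^sub>R u) = c\<^sup>2 * inner (U *v u) u" for c
    unfolding matrix_vector_mult_scaleR by (simp add: power2_eq_square)
  have "0 \<le> inner (v + U *v h) (s *\<^sub>R u) + 1 / 2 * (s\<^sup>2 * inner (U *v u) u) + M / 6 * (p ^ 3 - norm h ^ 3)"
    using is_arg_min_le[OF min, of "h + s *\<^sub>R u"] unfolding cubic_model_add[OF sym] sc p_def by linarith
  moreover have "0 \<le> inner (v + U *v h) ((- s) *\<^sub>R u) + 1 / 2 * (s\<^sup>2 * inner (U *v u) u) + M / 6 * (q ^ 3 - norm h ^ 3)"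
    using is_arg_min_le[OF min, of "h + (- s) *\<^sub>R u"] unfolding cubic_model_add[OF sym] sc q_def power2_minus by linarith
  moreover have "inner (v + U *v h) ((- s) *\<^sub>R u) = - inner (v + U *v h) (s *\<^sub>R u)" by simp
  ultimately have "0 \<le> s\<^sup>2 * inner (U *v u) u + M / 6 * (p ^ 3 + q ^ 3 - 2 * norm h ^ 3)"
    by (simp add: algebra_simps)
  also have "\<dots> \<le> s\<^sup>2 * inner (U *v u) u + M / 6 * (8 * s * s\<^sup>2)"
  proof -
    have "0 \<le> norm h ^ 3" by simp
    then have "p ^ 3 + q ^ 3 - 2 * norm h ^ 3 \<le> 8 * s * s\<^sup>2" using cube by linarith
    then show ?thesis using M by (intro add_left_mono mult_left_mono) auto
  qed
  also have "\<dots> = s\<^sup>2 * (inner (U *v u) u + 4 * M / 3 * s)" by (simp add: algebra_simps)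
  finally show ?thesis using s by (simp add: zero_le_mult_iff)
qed

section \<open>Smallest eigenvalues\<close>

text \<open>Eigenvectors of a symmetric matrix for distinct eigenvalues are orthogonal, hence independent.\<close>

lemma finite_eigenvalues:
  fixes A :: "real^'d^'d"
  assumes sym: "transpose A = A"
  shows "finite {c. \<exists>v. v \<noteq> 0 \<and> A *v v = c *\<^sub>R v}" (is "finite ?S")
proof -
  define w where "w c = (SOME v. v \<noteq> 0 \<and> A *v v = c *\<^sub>R v)" for c
  have w: "w c \<noteq> 0" "A *v w c = c *\<^sub>R w c" if "c \<in> ?S" for c
    using someI_ex[of "\<lambda>v. v \<noteq> 0 \<and> A *v v = c *\<^sub>R v"] that by (auto simp: w_def)
  have orth: "inner (w c) (w e) = 0" if "c \<in> ?S" "e \<in> ?S" "c \<noteq> e" for c e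
    using inner_symmetric_matrix[OF sym, of "w c" "w e"] that by (simp add: w)
  have inj: "inj_on w ?S"
  proof (rule inj_onI, rule ccontr)
    fix c e assume "c \<in> ?S" "e \<in> ?S" "w c = w e" "c \<noteq> e"
    then show False using orth[of c e] w(1)[of e] by simp
  qed
  have "pairwise orthogonal (w ` ?S)"
    unfolding pairwise_def orthogonal_def using orth by auto
  moreover have "0 \<notin> w ` ?S" 
  proof
    assume "0 \<in> w ` ?S"
    then obtain c where "0 = w c" "c \<in> ?S" by (rule imageE)
    then show False using w(1)[of c] by simp
  qed
  ultimately have "independent (w ` ?S)" by (rule pairwise_orthogonal_independent)
  then have "finite (w ` ?S)" using independent_bound by blast
  then show ?thesis using inj by (rule finite_imageD)
qed

text \<open>A minimizer of the Rayleigh quotient on the unit sphere is an eigenvector.\<close>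

lemma eigenvalue_exists:
  fixes A :: "real^'d^'d"
  assumes sym: "transpose A = A"
  shows "\<exists>c v. v \<noteq> 0 \<and> A *v v = c *\<^sub>R v"
proof -
  let ?R = "\<lambda>x. inner (A *v x) x"
  have cont: "continuous_on (sphere 0 1) ?R"
    by (intro continuous_intros bounded_linear.continuous_on[OF matrix_vector_mul_bounded_linear])
  have "axis undefined 1 \<in> (sphere 0 1 :: (real^'d) set)" by simp
  then have "(sphere 0 1 :: (real^'d) set) \<noteq> {}" by blast
  then obtain x where x: "x \<in> sphere 0 1" and xmin: "\<And>y. y \<in> sphere 0 1 \<Longrightarrow> ?R x \<le> ?R y"
    using continuous_attains_inf[OF compact_sphere _ cont] by blast
  define \<mu> where "\<mu> = ?R x"
  have xx: "inner x x = 1" using x by (simp add: norm_eq_1)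
  have psd: "\<mu> * inner y y \<le> ?R y" for y
  proof (cases "y = 0")
    case False
    define z where "z = (1 / norm y) *\<^sub>R y"
    have "z \<in> sphere 0 1" using False by (simp add: z_def)
    then have "\<mu> \<le> ?R z" unfolding \<mu>_def by (rule xmin)
    also have "?R z = ?R y / inner y y"
      unfolding z_def matrix_vector_mult_scaleR
      by (simp flip: power2_norm_eq_inner) (simp add: power2_eq_square)
    finally show ?thesis using False by (simp add: field_simps)
  qed simp
  define g where "g = A *v x - \<mu> *\<^sub>R x"
  define k where "k = ?R g - \<mu> * inner g g"
  have ev: "2 * inner g g \<le> t * k" if "t > 0" for t
  proof -
    have Agx: "inner (A *v g) x = inner (A *v x) g"
      using inner_symmetric_matrix[OF sym, of g x] by (simp add: inner_commute)
    have "0 \<le> ?R (x - t *\<^sub>R g) - \<mu> * inner (x - t *\<^sub>R g) (x - t *\<^sub>R g)"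
      using psd[of "x - t *\<^sub>R g"] by simp
    also have "\<dots> = (\<mu> - \<mu> * inner x x) - 2 * t * (inner (A *v x) g - \<mu> * inner x g) + t\<^sup>2 * k"
      by (simp add: k_def \<mu>_def Agx inner_diff_left inner_diff_right matrix_vector_mult_diff_distrib
          matrix_vector_mult_scaleR inner_commute[of g x] power2_eq_square algebra_simps)
    also have "\<dots> = t * (t * k - 2 * inner g g)"
      by (simp add: xx g_def inner_diff_left power2_eq_square algebra_simps)
    finally show ?thesis using that by (simp add: zero_le_mult_iff)
  qed
  have "((\<lambda>t. t * k) \<longlongrightarrow> 0 * k) (at_right 0)" by (intro tendsto_intros)
  moreover have "eventually (\<lambda>t. 2 * inner g g \<le> t * k) (at_right 0)"
    by (rule eventually_mono[OF eventually_at_right_less]) (rule ev)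
  ultimately have "2 * inner g g \<le> 0 * k" by (rule tendsto_lowerbound) simp
  then have "inner g g = 0" using inner_ge_zero[of g] by linarith
  then have "g = 0" by simp
  then have "A *v x = \<mu> *\<^sub>R x" by (simp add: g_def)
  moreover have "x \<noteq> 0" using x by auto
  ultimately show ?thesis by blast
qed

text \<open>The two preceding lemmas are needed because \<^const>\<open>lambda_min\<close> is a minimum over the set of
  eigenvalues, which says something only if that set is finite and nonempty.\<close>

lemma lambda_min_ge:
  fixes A :: "real^'d^'d"
  assumes sym: "transpose A = A" and ge: "\<And>u. norm u = 1 \<Longrightarrow> inner (A *v u) u \<ge> c"
  shows "lambda_min A \<ge> c"
proof -
  let ?S = "{c. \<exists>v. v \<noteq> 0 \<and> A *v v = c *\<^sub>R v}"
  have "lambda_min A \<in> ?S"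
    unfolding lambda_min_def using finite_eigenvalues[OF sym] eigenvalue_exists[OF sym] by (intro Min_in) auto
  then obtain v where v: "v \<noteq> 0" "A *v v = lambda_min A *\<^sub>R v" by auto
  define u where "u = (1 / norm v) *\<^sub>R v"
  have u: "norm u = 1" using v(1) by (simp add: u_def)
  have "A *v u = lambda_min A *\<^sub>R u" by (simp add: u_def matrix_vector_mult_scaleR v(2))
  then show ?thesis using ge[OF u] u by (simp add: norm_eq_1)
qed

section \<open>Tail bounds for recursive minibatch estimators\<close>

lemma cosh_potential_vector:
  "cosh_potential (UNIV :: (real^'d) set) norm (\<lambda>e. ennreal (cosh (norm e))) 1"
proof
  fix I :: "nat set" and a :: "nat \<Rightarrow> real^'d" and c e
  assume a: "\<And>i. i \<in> I \<Longrightarrow> norm (a i) \<le> c" "0 \<le> c" "(\<Sum>i\<in>I. a i) = 0"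
  have "(\<Sum>i\<in>I. ennreal (cosh (norm (e + a i)))) = ennreal (\<Sum>i\<in>I. cosh (norm (e + a i)))"
    by (rule sum_ennreal) simp
  also have "\<dots> \<le> ennreal (real (card I) * exp (c\<^sup>2 / 2) * cosh (norm e))"
    by (intro ennreal_leI sum_cosh_norm_le a)
  finally show "(\<Sum>i\<in>I. ennreal (cosh (norm (e + a i)))) \<le> of_nat (card I) * ennreal (exp (c\<^sup>2 / 2)) * ennreal (cosh (norm e))"
    by (simp add: ennreal_mult ennreal_of_nat_eq_real_of_nat)
next
  fix e :: "real^'d" and r :: real
  assume "0 \<le> r" "r < norm e"
  then show "ennreal (cosh r) \<le> ennreal (cosh (norm e))"
    by (intro ennreal_leI) (simp add: cosh_real_nonneg_le_iff)
qed (auto simp: subspace_def)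

lemma subspace_symmetric: "subspace {A :: real^'d^'d. transpose A = A}"
  by (auto simp: subspace_def transpose_def vec_eq_iff)

lemma cosh_potential_matrix:
  "cosh_potential {A :: real^'d^'d. transpose A = A} spectral_norm trace_cosh (real CARD('d))"
proof
  fix I :: "nat set" and a :: "nat \<Rightarrow> real^'d^'d" and c and e :: "real^'d^'d"
  assume a: "\<And>i. i \<in> I \<Longrightarrow> a i \<in> {A. transpose A = A}" "\<And>i. i \<in> I \<Longrightarrow> spectral_norm (a i) \<le> c"
    "0 \<le> c" "(\<Sum>i\<in>I. a i) = 0" "e \<in> {A. transpose A = A}"
  have bd: "norm (a i *v u) \<le> c * norm u" if "i \<in> I" for i u
    by (rule order_trans[OF norm_mult_spectral_norm_le mult_right_mono[OF a(2)[OF that]]]) simp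
  show "(\<Sum>i\<in>I. trace_cosh (e + a i)) \<le> of_nat (card I) * ennreal (exp (c\<^sup>2 / 2)) * trace_cosh e"
    using a by (intro sum_trace_cosh_le bd) auto
next
  fix e :: "real^'d^'d" and r :: real
  assume e: "e \<in> {A. transpose A = A}" and r: "0 \<le> r" "r < spectral_norm e"
  have "\<exists>u. norm u = 1 \<and> r < norm (e *v u)"
  proof (rule ccontr)
    assume *: "\<not> ?thesis"
    have "norm (e *v u) \<le> r * norm u" for u
    proof (cases "u = 0")
      case False
      have "norm (e *v ((1 / norm u) *\<^sub>R u)) \<le> r" using * False by (force simp: not_less)
      then show ?thesis using False by (simp add: matrix_vector_mult_scaleR field_simps)
    qed simp
    then have "spectral_norm e \<le> r" using r(1) by (rule spectral_norm_leI)
    then show False using r(2) by simp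
  qed
  then obtain u where u: "norm u = 1" "r < norm (e *v u)" by blast
  have "ennreal (cosh r) \<le> ennreal (cosh (norm (e *v u)))"
    using r(1) u(2) by (intro ennreal_leI) (simp add: cosh_real_nonneg_le_iff)
  also have "\<dots> \<le> trace_cosh e" using e u(1) by (intro cosh_le_trace_cosh) auto
  finally show "ennreal (cosh r) \<le> trace_cosh e" .
qed (auto simp: subspace_symmetric spectral_norm_scaleR trace_cosh_0)

text \<open>The sample mean of \<open>g i x\<close> over an index multiset, replaced by the exact mean for large batches.\<close>

definition minibatch :: "nat \<Rightarrow> (nat \<Rightarrow> 'a \<Rightarrow> 'b::real_normed_vector) \<Rightarrow> ('a \<Rightarrow> 'b) \<Rightarrow> nat multiset \<Rightarrow> 'a \<Rightarrow> 'b" where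
  "minibatch n g gbar J x = (if size J < n then (1 / real (size J)) *\<^sub>R (\<Sum>i\<in>#J. g i x) else gbar x)"

lemma minibatch_error:
  assumes "J \<noteq> {#}"
  shows "minibatch n g gbar J x - gbar x
    = (if size J < n then (1 / real (size J)) *\<^sub>R (\<Sum>i\<in>#J. g i x - gbar x) else 0)"
proof -
  have "(\<Sum>i\<in>#J. g i x - gbar x) = (\<Sum>i\<in>#J. g i x) - real (size J) *\<^sub>R gbar x"
    by (induction J) (simp_all add: algebra_simps)
  then show ?thesis using assms by (simp add: minibatch_def scaleR_diff_right)
qed

lemma sum_mset_subtract: "(\<Sum>i\<in>#J. a i - b i) = (\<Sum>i\<in>#J. a i) - (\<Sum>i\<in>#J. b i :: 'b::ab_group_add)"
  by (induction J) (simp_all add: algebra_simps)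

context cosh_potential
begin

lemma nn_integral_refresh:
  assumes n: "n \<ge> 1" and B: "B > 0" and lam: "\<theta> \<ge> 0" and c: "c \<ge> 0" and q: "q \<ge> 0"
    and cq: "B < n \<Longrightarrow> c\<^sup>2 \<le> q * real B"
    and a: "\<And>i. i \<in> {1..n} \<Longrightarrow> g i x - gbar x \<in> V" "\<And>i. i \<in> {1..n} \<Longrightarrow> N (g i x - gbar x) \<le> c"
    and mean: "(\<Sum>i\<in>{1..n}. g i x - gbar x) = 0"
  shows "(\<integral>\<^sup>+J. \<Phi> (\<theta> *\<^sub>R (minibatch n g gbar J x - gbar x)) \<partial>measure_pmf (sample_indices n B))
          \<le> ennreal (exp (\<theta>\<^sup>2 * q / 2)) * ennreal D"
proof -
  have "(\<integral>\<^sup>+J. \<Phi> (\<theta> *\<^sub>R (minibatch n g gbar J x - gbar x)) \<partial>measure_pmf (sample_indices n B))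
      \<le> ennreal (exp (\<theta>\<^sup>2 * q / 2)) * \<Phi> (\<theta> *\<^sub>R 0)"
  proof (rule nn_integral_sample_correction[OF n B lam c q cq a mean])
    show "0 \<in> V" by (rule subspace_0[OF V])
    show "minibatch n g gbar J x - gbar x
      = 0 + (if B < n then (1 / real B) *\<^sub>R (\<Sum>i\<in>#J. g i x - gbar x) else 0)" if "size J = B" for J
    proof -
      have "J \<noteq> {#}" using that B by auto
      then show ?thesis using minibatch_error[of J n g gbar x] that by simp
    qed
  qed
  then show ?thesis by (simp add: Phi_0)
qed

lemma nn_integral_update:
  assumes n: "n \<ge> 1" and B: "B > 0" and lam: "\<theta> \<ge> 0" and c: "c \<ge> 0" and q: "q \<ge> 0"
    and cq: "B < n \<Longrightarrow> c\<^sup>2 \<le> q * real B"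
    and a: "\<And>i z. i \<in> {1..n} \<Longrightarrow> g i z - gbar z \<in> V"
      "\<And>i. i \<in> {1..n} \<Longrightarrow> N ((g i x - gbar x) - (g i y - gbar y)) \<le> c"
    and mean: "\<And>z. (\<Sum>i\<in>{1..n}. g i z - gbar z) = 0" and e: "v - gbar y \<in> V"
  shows "(\<integral>\<^sup>+J. \<Phi> (\<theta> *\<^sub>R (minibatch n g gbar J x - minibatch n g gbar J y + v - gbar x))
            \<partial>measure_pmf (sample_indices n B))
          \<le> ennreal (exp (\<theta>\<^sup>2 * q / 2)) * \<Phi> (\<theta> *\<^sub>R (v - gbar y))"
proof (rule nn_integral_sample_correction[OF n B lam c q cq])
  show "(g i x - gbar x) - (g i y - gbar y) \<in> V" if "i \<in> {1..n}" for i
    using that by (intro subspace_diff[OF V] a(1))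
  show "(\<Sum>i\<in>{1..n}. (g i x - gbar x) - (g i y - gbar y)) = 0"
    unfolding sum_subtractf[of "\<lambda>i. g i x - gbar x" "\<lambda>i. g i y - gbar y"] mean by simp
  show "minibatch n g gbar J x - minibatch n g gbar J y + v - gbar x
      = (v - gbar y) + (if B < n then (1 / real B) *\<^sub>R (\<Sum>i\<in>#J. (g i x - gbar x) - (g i y - gbar y)) else 0)"
    if "size J = B" for J
  proof -
    have J: "J \<noteq> {#}" using that B by auto
    have "minibatch n g gbar J x - minibatch n g gbar J y + v - gbar x
        = (v - gbar y) + ((minibatch n g gbar J x - gbar x) - (minibatch n g gbar J y - gbar y))"
      by (simp add: algebra_simps)
    also have "\<dots> = (v - gbar y) + (if B < n then (1 / real B) *\<^sub>R (\<Sum>i\<in>#J. (g i x - gbar x) - (g i y - gbar y)) else 0)"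
      unfolding minibatch_error[OF J] that sum_mset_subtract by (simp add: scaleR_diff_right)
    finally show ?thesis .
  qed
qed (use a e in auto)

text \<open>The tail bound for the recursive estimator. Minimizing \<open>exp (\<theta>\<^sup>2 q - \<theta> r)\<close> over the scaling \<open>\<theta>\<close> of the
  potential gives \<open>\<theta> = r / (2 q) = 6 l\<^sup>2 / r\<close> and the value \<open>exp (- 3 l\<^sup>2)\<close>. The inequality \<open>ln 2 \<ge> 2 / 3\<close> then
  turns \<open>2 exp (- 3 l\<^sup>2)\<close> into \<open>exp (- l)\<close>; this is why the square of the logarithm suffices in the batch
  sizes even when the logarithm is less than \<open>1\<close>.\<close>

lemma estimator_tail:
  fixes err :: "'s \<Rightarrow> 'b"
  assumes proc: "history_process stop step law"
    and S: "S > 0" and l: "ln 2 \<le> l" and r: "r > 0" and q: "q = r\<^sup>2 / (12 * l\<^sup>2)"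
    and refresh: "\<And>t \<omega> \<theta>. t < T \<Longrightarrow> \<omega> \<in> set_pmf (law t) \<Longrightarrow> \<not> stop \<omega> \<Longrightarrow> t mod S = 0 \<Longrightarrow> \<theta> \<ge> 0 \<Longrightarrow>
          (\<integral>\<^sup>+\<omega>'. \<Phi> (\<theta> *\<^sub>R err (hd \<omega>')) \<partial>step \<omega>) \<le> ennreal (exp (\<theta>\<^sup>2 * q / 2)) * ennreal D"
    and update: "\<And>t \<omega> \<theta>. t < T \<Longrightarrow> \<omega> \<in> set_pmf (law t) \<Longrightarrow> \<not> stop \<omega> \<Longrightarrow> t mod S \<noteq> 0 \<Longrightarrow> \<theta> \<ge> 0 \<Longrightarrow>
          (\<integral>\<^sup>+\<omega>'. \<Phi> (\<theta> *\<^sub>R err (hd \<omega>')) \<partial>step \<omega>) \<le> ennreal (exp (\<theta>\<^sup>2 * (q / real S) / 2)) * \<Phi> (\<theta> *\<^sub>R err (hd \<omega>))"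
    and errV: "\<And>t \<omega>. \<omega> \<in> set_pmf (law t) \<Longrightarrow> \<omega> \<noteq> [] \<Longrightarrow> err (hd \<omega>) \<in> V"
  shows "emeasure (law T) {\<omega>. \<exists>s\<in>set \<omega>. r < N (err s)} \<le> ennreal (real T * (D * exp (- l)))"
proof -
  interpret history_process stop step law by (rule proc)
  have l0: "l > 0" using l ln_gt_zero[of "2::real"] by linarith
  define \<theta> where "\<theta> = 6 * l\<^sup>2 / r"
  have th: "\<theta> > 0" using l0 r by (simp add: \<theta>_def)
  have thr: "\<theta> * r = 6 * l\<^sup>2" using r by (simp add: \<theta>_def)
  have thq: "\<theta>\<^sup>2 * q / 2 = 3 / 2 * l\<^sup>2"
    using l0 r by (simp add: \<theta>_def q power2_eq_square field_simps)
  have each: "emeasure (law (Suc t)) {\<omega>. length \<omega> = Suc t \<and> r < N (err (hd \<omega>))} \<le> ennreal (D * exp (- l))"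
    if t: "t < T" for t
  proof -
    have "(\<integral>\<^sup>+\<omega>. indicator {\<omega>. length \<omega> = Suc t} \<omega> * \<Phi> (\<theta> *\<^sub>R err (hd \<omega>)) \<partial>law (Suc t))
        \<le> ennreal (exp (2 * (\<theta>\<^sup>2 * q / 2)) * D)"
    proof (rule nn_integral_last_le[where \<Psi> = "\<lambda>s. \<Phi> (\<theta> *\<^sub>R err s)", OF S _ D_nonneg _ _ t])
      show "0 \<le> \<theta>\<^sup>2 * q / 2" by (simp add: q)
      show "(\<integral>\<^sup>+\<omega>'. \<Phi> (\<theta> *\<^sub>R err (hd \<omega>')) \<partial>step \<omega>) \<le> ennreal (exp (\<theta>\<^sup>2 * q / 2)) * ennreal D"
        if "t < T" "\<omega> \<in> set_pmf (law t)" "\<not> stop \<omega>" "t mod S = 0" for t \<omega>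
        using refresh[OF that] th by simp
      show "(\<integral>\<^sup>+\<omega>'. \<Phi> (\<theta> *\<^sub>R err (hd \<omega>')) \<partial>step \<omega>) \<le> ennreal (exp (\<theta>\<^sup>2 * q / 2 / real S)) * \<Phi> (\<theta> *\<^sub>R err (hd \<omega>))"
        if "t < T" "\<omega> \<in> set_pmf (law t)" "\<not> stop \<omega>" "t mod S \<noteq> 0" for t \<omega>
        using update[OF that, of \<theta>] th by (simp add: field_simps)
    qed
    then have A: "(\<integral>\<^sup>+\<omega>. indicator {\<omega>. length \<omega> = Suc t} \<omega> * \<Phi> (\<theta> *\<^sub>R err (hd \<omega>)) \<partial>law (Suc t))
        \<le> ennreal (exp (3 * l\<^sup>2) * D)" unfolding thq by simp
    have "emeasure (law (Suc t)) {\<omega>. length \<omega> = Suc t \<and> r < N (err (hd \<omega>))}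
        \<le> ennreal (exp (3 * l\<^sup>2) * D / cosh (6 * l\<^sup>2))"
    proof (rule emeasure_last_le[OF _ _ A])
      fix \<omega> assume w: "\<omega> \<in> set_pmf (law (Suc t))" "\<omega> \<noteq> []" "r < N (err (hd \<omega>))"
      have "\<theta> * r < N (\<theta> *\<^sub>R err (hd \<omega>))" using w(3) th by (simp add: N_scaleR)
      then show "ennreal (cosh (6 * l\<^sup>2)) \<le> \<Phi> (\<theta> *\<^sub>R err (hd \<omega>))"
        unfolding thr using errV[OF w(1,2)] by (intro Phi_tail subspace_scale[OF V]) auto
    qed (use D_nonneg in auto)
    also have "\<dots> \<le> ennreal (D * exp (- l))"
    proof (rule ennreal_leI)
      have "2 * l \<le> 3 * (ln 2 * l)" using ln2_ge_two_thirds l0 by (simp add: field_simps mult_right_mono)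
      also have "\<dots> \<le> 3 * (l * l)" using l l0 by (simp add: mult_right_mono)
      finally have "ln 2 + 3 * l\<^sup>2 \<le> - l + 6 * l\<^sup>2" using l by (simp add: power2_eq_square)
      then have "exp (ln 2 + 3 * l\<^sup>2) \<le> exp (- l + 6 * l\<^sup>2)" by simp
      then have "2 * exp (3 * l\<^sup>2) \<le> exp (- l) * exp (6 * l\<^sup>2)" by (simp only: exp_add) simp
      also have "\<dots> \<le> exp (- l) * (2 * cosh (6 * l\<^sup>2))"
        by (intro mult_left_mono) (simp_all add: cosh_def)
      finally have "exp (3 * l\<^sup>2) \<le> exp (- l) * cosh (6 * l\<^sup>2)" by simp
      then have "exp (3 * l\<^sup>2) * D \<le> exp (- l) * cosh (6 * l\<^sup>2) * D" using D_nonneg by (rule mult_right_mono)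
      then show "exp (3 * l\<^sup>2) * D / cosh (6 * l\<^sup>2) \<le> D * exp (- l)"
        by (simp add: pos_divide_le_eq mult_ac)
    qed
    finally show ?thesis .
  qed
  have "emeasure (law T) {\<omega>. \<exists>s\<in>set \<omega>. r < N (err s)}
      \<le> (\<Sum>t<T. emeasure (law (Suc t)) {\<omega>. length \<omega> = Suc t \<and> r < N (err (hd \<omega>))})"
    by (rule emeasure_ex_le_sum)
  also have "\<dots> \<le> (\<Sum>t<T. ennreal (D * exp (- l)))" by (rule sum_mono) (use each in auto)
  also have "\<dots> = ennreal (real T * (D * exp (- l)))"
    using D_nonneg by (simp add: ennreal_mult' ennreal_of_nat_eq_real_of_nat)
  finally show ?thesis .
qed

end

section \<open>One step of cubic regularization\<close>

lemma lipschitz_gradient_hessian_bound: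
  fixes f :: "real^'d \<Rightarrow> real"
  assumes twice: "twice_differentiable f" and L: "0 \<le> L"
    and lip: "\<And>x y. norm (gradient f x - gradient f y) \<le> L * norm (x - y)"
  shows "spectral_norm (hessian f x) \<le> L"
proof (rule spectral_norm_leI[OF _ L])
  fix u :: "real^'d"
  define w where "w = hessian f x *v u"
  define k where "k t = inner (gradient f (x + t *\<^sub>R u)) w" for t
  have "(k has_real_derivative inner (hessian f (x + 0 *\<^sub>R u) *v u) w) (at 0)"
    unfolding k_def by (rule gradient_line_deriv[OF twice])
  then have "((\<lambda>t. (k t - k 0) / (t - 0)) \<longlongrightarrow> inner w w) (at 0)"
    unfolding has_field_derivative_iff by (simp add: w_def)
  then have lim: "((\<lambda>t. (k t - k 0) / (t - 0)) \<longlongrightarrow> inner w w) (at_right 0)"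
    by (rule tendsto_mono[rotated]) (rule at_le, simp)
  have "(k t - k 0) / (t - 0) \<le> L * norm u * norm w" if "t > 0" for t
  proof -
    have "k t - k 0 = inner (gradient f (x + t *\<^sub>R u) - gradient f x) w"
      by (simp add: k_def inner_diff_left)
    also have "\<dots> \<le> norm (gradient f (x + t *\<^sub>R u) - gradient f x) * norm w" by (rule norm_cauchy_schwarz)
    also have "\<dots> \<le> (L * norm (x + t *\<^sub>R u - x)) * norm w" by (intro mult_right_mono lip) simp
    also have "\<dots> = t * (L * norm u * norm w)" using that by simp
    finally show ?thesis using that by (simp add: pos_divide_le_eq mult.commute)
  qed
  then have "eventually (\<lambda>t. (k t - k 0) / (t - 0) \<le> L * norm u * norm w) (at_right 0)"
    by (rule eventually_mono[OF eventually_at_right_less])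
  then have "inner w w \<le> L * norm u * norm w" by (rule tendsto_upperbound[OF lim]) simp
  moreover have "inner w w = norm w * norm w" by (metis power2_eq_square power2_norm_eq_inner)
  ultimately have *: "norm w * norm w \<le> (L * norm u) * norm w" by simp
  show "norm (hessian f x *v u) \<le> L * norm u"
  proof (cases "w = 0")
    case True
    then show ?thesis using L by (simp add: w_def)
  next
    case False
    then have "norm w \<le> L * norm u" by (intro mult_right_le_imp_le[OF *]) simp
    then show ?thesis by (simp only: w_def)
  qed
qed

lemma norm_mean_le:
  fixes a :: "nat \<Rightarrow> 'a::real_normed_vector"
  assumes n: "n \<ge> 1" and a: "\<And>i. i \<in> {1..n} \<Longrightarrow> norm (a i) \<le> c"
  shows "norm ((1 / real n) *\<^sub>R (\<Sum>i\<in>{1..n}. a i)) \<le> c"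
proof -
  have "norm (\<Sum>i\<in>{1..n}. a i) \<le> real (card {1..n}) * c"
    by (rule order_trans[OF norm_sum sum_bounded_above]) (use a in auto)
  then have "norm (\<Sum>i\<in>{1..n}. a i) \<le> real n * c" by simp
  then show ?thesis using n by (simp add: pos_divide_le_eq mult.commute)
qed

lemma spectral_norm_mean_le:
  fixes A :: "nat \<Rightarrow> real^'d^'d"
  assumes n: "n \<ge> 1" and A: "\<And>i. i \<in> {1..n} \<Longrightarrow> spectral_norm (A i) \<le> c"
  shows "spectral_norm ((1 / real n) *\<^sub>R (\<Sum>i\<in>{1..n}. A i)) \<le> c"
proof (rule spectral_norm_leI)
  show "0 \<le> c" using order_trans[OF spectral_norm_nonneg A[of 1]] n by simp
  fix u :: "real^'d"
  have "norm ((1 / real n) *\<^sub>R (\<Sum>i\<in>{1..n}. A i *v u)) \<le> c * norm u"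
    by (rule norm_mean_le[OF n], rule order_trans[OF norm_mult_spectral_norm_le mult_right_mono[OF A]]) auto
  then show "norm (((1 / real n) *\<^sub>R (\<Sum>i\<in>{1..n}. A i)) *v u) \<le> c * norm u"
    by (simp add: sum_matrix_vector scaleR_matrix_vector_assoc)
qed

lemma sum_diff_mean:
  fixes a :: "nat \<Rightarrow> 'a::real_vector"
  assumes "n \<ge> 1" and "m = (1 / real n) *\<^sub>R (\<Sum>i\<in>{1..n}. a i)"
  shows "(\<Sum>i\<in>{1..n}. a i - m) = 0"
  using assms by (simp add: sum_subtractf sum_constant_scaleR)

lemma spectral_norm_diff_le: "spectral_norm (A - B) \<le> spectral_norm A + spectral_norm B"
  using spectral_norm_triangle[of A "(-1) *\<^sub>R B"] spectral_norm_scaleR[of "-1" B] by simp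

context lipschitz_hessian
begin

text \<open>A long step decreases the objective. Only \<open>cubic_model v U (4 \<rho>) h \<le> 0\<close> is used: the cubic terms then
  leave \<open>- \<rho> r\<^sup>3 / 2\<close>, where \<open>r = norm h\<close>, and the two estimation errors cost at most \<open>\<rho> r\<^sup>3 / 5\<close> and \<open>\<rho> r\<^sup>3 / 8\<close>.\<close>

lemma cubic_step_descent:
  assumes rho: "\<rho> > 0" and s: "s > 0"
    and min: "is_arg_min (cubic_model v U (4 * \<rho>)) (\<lambda>_. True) h"
    and v: "norm (v - gradient f x) \<le> \<rho> * s\<^sup>2 / 5" and U: "spectral_norm (U - hessian f x) \<le> \<rho> * s / 4"
    and h: "norm h > s"
  shows "f (x + h) \<le> f x - 7 / 40 * \<rho> * s ^ 3"
proof -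
  define r where "r = norm h"
  have r: "s \<le> r" "0 \<le> r" using h s by (auto simp: r_def)
  define E where "E = U - hessian f x"
  have "cubic_model v U (4 * \<rho>) h \<le> 0" using is_arg_min_le[OF min, of 0] by simp
  then have m: "inner v h + 1 / 2 * inner (U *v h) h + 2 / 3 * (\<rho> * r ^ 3) \<le> 0"
    by (simp add: cubic_model_def r_def)
  have gv: "- inner (v - gradient f x) h \<le> \<rho> * r ^ 3 / 5"
  proof -
    have "- inner (v - gradient f x) h \<le> norm (v - gradient f x) * r"
      using Cauchy_Schwarz_ineq2[of "v - gradient f x" h] by (simp add: r_def abs_le_iff)
    also have "\<dots> \<le> \<rho> * s\<^sup>2 / 5 * r" using r by (intro mult_right_mono v) auto
    also have "\<dots> \<le> \<rho> * r\<^sup>2 / 5 * r"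
      using r s rho by (intro mult_right_mono divide_right_mono mult_left_mono power_mono) auto
    finally show ?thesis by (simp add: eval_nat_numeral mult_ac)
  qed
  have gU: "- inner (E *v h) h \<le> \<rho> * r ^ 3 / 4"
  proof -
    have "- inner (E *v h) h \<le> norm (E *v h) * r"
      using Cauchy_Schwarz_ineq2[of "E *v h" h] by (simp add: r_def abs_le_iff)
    also have "\<dots> \<le> (\<rho> * s / 4 * r) * r"
      using order_trans[OF norm_mult_spectral_norm_le mult_right_mono[OF U]] r
      by (intro mult_right_mono) (auto simp: r_def E_def)
    also have "\<dots> \<le> (\<rho> * r / 4 * r) * r"
      using r s rho by (intro mult_right_mono divide_right_mono mult_left_mono) auto
    finally show ?thesis by (simp add: eval_nat_numeral mult_ac)
  qed
  have e1: "inner (gradient f x) h = inner v h - inner (v - gradient f x) h"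
    by (simp add: inner_diff_left)
  have e2: "inner (hessian f x *v h) h = inner (U *v h) h - inner (E *v h) h"
    by (simp add: E_def inner_diff_left matrix_vector_mult_diff_rdistrib)
  have R: "\<rho> * s ^ 3 \<le> \<rho> * r ^ 3" using r s rho by (intro mult_left_mono power_mono) auto
  have "f (x + h) \<le> f x + inner (gradient f x) h + 1 / 2 * inner (hessian f x *v h) h + \<rho> / 6 * norm h ^ 3"
    by (rule cubic_taylor)
  then have t: "f (x + h) \<le> f x + (inner v h - inner (v - gradient f x) h)
      + 1 / 2 * (inner (U *v h) h - inner (E *v h) h) + \<rho> * r ^ 3 / 6"
    unfolding e1 e2 r_def by simp
  have arith: "y \<le> z - 7 / 40 * P" if "P \<le> R" "y \<le> z + (a - b) + 1 / 2 * (c - d) + R / 6"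
    "a + 1 / 2 * c + 2 / 3 * R \<le> 0" "- b \<le> R / 5" "- d \<le> R / 4" for y z a b c d P R :: real
    using that by (simp add: field_simps)
  show ?thesis using arith[OF R t m gv gU] by (simp only: mult.assoc)
qed

text \<open>A short step leads to an approximate local minimum.\<close>

lemma cubic_step_stop:
  assumes rho: "\<rho> > 0" and s: "s > 0"
    and min: "is_arg_min (cubic_model v U (4 * \<rho>)) (\<lambda>_. True) h" and symU: "transpose U = U"
    and v: "norm (v - gradient f x) \<le> \<rho> * s\<^sup>2 / 5" and U: "spectral_norm (U - hessian f x) \<le> \<rho> * s / 4"
    and h: "norm h \<le> s"
  shows "norm (gradient f (x + h)) \<le> 3 * \<rho> * s\<^sup>2"
    and "norm u = 1 \<Longrightarrow> inner (hessian f (x + h) *v u) u \<ge> - (7 * \<rho> * s)"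
proof -
  have hs: "norm h ^ 2 \<le> s\<^sup>2" using h by (intro power_mono) auto
  have Uh: "norm ((U - hessian f x) *v w) \<le> \<rho> * s / 4 * norm w" for w
    by (rule order_trans[OF norm_mult_spectral_norm_le mult_right_mono[OF U]]) simp
  let ?a = "gradient f (x + h) - gradient f x - hessian f x *v h"
  have "norm (gradient f (x + h)) = norm (?a - (v - gradient f x) - (U - hessian f x) *v h + (v + U *v h))"
    by (simp add: matrix_vector_mult_diff_rdistrib)
  also have "\<dots> \<le> norm ?a + norm (v - gradient f x) + norm ((U - hessian f x) *v h) + norm (v + U *v h)"
    using norm_triangle_ineq[of "?a - (v - gradient f x) - (U - hessian f x) *v h" "v + U *v h"]
      norm_triangle_ineq4[of "?a - (v - gradient f x)" "(U - hessian f x) *v h"]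
      norm_triangle_ineq4[of ?a "v - gradient f x"] by linarith
  also have "\<dots> \<le> \<rho> / 2 * s\<^sup>2 + \<rho> * s\<^sup>2 / 5 + \<rho> * s\<^sup>2 / 4 + 2 * \<rho> * s\<^sup>2"
  proof (intro add_mono v)
    show "norm ?a \<le> \<rho> / 2 * s\<^sup>2"
      using rho by (intro order_trans[OF gradient_taylor] mult_left_mono hs) auto
    have "\<rho> * s / 4 * norm h \<le> \<rho> * s / 4 * s" using rho s h by (intro mult_left_mono) auto
    then show "norm ((U - hessian f x) *v h) \<le> \<rho> * s\<^sup>2 / 4"
      using Uh[of h] by (simp add: power2_eq_square)
    have "norm (v + U *v h) \<le> 4 * \<rho> / 2 * norm h ^ 2"
      by (rule cubic_argmin_stationary[OF min symU]) (use rho in simp)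
    also have "\<dots> \<le> 2 * \<rho> * s\<^sup>2" using mult_left_mono[OF hs, of "2 * \<rho>"] rho by simp
    finally show "norm (v + U *v h) \<le> 2 * \<rho> * s\<^sup>2" .
  qed
  also have "\<dots> \<le> 3 * \<rho> * s\<^sup>2"
  proof -
    have "0 \<le> \<rho> * s\<^sup>2" using rho by simp
    then show ?thesis by (simp add: field_simps)
  qed
  finally show "norm (gradient f (x + h)) \<le> 3 * \<rho> * s\<^sup>2" .
  assume u: "norm u = 1"
  have a: "inner (U *v u) u \<ge> - (4 * (4 * \<rho>) / 3) * s"
    by (rule cubic_argmin_curvature[OF min symU _ s h u]) (use rho in simp)
  have b: "inner ((U - hessian f x) *v u) u \<le> \<rho> * s / 4"
    using norm_cauchy_schwarz[of "(U - hessian f x) *v u" u] Uh[of u] u by simp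
  have c: "- inner ((hessian f (x + h) - hessian f x) *v u) u \<le> \<rho> * s"
  proof -
    have "- inner ((hessian f (x + h) - hessian f x) *v u) u \<le> norm ((hessian f (x + h) - hessian f x) *v u)"
      using Cauchy_Schwarz_ineq2[of "(hessian f (x + h) - hessian f x) *v u" u] u by (simp add: abs_le_iff)
    also have "\<dots> \<le> \<rho> * norm h" using hessian_diff_le[of "x + h" x u] u by simp
    also have "\<dots> \<le> \<rho> * s" using rho h by (intro mult_left_mono) auto
    finally show ?thesis .
  qed
  have d: "inner (hessian f (x + h) *v u) u = inner ((hessian f (x + h) - hessian f x) *v u) u
      - inner ((U - hessian f x) *v u) u + inner (U *v u) u"
    by (simp add: matrix_vector_mult_diff_rdistrib inner_diff_left)
  have "0 \<le> \<rho> * s" using rho s by simp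
  then show "inner (hessian f (x + h) *v u) u \<ge> - (7 * \<rho> * s)"
    using a b c unfolding d by (simp add: field_simps)
qed

end

section \<open>The algorithm\<close>

text \<open>The hypotheses on the objective, the parameters and the batch sizes of a run of the algorithm.\<close>

locale srvrc_run =
  fixes n T Sg Sh :: nat
    and f :: "nat \<Rightarrow> real^'d \<Rightarrow> real"
    and F :: "real^'d \<Rightarrow> real"
    and x0 :: "real^'d"
    and \<Delta> L \<rho> M \<epsilon> \<xi> :: real
    and Bg Bh :: "'d history \<Rightarrow> nat"
    and pick :: "'d history \<Rightarrow> nat multiset \<Rightarrow> nat multiset \<Rightarrow> (real^'d) set \<Rightarrow> (real^'d) pmf"
  assumes n: "n \<ge> 1"
    and F: "F = average n f"
    and diff: "\<And>i. i \<in> {1..n} \<Longrightarrow> twice_differentiable (f i)"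
    and pos: "\<Delta> > 0" "L > 0" "\<rho> > 0" "M > 0"
    and gap: "bdd_below (range F)" "F x0 - (INF x. F x) \<le> \<Delta>"
    and grad_lip: "\<And>i x y. i \<in> {1..n} \<Longrightarrow>
          norm (gradient (f i) x - gradient (f i) y) \<le> L * norm (x - y)"
    and hess_lip: "\<And>i x y. i \<in> {1..n} \<Longrightarrow>
          spectral_norm (hessian (f i) x - hessian (f i) y) \<le> \<rho> * norm (x - y)"
    and grad_dev: "\<And>i x. i \<in> {1..n} \<Longrightarrow> norm (gradient (f i) x - gradient F x) \<le> M"
    and eps: "\<epsilon> > 0"
    and xi: "0 < \<xi>" "\<xi> < 1"
    and epochs: "Sg > 0" "Sh > 0"
    and T: "real T \<ge> 40 * \<Delta> * \<rho> powr (1/2) * \<epsilon> powr (-3/2)"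
    and pick: "\<And>\<omega> J I S. S \<noteq> {} \<Longrightarrow> set_pmf (pick \<omega> J I S) \<subseteq> S"
    and batch_pos: "\<And>t \<omega>. \<lbrakk>t < T; \<omega> \<in> set_pmf (srvrc n f x0 \<epsilon> \<rho> (\<lambda>_. 4 * \<rho>) Sg Sh Bg Bh pick t);
            \<not> stopped \<epsilon> \<rho> \<omega>\<rbrakk> \<Longrightarrow> Bg \<omega> > 0 \<and> Bh \<omega> > 0"
    and batch_g_inner: "\<And>t \<omega>. \<lbrakk>t < T; \<omega> \<in> set_pmf (srvrc n f x0 \<epsilon> \<rho> (\<lambda>_. 4 * \<rho>) Sg Sh Bg Bh pick t);
            \<not> stopped \<epsilon> \<rho> \<omega>; t mod Sg \<noteq> 0\<rbrakk> \<Longrightarrow>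
          real (Bg \<omega>) \<ge> min (real n)
            (1440 * L^2 * real Sg * norm (iter_h (hd \<omega>))^2 * (ln (2 * real T / \<xi>))^2 / \<epsilon>^2)"
    and batch_h_inner: "\<And>t \<omega>. \<lbrakk>t < T; \<omega> \<in> set_pmf (srvrc n f x0 \<epsilon> \<rho> (\<lambda>_. 4 * \<rho>) Sg Sh Bg Bh pick t);
            \<not> stopped \<epsilon> \<rho> \<omega>; t mod Sh \<noteq> 0\<rbrakk> \<Longrightarrow>
          real (Bh \<omega>) \<ge> min (real n)
            (800 * \<rho> * real Sh * norm (iter_h (hd \<omega>))^2
               * (ln (2 * real T * real CARD('d) / \<xi>))^2 / \<epsilon>)"
    and batch_g_outer: "\<And>t \<omega>. \<lbrakk>t < T; \<omega> \<in> set_pmf (srvrc n f x0 \<epsilon> \<rho> (\<lambda>_. 4 * \<rho>) Sg Sh Bg Bh pick t);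
            \<not> stopped \<epsilon> \<rho> \<omega>; t mod Sg = 0\<rbrakk> \<Longrightarrow>
          real (Bg \<omega>) \<ge> min (real n) (1440 * M^2 * (ln (2 * real T / \<xi>))^2 / \<epsilon>^2)"
    and batch_h_outer: "\<And>t \<omega>. \<lbrakk>t < T; \<omega> \<in> set_pmf (srvrc n f x0 \<epsilon> \<rho> (\<lambda>_. 4 * \<rho>) Sg Sh Bg Bh pick t);
            \<not> stopped \<epsilon> \<rho> \<omega>; t mod Sh = 0\<rbrakk> \<Longrightarrow>
          real (Bh \<omega>) \<ge> min (real n)
            (800 * L^2 * (ln (2 * real T * real CARD('d) / \<xi>))^2 / (\<rho> * \<epsilon>))"
begin

abbreviation "law \<equiv> srvrc n f x0 \<epsilon> \<rho> (\<lambda>_. 4 * \<rho>) Sg Sh Bg Bh pick"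
abbreviation "step \<equiv> srvrc_step n f x0 \<epsilon> \<rho> (\<lambda>_. 4 * \<rho>) Sg Sh Bg Bh pick"

text \<open>The gradient and Hessian estimators computed in the iteration after history \<open>\<omega>\<close> from the sampled
  indices, and the iteration that results when the step \<open>h\<close> is taken.\<close>

definition new_v :: "'d history \<Rightarrow> nat multiset \<Rightarrow> real^'d" where
  "new_v \<omega> J = (if length \<omega> mod Sg = 0 then batch_gradient n f J (current_point x0 \<omega>)
     else batch_gradient n f J (current_point x0 \<omega>) - batch_gradient n f J (iter_x (hd \<omega>)) + iter_v (hd \<omega>))"

definition new_U :: "'d history \<Rightarrow> nat multiset \<Rightarrow> real^'d^'d" where
  "new_U \<omega> I = (if length \<omega> mod Sh = 0 then batch_hessian n f I (current_point x0 \<omega>)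
     else batch_hessian n f I (current_point x0 \<omega>) - batch_hessian n f I (iter_x (hd \<omega>)) + iter_U (hd \<omega>))"

definition new_iteration :: "'d history \<Rightarrow> nat multiset \<Rightarrow> nat multiset \<Rightarrow> real^'d \<Rightarrow> 'd iteration" where
  "new_iteration \<omega> J I h = \<lparr>iter_x = current_point x0 \<omega>, iter_J = J, iter_I = I,
     iter_v = new_v \<omega> J, iter_U = new_U \<omega> I, iter_h = h\<rparr>"

text \<open>The estimation errors in an iteration.\<close>

definition grad_error :: "'d iteration \<Rightarrow> real^'d" where
  "grad_error it = iter_v it - gradient F (iter_x it)"

definition hess_error :: "'d iteration \<Rightarrow> real^'d^'d" where
  "hess_error it = iter_U it - hessian F (iter_x it)"

lemma step_unstopped:
  assumes "\<not> stopped \<epsilon> \<rho> \<omega>"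
  shows "step \<omega> = do {
      J \<leftarrow> sample_indices n (Bg \<omega>);
      I \<leftarrow> sample_indices n (Bh \<omega>);
      h \<leftarrow> pick \<omega> J I {h. is_arg_min (cubic_model (new_v \<omega> J) (new_U \<omega> I) (4 * \<rho>)) (\<lambda>_. True) h};
      return_pmf (new_iteration \<omega> J I h # \<omega>)}"
  using assms by (simp add: srvrc_step_def Let_def new_iteration_def new_v_def new_U_def)

lemma set_step:
  assumes "\<not> stopped \<epsilon> \<rho> \<omega>" "\<omega>' \<in> set_pmf (step \<omega>)"
  obtains J I h where "\<omega>' = new_iteration \<omega> J I h # \<omega>"
    "J \<in> set_pmf (sample_indices n (Bg \<omega>))" "I \<in> set_pmf (sample_indices n (Bh \<omega>))"
    "is_arg_min (cubic_model (new_v \<omega> J) (new_U \<omega> I) (4 * \<rho>)) (\<lambda>_. True) h"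
proof -
  obtain J I h where JI: "J \<in> set_pmf (sample_indices n (Bg \<omega>))" "I \<in> set_pmf (sample_indices n (Bh \<omega>))"
    and h: "h \<in> set_pmf (pick \<omega> J I {h. is_arg_min (cubic_model (new_v \<omega> J) (new_U \<omega> I) (4 * \<rho>)) (\<lambda>_. True) h})"
    and w: "\<omega>' = new_iteration \<omega> J I h # \<omega>"
    using assms(2) unfolding step_unstopped[OF assms(1)] by auto
  have "{h. is_arg_min (cubic_model (new_v \<omega> J) (new_U \<omega> I) (4 * \<rho>)) (\<lambda>_. True) h} \<noteq> {}"
    using pos by (intro cubic_model_argmin_exists) simp
  from subsetD[OF pick[OF this] h]
  have "is_arg_min (cubic_model (new_v \<omega> J) (new_U \<omega> I) (4 * \<rho>)) (\<lambda>_. True) h" by simp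
  with w JI show thesis by (rule that)
qed

lemma process: "history_process (stopped \<epsilon> \<rho>) step law"
proof
  show "set_pmf (step \<omega>) \<subseteq> range (\<lambda>s. s # \<omega>)" if "\<not> stopped \<epsilon> \<rho> \<omega>" for \<omega>
    using set_step[OF that] by blast
  show "step \<omega> = return_pmf \<omega>" if "stopped \<epsilon> \<rho> \<omega>" for \<omega>
    using that by (simp add: srvrc_step_def)
qed simp_all

sublocale history_process "stopped \<epsilon> \<rho>" step law by (rule process)

lemma nn_integral_step_v:
  assumes "\<not> stopped \<epsilon> \<rho> \<omega>"
  shows "(\<integral>\<^sup>+\<omega>'. \<Psi> (grad_error (hd \<omega>')) \<partial>measure_pmf (step \<omega>))
    = (\<integral>\<^sup>+J. \<Psi> (new_v \<omega> J - gradient F (current_point x0 \<omega>)) \<partial>measure_pmf (sample_indices n (Bg \<omega>)))"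
  by (simp add: step_unstopped[OF assms] new_iteration_def grad_error_def)

lemma nn_integral_step_U:
  assumes "\<not> stopped \<epsilon> \<rho> \<omega>"
  shows "(\<integral>\<^sup>+\<omega>'. \<Psi> (hess_error (hd \<omega>')) \<partial>measure_pmf (step \<omega>))
    = (\<integral>\<^sup>+I. \<Psi> (new_U \<omega> I - hessian F (current_point x0 \<omega>)) \<partial>measure_pmf (sample_indices n (Bh \<omega>)))"
  by (simp add: step_unstopped[OF assms] new_iteration_def hess_error_def)

lemma gradient_F: "gradient F x = (1 / real n) *\<^sub>R (\<Sum>i\<in>{1..n}. gradient (f i) x)"
  unfolding F by (rule gradient_eqI[OF gradient_average[OF diff]])

lemma hessian_F: "hessian F x = (1 / real n) *\<^sub>R (\<Sum>i\<in>{1..n}. hessian (f i) x)"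
  unfolding F by (rule hessian_eqI[OF hessian_average[OF diff]])

lemma lipschitz_hessian_f: "i \<in> {1..n} \<Longrightarrow> lipschitz_hessian (f i) \<rho>"
  using pos by unfold_locales (auto intro: diff hess_lip)

lemma mean_scaled_diff:
  fixes a b :: "nat \<Rightarrow> 'b::real_vector"
  shows "(1 / real n) *\<^sub>R (\<Sum>i\<in>{1..n}. a i) - (1 / real n) *\<^sub>R (\<Sum>i\<in>{1..n}. b i)
    = (1 / real n) *\<^sub>R (\<Sum>i\<in>{1..n}. a i - b i)"
  by (simp add: sum_subtractf scaleR_diff_right)

sublocale F: lipschitz_hessian F \<rho>
proof
  show "twice_differentiable F" unfolding F by (rule twice_differentiable_average[OF diff])
  show "0 \<le> \<rho>" using pos by simp
  show "spectral_norm (hessian F x - hessian F y) \<le> \<rho> * norm (x - y)" for x y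
    unfolding hessian_F mean_scaled_diff by (rule spectral_norm_mean_le[OF n hess_lip])
qed

lemma gradient_F_lip: "norm (gradient F x - gradient F y) \<le> L * norm (x - y)"
  unfolding gradient_F mean_scaled_diff by (rule norm_mean_le[OF n grad_lip])

lemma hessian_f_bound: "i \<in> {1..n} \<Longrightarrow> spectral_norm (hessian (f i) x) \<le> L"
  using pos by (intro lipschitz_gradient_hessian_bound diff grad_lip) auto

lemma hessian_F_bound: "spectral_norm (hessian F x) \<le> L"
  unfolding hessian_F by (rule spectral_norm_mean_le[OF n hessian_f_bound])

lemma batch_gradient_minibatch: "batch_gradient n f J x = minibatch n (\<lambda>i. gradient (f i)) (gradient F) J x"
  by (simp add: batch_gradient_def minibatch_def F)

lemma batch_hessian_minibatch: "batch_hessian n f I x = minibatch n (\<lambda>i. hessian (f i)) (hessian F) I x"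
  by (simp add: batch_hessian_def minibatch_def F)

lemma hessian_deviation_symmetric: "i \<in> {1..n} \<Longrightarrow> hessian (f i) x - hessian F x \<in> {A. transpose A = A}"
  using lipschitz_hessian.hessian_symmetric[OF lipschitz_hessian_f] F.hessian_symmetric
  by (intro subspace_diff[OF subspace_symmetric]) auto

lemma batch_hessian_symmetric:
  assumes "set_mset I \<subseteq> {1..n}"
  shows "batch_hessian n f I x \<in> {A. transpose A = A}"
proof -
  have "(\<Sum>i\<in>#I. hessian (f i) x) \<in> {A. transpose A = A}" using assms
  proof (induction I)
    case empty
    then show ?case using subspace_0[OF subspace_symmetric] by simp
  next
    case (add i I)
    then have "hessian (f i) x \<in> {A. transpose A = A}"
      using lipschitz_hessian.hessian_symmetric[OF lipschitz_hessian_f] by simp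
    then have "hessian (f i) x + (\<Sum>i\<in>#I. hessian (f i) x) \<in> {A. transpose A = A}"
      using add by (intro subspace_add[OF subspace_symmetric]) auto
    then show ?case by simp
  qed
  then have "(1 / real (size I)) *\<^sub>R (\<Sum>i\<in>#I. hessian (f i) x) \<in> {A. transpose A = A}"
    by (rule subspace_scale[OF subspace_symmetric])
  then show ?thesis using F.hessian_symmetric[of x] by (auto simp: batch_hessian_def F)
qed

lemma iter_U_symmetric:
  assumes "\<omega> \<in> set_pmf (law t)" "\<omega> \<noteq> []"
  shows "transpose (iter_U (hd \<omega>)) = iter_U (hd \<omega>)"
  using assms
proof (induction t arbitrary: \<omega>)
  case (Suc t)
  then obtain \<omega>0 where w0: "\<omega>0 \<in> set_pmf (law t)" "\<omega> \<in> set_pmf (step \<omega>0)" by auto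
  show ?case
  proof (cases "stopped \<epsilon> \<rho> \<omega>0")
    case True
    then show ?thesis using w0 Suc step_stop by simp
  next
    case False
    from set_step[OF this w0(2)] obtain J I h where w: "\<omega> = new_iteration \<omega>0 J I h # \<omega>0"
      and I: "I \<in> set_pmf (sample_indices n (Bh \<omega>0))" by metis
    have b: "batch_hessian n f I x \<in> {A. transpose A = A}" for x
      by (rule batch_hessian_symmetric[OF set_sample_indices(2)[OF n I]])
    have "new_U \<omega>0 I \<in> {A. transpose A = A}"
    proof (cases "length \<omega>0 mod Sh = 0")
      case False
      then have "\<omega>0 \<noteq> []" by auto
      then have "iter_U (hd \<omega>0) \<in> {A. transpose A = A}" using Suc.IH[OF w0(1)] by simp
      then show ?thesis unfolding new_U_def using False
        by (simp only: if_False) (intro subspace_add[OF subspace_symmetric] subspace_diff[OF subspace_symmetric] b)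
    qed (use b in \<open>simp add: new_U_def\<close>)
    then show ?thesis by (simp add: w new_iteration_def)
  qed
qed simp

lemma hess_error_symmetric:
  assumes "\<omega> \<in> set_pmf (law t)" "\<omega> \<noteq> []"
  shows "hess_error (hd \<omega>) \<in> {A. transpose A = A}"
  unfolding hess_error_def using iter_U_symmetric[OF assms] F.hessian_symmetric
  by (intro subspace_diff[OF subspace_symmetric]) auto

lemma T_pos: "T > 0"
proof -
  have "0 < 40 * \<Delta> * \<rho> powr (1/2) * \<epsilon> powr (-3/2)" using pos eps by simp
  then show ?thesis using T by linarith
qed

text \<open>The logarithms in the batch sizes of the gradients and of the Hessians.\<close>

definition "log_g = ln (2 * real T / \<xi>)"
definition "log_h = ln (2 * real T * real CARD('d) / \<xi>)"

lemma log_g_ge: "ln 2 \<le> log_g"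
proof -
  have "2 * \<xi> \<le> 2 * real T" using T_pos xi by linarith
  then have "2 \<le> 2 * real T / \<xi>" using xi by (simp add: field_simps)
  then show ?thesis unfolding log_g_def by (subst ln_le_cancel_iff) auto
qed

lemma log_h_ge: "ln 2 \<le> log_h"
proof -
  have "\<xi> * 1 \<le> real T * real CARD('d)" using T_pos xi by (intro mult_mono) (auto simp: Suc_le_eq)
  then have "2 \<le> 2 * real T * real CARD('d) / \<xi>" using xi by (simp add: field_simps)
  then show ?thesis unfolding log_h_def by (subst ln_le_cancel_iff) auto
qed

lemma exp_log_g: "real T * (1 * exp (- log_g)) = \<xi> / 2"
  using T_pos xi by (simp add: log_g_def exp_minus)

lemma exp_log_h: "real T * (real CARD('d) * exp (- log_h)) = \<xi> / 2"
  using T_pos xi by (simp add: log_h_def exp_minus)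

lemma displacement:
  "\<omega> \<noteq> [] \<Longrightarrow> norm (current_point x0 \<omega> - iter_x (hd \<omega>)) = norm (iter_h (hd \<omega>))"
  by (simp add: current_point_def)

text \<open>The batch sizes bound the variance proxy of one iteration: with \<open>q = (\<epsilon> / 5)\<^sup>2 / (12 log_g\<^sup>2)\<close>, the samples
  of a refresh deviate by at most \<open>M\<close>, and those of an update by at most \<open>2 L\<close> times the length of the
  previous step.\<close>

lemma grad_error_tail:
  "emeasure (law T) {\<omega>. \<exists>it\<in>set \<omega>. \<epsilon> / 5 < norm (grad_error it)} \<le> ennreal (\<xi> / 2)"
proof -
  interpret V: cosh_potential "UNIV :: (real^'d) set" norm "\<lambda>e. ennreal (cosh (norm e))" 1
    by (rule cosh_potential_vector)
  define q where "q = (\<epsilon> / 5)\<^sup>2 / (12 * log_g\<^sup>2)"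
  have l0: "log_g > 0" using log_g_ge ln_gt_zero[of "2::real"] by linarith
  have q0: "q \<ge> 0" by (simp add: q_def)
  have mean: "(\<Sum>i\<in>{1..n}. gradient (f i) x - gradient F x) = 0" for x
    by (rule sum_diff_mean[OF n gradient_F])
  have "emeasure (law T) {\<omega>. \<exists>it\<in>set \<omega>. \<epsilon> / 5 < norm (grad_error it)} \<le> ennreal (real T * (1 * exp (- log_g)))"
  proof (rule V.estimator_tail[OF process epochs(1) log_g_ge _ q_def])
    show "0 < \<epsilon> / 5" using eps by simp
    fix t \<omega> and \<theta> :: real
    assume t: "t < T" and w: "\<omega> \<in> set_pmf (law t)" and ns: "\<not> stopped \<epsilon> \<rho> \<omega>" and th: "\<theta> \<ge> 0"
    note B = batch_pos[OF t w ns, THEN conjunct1]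
    have len: "length \<omega> = t" by (rule length_law(2)[OF w ns])
    let ?x = "current_point x0 \<omega>"
    {
      assume m: "t mod Sg = 0"
      have "M\<^sup>2 \<le> q * real (Bg \<omega>)" if "Bg \<omega> < n"
      proof -
        have "1440 * M\<^sup>2 * log_g\<^sup>2 / \<epsilon>\<^sup>2 \<le> real (Bg \<omega>)"
          using batch_g_outer[OF t w ns m] that by (simp add: log_g_def min_def split: if_splits)
        then have le: "q * (1440 * M\<^sup>2 * log_g\<^sup>2 / \<epsilon>\<^sup>2) \<le> q * real (Bg \<omega>)" by (intro mult_left_mono q0)
        have eq: "q * (1440 * M\<^sup>2 * log_g\<^sup>2 / \<epsilon>\<^sup>2) = 24 / 5 * M\<^sup>2"
          using l0 eps by (simp add: q_def field_simps)
        show ?thesis using le[unfolded eq] zero_le_power2[of M] by linarith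
      qed
      then have "(\<integral>\<^sup>+J. ennreal (cosh (norm (\<theta> *\<^sub>R (minibatch n (\<lambda>i. gradient (f i)) (gradient F) J ?x - gradient F ?x))))
           \<partial>measure_pmf (sample_indices n (Bg \<omega>))) \<le> ennreal (exp (\<theta>\<^sup>2 * q / 2)) * ennreal 1"
        using pos by (intro V.nn_integral_refresh[where g = "\<lambda>i. gradient (f i)" and gbar = "gradient F" and c = M]
            n B th q0 grad_dev mean) auto
      then show "(\<integral>\<^sup>+\<omega>'. ennreal (cosh (norm (\<theta> *\<^sub>R grad_error (hd \<omega>')))) \<partial>step \<omega>)
          \<le> ennreal (exp (\<theta>\<^sup>2 * q / 2)) * ennreal 1"
        unfolding nn_integral_step_v[OF ns, of "\<lambda>e. ennreal (cosh (norm (\<theta> *\<^sub>R e)))"]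
        using m by (simp add: new_v_def len batch_gradient_minibatch)
    next
      assume m: "t mod Sg \<noteq> 0"
      then have ne: "\<omega> \<noteq> []" using len by auto
      let ?y = "iter_x (hd \<omega>)" and ?h = "norm (iter_h (hd \<omega>))"
      have "(2 * L * ?h)\<^sup>2 \<le> q / real Sg * real (Bg \<omega>)" if "Bg \<omega> < n"
      proof -
        have "1440 * L\<^sup>2 * real Sg * ?h\<^sup>2 * log_g\<^sup>2 / \<epsilon>\<^sup>2 \<le> real (Bg \<omega>)"
          using batch_g_inner[OF t w ns m] that by (simp add: log_g_def min_def split: if_splits)
        then have le: "q / real Sg * (1440 * L\<^sup>2 * real Sg * ?h\<^sup>2 * log_g\<^sup>2 / \<epsilon>\<^sup>2) \<le> q / real Sg * real (Bg \<omega>)"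
          using q0 by (intro mult_left_mono) auto
        have eq: "q / real Sg * (1440 * L\<^sup>2 * real Sg * ?h\<^sup>2 * log_g\<^sup>2 / \<epsilon>\<^sup>2) = 24 / 5 * (L * ?h)\<^sup>2"
          using l0 eps epochs by (simp add: q_def field_simps)
        have "(2 * L * ?h)\<^sup>2 = 4 * (L * ?h)\<^sup>2" by (simp add: power_mult_distrib)
        also have "\<dots> \<le> 24 / 5 * (L * ?h)\<^sup>2" by (rule mult_right_mono) simp_all
        also note le[unfolded eq]
        finally show ?thesis .
      qed
      moreover have "norm ((gradient (f i) ?x - gradient F ?x) - (gradient (f i) ?y - gradient F ?y)) \<le> 2 * L * ?h"
        if "i \<in> {1..n}" for i
      proof -
        have swap: "(gradient (f i) ?x - gradient F ?x) - (gradient (f i) ?y - gradient F ?y)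
            = (gradient (f i) ?x - gradient (f i) ?y) - (gradient F ?x - gradient F ?y)" by simp
        show ?thesis unfolding swap
          using norm_triangle_ineq4[of "gradient (f i) ?x - gradient (f i) ?y" "gradient F ?x - gradient F ?y"]
            grad_lip[OF that, of ?x ?y] gradient_F_lip[of ?x ?y] displacement[OF ne] by simp
      qed
      ultimately have "(\<integral>\<^sup>+J. ennreal (cosh (norm (\<theta> *\<^sub>R (minibatch n (\<lambda>i. gradient (f i)) (gradient F) J ?x
            - minibatch n (\<lambda>i. gradient (f i)) (gradient F) J ?y + iter_v (hd \<omega>) - gradient F ?x))))
           \<partial>measure_pmf (sample_indices n (Bg \<omega>)))
          \<le> ennreal (exp (\<theta>\<^sup>2 * (q / real Sg) / 2)) * ennreal (cosh (norm (\<theta> *\<^sub>R (iter_v (hd \<omega>) - gradient F ?y))))"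
        using pos q0 by (intro V.nn_integral_update[OF n B th, where c = "2 * L * ?h"] mean) auto
      then show "(\<integral>\<^sup>+\<omega>'. ennreal (cosh (norm (\<theta> *\<^sub>R grad_error (hd \<omega>')))) \<partial>step \<omega>)
          \<le> ennreal (exp (\<theta>\<^sup>2 * (q / real Sg) / 2)) * ennreal (cosh (norm (\<theta> *\<^sub>R grad_error (hd \<omega>))))"
        unfolding nn_integral_step_v[OF ns, of "\<lambda>e. ennreal (cosh (norm (\<theta> *\<^sub>R e)))"]
        using m by (simp add: new_v_def len batch_gradient_minibatch grad_error_def)
    }
  qed auto
  then show ?thesis unfolding exp_log_g .
qed

text \<open>As for the gradients, with \<open>q = (sqrt (\<rho> \<epsilon>) / 4)\<^sup>2 / (12 log_h\<^sup>2)\<close>. The samples of a refresh deviate by at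
  most \<open>2 L\<close>, since the gradients are \<open>L\<close>-Lipschitz, and those of an update by at most \<open>2 \<rho>\<close> times the length of
  the previous step.\<close>

lemma hess_error_tail:
  "emeasure (law T) {\<omega>. \<exists>it\<in>set \<omega>. sqrt (\<rho> * \<epsilon>) / 4 < spectral_norm (hess_error it)} \<le> ennreal (\<xi> / 2)"
proof -
  interpret V: cosh_potential "{A :: real^'d^'d. transpose A = A}" spectral_norm trace_cosh "real CARD('d)"
    by (rule cosh_potential_matrix)
  define q where "q = (sqrt (\<rho> * \<epsilon>) / 4)\<^sup>2 / (12 * log_h\<^sup>2)"
  have l0: "log_h > 0" using log_h_ge ln_gt_zero[of "2::real"] by linarith
  have q0: "q \<ge> 0" by (simp add: q_def)
  have q': "q = \<rho> * \<epsilon> / (192 * log_h\<^sup>2)"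
    using pos eps by (simp add: q_def power_divide)
  have mean: "(\<Sum>i\<in>{1..n}. hessian (f i) x - hessian F x) = 0" for x
    by (rule sum_diff_mean[OF n hessian_F])
  have "emeasure (law T) {\<omega>. \<exists>it\<in>set \<omega>. sqrt (\<rho> * \<epsilon>) / 4 < spectral_norm (hess_error it)}
      \<le> ennreal (real T * (real CARD('d) * exp (- log_h)))"
  proof (rule V.estimator_tail[OF process epochs(2) log_h_ge _ q_def])
    show "0 < sqrt (\<rho> * \<epsilon>) / 4" using eps pos by simp
    fix t \<omega> and \<theta> :: real
    assume t: "t < T" and w: "\<omega> \<in> set_pmf (law t)" and ns: "\<not> stopped \<epsilon> \<rho> \<omega>" and th: "\<theta> \<ge> 0"
    note B = batch_pos[OF t w ns, THEN conjunct2]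
    have len: "length \<omega> = t" by (rule length_law(2)[OF w ns])
    let ?x = "current_point x0 \<omega>"
    {
      assume m: "t mod Sh = 0"
      have "(2 * L)\<^sup>2 \<le> q * real (Bh \<omega>)" if "Bh \<omega> < n"
      proof -
        have "800 * L\<^sup>2 * log_h\<^sup>2 / (\<rho> * \<epsilon>) \<le> real (Bh \<omega>)"
          using batch_h_outer[OF t w ns m] that by (simp add: log_h_def min_def split: if_splits)
        then have le: "q * (800 * L\<^sup>2 * log_h\<^sup>2 / (\<rho> * \<epsilon>)) \<le> q * real (Bh \<omega>)" by (intro mult_left_mono q0)
        have eq: "q * (800 * L\<^sup>2 * log_h\<^sup>2 / (\<rho> * \<epsilon>)) = 25 / 6 * L\<^sup>2"
          using l0 eps pos by (simp add: q' field_simps)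
        have "(2 * L)\<^sup>2 = 4 * L\<^sup>2" by (simp add: power_mult_distrib)
        then show ?thesis using le[unfolded eq] zero_le_power2[of L] by linarith
      qed
      moreover have "spectral_norm (hessian (f i) ?x - hessian F ?x) \<le> 2 * L" if "i \<in> {1..n}" for i
        using spectral_norm_diff_le[of "hessian (f i) ?x" "hessian F ?x"] hessian_f_bound[OF that, of ?x] hessian_F_bound[of ?x]
        by simp
      ultimately have "(\<integral>\<^sup>+J. trace_cosh (\<theta> *\<^sub>R (minibatch n (\<lambda>i. hessian (f i)) (hessian F) J ?x - hessian F ?x))
           \<partial>measure_pmf (sample_indices n (Bh \<omega>))) \<le> ennreal (exp (\<theta>\<^sup>2 * q / 2)) * ennreal (real CARD('d))"
        using pos by (intro V.nn_integral_refresh[where g = "\<lambda>i. hessian (f i)" and gbar = "hessian F" and c = "2 * L"]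
            n B th q0 hessian_deviation_symmetric mean) auto
      then show "(\<integral>\<^sup>+\<omega>'. trace_cosh (\<theta> *\<^sub>R hess_error (hd \<omega>')) \<partial>step \<omega>)
          \<le> ennreal (exp (\<theta>\<^sup>2 * q / 2)) * ennreal (real CARD('d))"
        unfolding nn_integral_step_U[OF ns, of "\<lambda>e. trace_cosh (\<theta> *\<^sub>R e)"]
        using m by (simp add: new_U_def len batch_hessian_minibatch)
    next
      assume m: "t mod Sh \<noteq> 0"
      then have ne: "\<omega> \<noteq> []" using len by auto
      let ?y = "iter_x (hd \<omega>)" and ?h = "norm (iter_h (hd \<omega>))"
      have "(2 * \<rho> * ?h)\<^sup>2 \<le> q / real Sh * real (Bh \<omega>)" if "Bh \<omega> < n"
      proof -
        have "800 * \<rho> * real Sh * ?h\<^sup>2 * log_h\<^sup>2 / \<epsilon> \<le> real (Bh \<omega>)"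
          using batch_h_inner[OF t w ns m] that by (simp add: log_h_def min_def split: if_splits)
        then have le: "q / real Sh * (800 * \<rho> * real Sh * ?h\<^sup>2 * log_h\<^sup>2 / \<epsilon>) \<le> q / real Sh * real (Bh \<omega>)"
          using q0 by (intro mult_left_mono) auto
        have eq: "q / real Sh * (800 * \<rho> * real Sh * ?h\<^sup>2 * log_h\<^sup>2 / \<epsilon>) = 25 / 6 * (\<rho> * ?h)\<^sup>2"
          using l0 eps epochs by (simp add: q' field_simps power2_eq_square)
        have "(2 * \<rho> * ?h)\<^sup>2 = 4 * (\<rho> * ?h)\<^sup>2" by (simp add: power_mult_distrib)
        also have "\<dots> \<le> 25 / 6 * (\<rho> * ?h)\<^sup>2" by (rule mult_right_mono) simp_all
        also note le[unfolded eq]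
        finally show ?thesis .
      qed
      moreover have "spectral_norm ((hessian (f i) ?x - hessian F ?x) - (hessian (f i) ?y - hessian F ?y)) \<le> 2 * \<rho> * ?h"
        if "i \<in> {1..n}" for i
      proof -
        have swap: "(hessian (f i) ?x - hessian F ?x) - (hessian (f i) ?y - hessian F ?y)
            = (hessian (f i) ?x - hessian (f i) ?y) - (hessian F ?x - hessian F ?y)" by simp
        show ?thesis unfolding swap
          using spectral_norm_diff_le[of "hessian (f i) ?x - hessian (f i) ?y" "hessian F ?x - hessian F ?y"]
            hess_lip[OF that, of ?x ?y] F.lip[of ?x ?y] displacement[OF ne] by simp
      qed
      moreover have "iter_U (hd \<omega>) - hessian F ?y \<in> {A. transpose A = A}"
        using hess_error_symmetric[OF w ne] by (simp only: hess_error_def)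
      ultimately have "(\<integral>\<^sup>+J. trace_cosh (\<theta> *\<^sub>R (minibatch n (\<lambda>i. hessian (f i)) (hessian F) J ?x
            - minibatch n (\<lambda>i. hessian (f i)) (hessian F) J ?y + iter_U (hd \<omega>) - hessian F ?x))
           \<partial>measure_pmf (sample_indices n (Bh \<omega>)))
          \<le> ennreal (exp (\<theta>\<^sup>2 * (q / real Sh) / 2)) * trace_cosh (\<theta> *\<^sub>R (iter_U (hd \<omega>) - hessian F ?y))"
        using pos q0 by (intro V.nn_integral_update[OF n B th, where c = "2 * \<rho> * ?h"] mean hessian_deviation_symmetric) auto
      then show "(\<integral>\<^sup>+\<omega>'. trace_cosh (\<theta> *\<^sub>R hess_error (hd \<omega>')) \<partial>step \<omega>)
          \<le> ennreal (exp (\<theta>\<^sup>2 * (q / real Sh) / 2)) * trace_cosh (\<theta> *\<^sub>R hess_error (hd \<omega>))"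
        unfolding nn_integral_step_U[OF ns, of "\<lambda>e. trace_cosh (\<theta> *\<^sub>R e)"]
        using m by (simp add: new_U_def len batch_hessian_minibatch hess_error_def)
    }
  qed (rule hess_error_symmetric)
  then show ?thesis unfolding exp_log_h .
qed

text \<open>An iteration whose gradient and Hessian estimates are accurate.\<close>

definition good :: "'d iteration \<Rightarrow> bool" where
  "good it \<longleftrightarrow> norm (grad_error it) \<le> \<epsilon> / 5 \<and> spectral_norm (hess_error it) \<le> sqrt (\<rho> * \<epsilon>) / 4"

lemma prob_good: "measure_pmf.prob (law T) {\<omega>. \<forall>it\<in>set \<omega>. good it} \<ge> 1 - \<xi>"
proof -
  let ?A = "{\<omega>. \<exists>it\<in>set \<omega>. \<epsilon> / 5 < norm (grad_error it)}"
  let ?B = "{\<omega>. \<exists>it\<in>set \<omega>. sqrt (\<rho> * \<epsilon>) / 4 < spectral_norm (hess_error it)}"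
  have "emeasure (law T) (?A \<union> ?B) \<le> emeasure (law T) ?A + emeasure (law T) ?B"
    by (rule emeasure_subadditive) simp_all
  also have "\<dots> \<le> ennreal (\<xi> / 2) + ennreal (\<xi> / 2)"
    by (intro add_mono grad_error_tail hess_error_tail)
  also have "\<dots> = ennreal \<xi>" using xi by (simp flip: ennreal_plus)
  finally have "measure_pmf.prob (law T) (?A \<union> ?B) \<le> \<xi>"
    using xi by (simp add: measure_pmf.emeasure_eq_measure)
  moreover have "{\<omega>. \<forall>it\<in>set \<omega>. good it} = UNIV - (?A \<union> ?B)"
    by (auto simp: good_def not_less not_le)
  ultimately show ?thesis using measure_pmf.prob_compl[of "?A \<union> ?B" "law T"] by simp
qed

text \<open>The length of a step at or below which the algorithm stops.\<close>

definition "radius = sqrt (\<epsilon> / \<rho>)"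

lemma radius_pos: "radius > 0"
  using pos eps by (simp add: radius_def)

lemma rho_radius_sq: "\<rho> * radius\<^sup>2 = \<epsilon>"
  using pos eps by (simp add: radius_def)

lemma rho_radius: "\<rho> * radius = sqrt (\<rho> * \<epsilon>)"
proof (rule real_sqrt_unique[symmetric])
  show "(\<rho> * radius)\<^sup>2 = \<rho> * \<epsilon>"
    by (subst rho_radius_sq[symmetric]) (simp add: power2_eq_square)
qed (use pos radius_pos in simp)

text \<open>As long as all estimates are accurate, the objective decreases by a fixed amount in each iteration
  that does not stop, and the point reached by a stopping iteration is an approximate local minimum.\<close>

lemma trajectory:
  assumes "\<omega> \<in> set_pmf (law t)" "\<forall>it\<in>set \<omega>. good it"
  shows "if stopped \<epsilon> \<rho> \<omega>
    then norm (gradient F (current_point x0 \<omega>)) \<le> 3 * \<epsilon>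
         \<and> lambda_min (hessian F (current_point x0 \<omega>)) \<ge> - (7 * sqrt (\<rho> * \<epsilon>))
    else F (current_point x0 \<omega>) \<le> F x0 - real t * (7 / 40 * \<rho> * radius ^ 3)"
  using assms
proof (induction t arbitrary: \<omega>)
  case 0
  then show ?case by (simp add: stopped_def current_point_def)
next
  case (Suc t)
  then obtain \<omega>0 where w0: "\<omega>0 \<in> set_pmf (law t)" "\<omega> \<in> set_pmf (step \<omega>0)" by auto
  show ?case
  proof (cases "stopped \<epsilon> \<rho> \<omega>0")
    case True
    then have "\<omega> = \<omega>0" using w0 step_stop by simp
    then show ?thesis using Suc.IH[OF w0(1)] Suc.prems True by simp
  next
    case False
    from set_step[OF this w0(2)] obtain J I h where w: "\<omega> = new_iteration \<omega>0 J I h # \<omega>0"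
      and min: "is_arg_min (cubic_model (new_v \<omega>0 J) (new_U \<omega>0 I) (4 * \<rho>)) (\<lambda>_. True) h" by metis
    let ?x = "current_point x0 \<omega>0"
    have next_point: "current_point x0 \<omega> = ?x + h" by (simp add: w current_point_def new_iteration_def)
    have stop: "stopped \<epsilon> \<rho> \<omega> \<longleftrightarrow> norm h \<le> radius"
      by (simp add: w stopped_def new_iteration_def radius_def)
    have "good (new_iteration \<omega>0 J I h)" using Suc.prems(2) w by simp
    then have v: "norm (new_v \<omega>0 J - gradient F ?x) \<le> \<rho> * radius\<^sup>2 / 5"
      and U: "spectral_norm (new_U \<omega>0 I - hessian F ?x) \<le> \<rho> * radius / 4"
      unfolding rho_radius_sq rho_radius by (simp_all add: good_def grad_error_def hess_error_def new_iteration_def)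
    have symU: "transpose (new_U \<omega>0 I) = new_U \<omega>0 I"
      using iter_U_symmetric[OF Suc.prems(1)] by (simp add: w new_iteration_def)
    show ?thesis
    proof (cases "norm h \<le> radius")
      case True
      have "norm (gradient F (?x + h)) \<le> 3 * \<rho> * radius\<^sup>2"
        by (rule F.cubic_step_stop(1)[OF pos(3) radius_pos min symU v U True])
      then have "norm (gradient F (?x + h)) \<le> 3 * \<epsilon>"
        by (simp only: mult.assoc rho_radius_sq)
      moreover have "lambda_min (hessian F (?x + h)) \<ge> - (7 * \<rho> * radius)"
        by (rule lambda_min_ge[OF F.hessian_symmetric F.cubic_step_stop(2)[OF pos(3) radius_pos min symU v U True]])
      then have "lambda_min (hessian F (?x + h)) \<ge> - (7 * sqrt (\<rho> * \<epsilon>))"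
        by (simp only: mult.assoc rho_radius)
      ultimately show ?thesis using True stop by (simp add: next_point)
    next
      case nle: False
      have "F (?x + h) \<le> F ?x - 7 / 40 * \<rho> * radius ^ 3"
        using nle by (intro F.cubic_step_descent[OF pos(3) radius_pos min v U]) simp
      moreover have "F ?x \<le> F x0 - real t * (7 / 40 * \<rho> * radius ^ 3)"
        using Suc.IH[OF w0(1)] Suc.prems(2) False by (simp add: w)
      moreover have "real (Suc t) * (7 / 40 * \<rho> * radius ^ 3)
          = real t * (7 / 40 * \<rho> * radius ^ 3) + 7 / 40 * \<rho> * radius ^ 3"
        by (simp add: distrib_right)
      ultimately have "F (?x + h) \<le> F x0 - real (Suc t) * (7 / 40 * \<rho> * radius ^ 3)" by linarith
      then show ?thesis using nle stop by (simp add: next_point)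
    qed
  qed
qed

text \<open>A run of \<open>T\<close> long steps would decrease the objective by more than the initial gap.\<close>

lemma total_descent: "\<Delta> < real T * (7 / 40 * \<rho> * radius ^ 3)"
proof -
  have rad: "radius = (\<epsilon> / \<rho>) powr (1/2)" using pos eps by (simp add: radius_def powr_half_sqrt)
  have "radius ^ 3 = radius powr 3" using radius_pos by (simp add: powr_numeral)
  also have "\<dots> = ((\<epsilon> / \<rho>) powr (1/2)) powr 3" by (simp only: rad)
  also have "((\<epsilon> / \<rho>) powr (1/2)) powr 3 = \<epsilon> powr (3/2) / \<rho> powr (3/2)"
    using pos eps by (simp add: powr_powr powr_divide)
  finally have r3: "radius ^ 3 = \<epsilon> powr (3/2) / \<rho> powr (3/2)" .
  have e: "\<epsilon> powr (-3/2) * \<epsilon> powr (3/2) = 1" using eps by (simp flip: powr_add)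
  have r: "\<rho> powr (1/2) * \<rho> = \<rho> powr (3/2)"
    using pos powr_add[of \<rho> "1/2" 1] by simp
  have "\<rho> powr (3/2) > 0" using pos by simp
  have "(40 * \<Delta> * \<rho> powr (1/2) * \<epsilon> powr (-3/2)) * (7 / 40 * \<rho> * radius ^ 3)
      = 7 * \<Delta> * (\<epsilon> powr (-3/2) * \<epsilon> powr (3/2)) * ((\<rho> powr (1/2) * \<rho>) / \<rho> powr (3/2))"
    unfolding r3 by simp
  also have "\<dots> = 7 * \<Delta>" unfolding e r using \<open>\<rho> powr (3/2) > 0\<close> by simp
  finally have "(40 * \<Delta> * \<rho> powr (1/2) * \<epsilon> powr (-3/2)) * (7 / 40 * \<rho> * radius ^ 3) = 7 * \<Delta>" .
  moreover have "(40 * \<Delta> * \<rho> powr (1/2) * \<epsilon> powr (-3/2)) * (7 / 40 * \<rho> * radius ^ 3)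
      \<le> real T * (7 / 40 * \<rho> * radius ^ 3)"
    using T pos radius_pos by (intro mult_right_mono) auto
  ultimately show ?thesis using pos by linarith
qed

lemma good_output:
  assumes w: "\<omega> \<in> set_pmf (law T)" and good: "\<forall>it\<in>set \<omega>. good it"
  shows "\<exists>x_out. srvrc_output x0 \<epsilon> \<rho> \<omega> = Some x_out
     \<and> norm (gradient F x_out) \<le> 3 * \<epsilon> \<and> lambda_min (hessian F x_out) \<ge> - (7 * sqrt (\<rho> * \<epsilon>))"
proof (cases "stopped \<epsilon> \<rho> \<omega>")
  case True
  then show ?thesis using trajectory[OF w good] by (simp add: srvrc_output_def)
next
  case False
  then have "F (current_point x0 \<omega>) \<le> F x0 - real T * (7 / 40 * \<rho> * radius ^ 3)"
    using trajectory[OF w good] by simp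
  moreover have "(INF x. F x) \<le> F (current_point x0 \<omega>)" by (rule cINF_lower[OF gap(1)]) simp
  ultimately show ?thesis using gap(2) total_descent by linarith
qed

lemma mu_bound:
  assumes g: "norm (gradient F x) \<le> 3 * \<epsilon>" and l: "lambda_min (hessian F x) \<ge> - (7 * sqrt (\<rho> * \<epsilon>))"
  shows "mu \<rho> F x \<le> 600 * \<epsilon> powr (3/2)"
    and "approx_local_min F (600 powr (2/3) * \<epsilon>) (600 powr (1/3) * sqrt (\<rho> * \<epsilon>)) x"
proof -
  have three: "(3::real) \<le> 600 powr (2/3)"
  proof -
    have "(27::real) powr (1/3) \<le> 600 powr (2/3)"
    proof -
      have "(27::real) powr (1/3) \<le> 600 powr (1/3)" by (rule powr_mono2) simp_all
      also have "\<dots> \<le> 600 powr (2/3)" by (rule powr_mono) simp_all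
      finally show ?thesis .
    qed
    moreover have "(27::real) powr (1/3) = 3"
      using powr_powr[of 3 3 "1/3"] by simp
    ultimately show ?thesis by simp
  qed
  have seven: "(7::real) \<le> 600 powr (1/3)"
  proof -
    have "(343::real) powr (1/3) \<le> 600 powr (1/3)" by (rule powr_mono2) simp_all
    moreover have "(343::real) powr (1/3) = 7"
      using powr_powr[of 7 3 "1/3"] by simp
    ultimately show ?thesis by simp
  qed
  have s0: "0 \<le> sqrt (\<rho> * \<epsilon>)" using pos eps by simp
  have "3 * \<epsilon> \<le> 600 powr (2/3) * \<epsilon>" using three eps by (intro mult_right_mono) auto
  moreover have "7 * sqrt (\<rho> * \<epsilon>) \<le> 600 powr (1/3) * sqrt (\<rho> * \<epsilon>)" by (rule mult_right_mono[OF seven s0])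
  ultimately show "approx_local_min F (600 powr (2/3) * \<epsilon>) (600 powr (1/3) * sqrt (\<rho> * \<epsilon>)) x"
    unfolding approx_local_min_def using g l by linarith
  have e0: "0 \<le> \<epsilon> powr (3/2)" by simp
  have "norm (gradient F x) powr (3/2) \<le> (3 * \<epsilon>) powr (3/2)" by (rule powr_mono2) (use g in simp_all)
  also have "\<dots> = 3 powr (3/2) * \<epsilon> powr (3/2)" using eps by (simp add: powr_mult)
  also have "\<dots> \<le> 600 * \<epsilon> powr (3/2)"
  proof (rule mult_right_mono[OF _ e0])
    have "(3::real) powr (3/2) \<le> 3 powr 2" by (rule powr_mono) simp_all
    also have "\<dots> = 9" by (simp add: powr_numeral)
    finally show "(3::real) powr (3/2) \<le> 600" by simp
  qed
  finally have a: "norm (gradient F x) powr (3/2) \<le> 600 * \<epsilon> powr (3/2)" .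
  let ?l = "lambda_min (hessian F x)"
  have "- (?l ^ 3) \<le> 343 * sqrt (\<rho> * \<epsilon>) ^ 3"
  proof -
    have "(- ?l) ^ 3 \<le> (7 * sqrt (\<rho> * \<epsilon>)) ^ 3"
      using l s0 power_mono_odd[of 3 "- ?l" "7 * sqrt (\<rho> * \<epsilon>)"] by simp
    then show ?thesis by (simp add: power_mult_distrib)
  qed
  also have "sqrt (\<rho> * \<epsilon>) ^ 3 = \<rho> powr (3/2) * \<epsilon> powr (3/2)"
  proof -
    have "sqrt (\<rho> * \<epsilon>) ^ 3 = sqrt (\<rho> * \<epsilon>) powr 3" using pos eps by (simp add: powr_numeral)
    also have "\<dots> = ((\<rho> * \<epsilon>) powr (1/2)) powr 3" using pos eps by (simp add: powr_half_sqrt)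
    also have "\<dots> = \<rho> powr (3/2) * \<epsilon> powr (3/2)" using pos eps by (simp add: powr_powr powr_mult)
    finally show ?thesis .
  qed
  finally have "- (?l ^ 3) / \<rho> powr (3/2) \<le> 343 * (\<rho> powr (3/2) * \<epsilon> powr (3/2)) / \<rho> powr (3/2)"
    by (rule divide_right_mono) simp
  also have "\<dots> = 343 * \<epsilon> powr (3/2)" using pos by simp
  also have "\<dots> \<le> 600 * \<epsilon> powr (3/2)" using e0 by simp
  finally have b: "- (?l ^ 3) / \<rho> powr (3/2) \<le> 600 * \<epsilon> powr (3/2)" .
  show "mu \<rho> F x \<le> 600 * \<epsilon> powr (3/2)" unfolding mu_def using a b by simp
qed

lemma prob_output:
  "measure_pmf.prob (law T)
     {\<omega>. \<exists>x_out. srvrc_output x0 \<epsilon> \<rho> \<omega> = Some x_out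
          \<and> mu \<rho> F x_out \<le> 600 * \<epsilon> powr (3/2)
          \<and> approx_local_min F (600 powr (2/3) * \<epsilon>) (600 powr (1/3) * sqrt (\<rho> * \<epsilon>)) x_out} \<ge> 1 - \<xi>"
    (is "measure_pmf.prob _ ?G \<ge> _")
proof -
  have "1 - \<xi> \<le> measure_pmf.prob (law T) {\<omega>. \<forall>it\<in>set \<omega>. good it}" by (rule prob_good)
  also have "\<dots> \<le> measure_pmf.prob (law T) ?G"
  proof (rule measure_pmf.finite_measure_mono_AE)
    show "AE \<omega> in law T. \<omega> \<in> {\<omega>. \<forall>it\<in>set \<omega>. good it} \<longrightarrow> \<omega> \<in> ?G"
      unfolding AE_measure_pmf_iff using good_output mu_bound by fast
  qed simp
  finally show ?thesis .
qed

end

theorem theorem4p2: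
  fixes n T Sg Sh :: nat
    and f :: "nat \<Rightarrow> real^'d \<Rightarrow> real"
    and F :: "real^'d \<Rightarrow> real"
    and x0 :: "real^'d"
    and \<Delta> L \<rho> M \<epsilon> \<xi> :: real
    and Bg Bh :: "'d history \<Rightarrow> nat"
    and pick :: "'d history \<Rightarrow> nat multiset \<Rightarrow> nat multiset \<Rightarrow> (real^'d) set \<Rightarrow> (real^'d) pmf"
  assumes n: "n \<ge> 1"
    and F: "F = average n f"
    and diff: "\<And>i. i \<in> {1..n} \<Longrightarrow> twice_differentiable (f i)"
    and pos: "\<Delta> > 0" "L > 0" "\<rho> > 0" "M > 0"
    and gap: "bdd_below (range F)" "F x0 - (INF x. F x) \<le> \<Delta>"
    and grad_lip: "\<And>i x y. i \<in> {1..n} \<Longrightarrow>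
          norm (gradient (f i) x - gradient (f i) y) \<le> L * norm (x - y)"
    and hess_lip: "\<And>i x y. i \<in> {1..n} \<Longrightarrow>
          spectral_norm (hessian (f i) x - hessian (f i) y) \<le> \<rho> * norm (x - y)"
    and grad_dev: "\<And>i x. i \<in> {1..n} \<Longrightarrow> norm (gradient (f i) x - gradient F x) \<le> M"
    and eps: "\<epsilon> > 0"
    and xi: "0 < \<xi>" "\<xi> < 1"
    and epochs: "Sg > 0" "Sh > 0"
    and T: "real T \<ge> 40 * \<Delta> * \<rho> powr (1/2) * \<epsilon> powr (-3/2)"
    and pick: "\<And>\<omega> J I S. S \<noteq> {} \<Longrightarrow> set_pmf (pick \<omega> J I S) \<subseteq> S"
    and batch_pos: "\<And>t \<omega>. \<lbrakk>t < T; \<omega> \<in> set_pmf (srvrc n f x0 \<epsilon> \<rho> (\<lambda>_. 4 * \<rho>) Sg Sh Bg Bh pick t);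
            \<not> stopped \<epsilon> \<rho> \<omega>\<rbrakk> \<Longrightarrow> Bg \<omega> > 0 \<and> Bh \<omega> > 0"
    and batch_g_inner: "\<And>t \<omega>. \<lbrakk>t < T; \<omega> \<in> set_pmf (srvrc n f x0 \<epsilon> \<rho> (\<lambda>_. 4 * \<rho>) Sg Sh Bg Bh pick t);
            \<not> stopped \<epsilon> \<rho> \<omega>; t mod Sg \<noteq> 0\<rbrakk> \<Longrightarrow>
          real (Bg \<omega>) \<ge> min (real n)
            (1440 * L^2 * real Sg * norm (iter_h (hd \<omega>))^2 * (ln (2 * real T / \<xi>))^2 / \<epsilon>^2)"
    and batch_h_inner: "\<And>t \<omega>. \<lbrakk>t < T; \<omega> \<in> set_pmf (srvrc n f x0 \<epsilon> \<rho> (\<lambda>_. 4 * \<rho>) Sg Sh Bg Bh pick t);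
            \<not> stopped \<epsilon> \<rho> \<omega>; t mod Sh \<noteq> 0\<rbrakk> \<Longrightarrow>
          real (Bh \<omega>) \<ge> min (real n)
            (800 * \<rho> * real Sh * norm (iter_h (hd \<omega>))^2
               * (ln (2 * real T * real CARD('d) / \<xi>))^2 / \<epsilon>)"
    and batch_g_outer: "\<And>t \<omega>. \<lbrakk>t < T; \<omega> \<in> set_pmf (srvrc n f x0 \<epsilon> \<rho> (\<lambda>_. 4 * \<rho>) Sg Sh Bg Bh pick t);
            \<not> stopped \<epsilon> \<rho> \<omega>; t mod Sg = 0\<rbrakk> \<Longrightarrow>
          real (Bg \<omega>) \<ge> min (real n) (1440 * M^2 * (ln (2 * real T / \<xi>))^2 / \<epsilon>^2)"
    and batch_h_outer: "\<And>t \<omega>. \<lbrakk>t < T; \<omega> \<in> set_pmf (srvrc n f x0 \<epsilon> \<rho> (\<lambda>_. 4 * \<rho>) Sg Sh Bg Bh pick t);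
            \<not> stopped \<epsilon> \<rho> \<omega>; t mod Sh = 0\<rbrakk> \<Longrightarrow>
          real (Bh \<omega>) \<ge> min (real n)
            (800 * L^2 * (ln (2 * real T * real CARD('d) / \<xi>))^2 / (\<rho> * \<epsilon>))"
  shows "measure_pmf.prob (srvrc n f x0 \<epsilon> \<rho> (\<lambda>_. 4 * \<rho>) Sg Sh Bg Bh pick T)
           {\<omega>. \<exists>x_out. srvrc_output x0 \<epsilon> \<rho> \<omega> = Some x_out
                \<and> mu \<rho> F x_out \<le> 600 * \<epsilon> powr (3/2)
                \<and> approx_local_min F (600 powr (2/3) * \<epsilon>) (600 powr (1/3) * sqrt (\<rho> * \<epsilon>)) x_out}
         \<ge> 1 - \<xi>"
proof -
  interpret srvrc_run n T Sg Sh f F x0 \<Delta> L \<rho> M \<epsilon> \<xi> Bg Bh pick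
    using assms by (rule srvrc_run.intro)
  show ?thesis by (rule prob_output)
qed

end
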